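(* Let $\sigma_1\ne\sigma_2$ be commuting involutions of a connected reductive group $G$, with associated decomposition $\mathfrak g=\mathfrak g_{00}\oplus\mathfrak g_{01}\oplus\mathfrak g_{10}\oplus\mathfrak g_{11}$. The commutator map $\varphi:\mathfrak g_{10}\times\mathfrak g_{11}\to\mathfrak g_{01}$, $\varphi(x,y)=[x,y]$, is dominant if and only if there exist $x\in\mathfrak g_{10}$ and $y\in\mathfrak g_{11}$ such that $\mathfrak z_{\mathfrak g}(x)_{01}\cap\mathfrak z_{\mathfrak g}(y)_{01}=\{0\}$.
   Context: The ground field $\Bbbk$ is algebraically closed of characteristic $0$; $G$ is a connected reductive algebraic group with Lie algebra $\mathfrak g$. Involutions of $G$ and the induced involutions of $\mathfrak g$ are denoted by the same letters. For commuting involutions $\sigma_1\neq\sigma_2$ set $\mathfrak g_{ij}=\{x\in\mathfrak g\mid \sigma_1(x)=(-1)^i x,\ \sigma_2(x)=(-1)^j x\}$ for $i,j\in\{0,1\}$, so that $\mathfrak g=\bigoplus_{i,j}\mathfrak g_{ij}$. $\mathfrak z_{\mathfrak g}(x)$ is the centraliser of $x$ in $\mathfrak g$, and $\mathfrak z_{\mathfrak g}(x)_{01}=\mathfrak z_{\mathfrak g}(x)\cap\mathfrak g_{01}$. *)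

theory Defs
  imports "HOL-Analysis.Analysis" "HOL-Algebra.Coset"
    "HOL-Computational_Algebra.Polynomial" "HOL-Library.Function_Algebras"
begin

section \<open>Affine varieties and the Zariski topology\<close>

text \<open>
  A \<open>k\<close>-valued function on a set \<open>X\<close> is represented by a total function vanishing outside \<open>X\<close>.
  Hence the unit of an algebra of functions on \<open>X\<close> is the indicator function of \<open>X\<close>, and not
  the constant function \<open>1\<close> of the function type.
\<close>

definition const_on :: "'a set \<Rightarrow> 'k \<Rightarrow> 'a \<Rightarrow> 'k::field" where
  "const_on X c = (\<lambda>x. if x \<in> X then c else 0)"

definition functions_on :: "'a set \<Rightarrow> ('a \<Rightarrow> 'k::field) set" where
  "functions_on X = {f. \<forall>x. x \<notin> X \<longrightarrow> f x = 0}"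

text \<open>The unital algebra of functions on \<open>X\<close> generated by \<open>F\<close>, for \<open>F \<subseteq> functions_on X\<close>.\<close>

inductive_set generated_algebra :: "'a set \<Rightarrow> ('a \<Rightarrow> 'k::field) set \<Rightarrow> ('a \<Rightarrow> 'k) set"
  for X :: "'a set" and F :: "('a \<Rightarrow> 'k) set" where
  generator: "f \<in> F \<Longrightarrow> f \<in> generated_algebra X F"
| const: "const_on X c \<in> generated_algebra X F"
| add: "f \<in> generated_algebra X F \<Longrightarrow> g \<in> generated_algebra X F \<Longrightarrow> f + g \<in> generated_algebra X F"
| mult: "f \<in> generated_algebra X F \<Longrightarrow> g \<in> generated_algebra X F \<Longrightarrow> f * g \<in> generated_algebra X F"

text \<open>Homomorphisms of unital algebras from \<open>A\<close>, an algebra of functions on \<open>X\<close>, to the ground field.\<close>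

definition character :: "'a set \<Rightarrow> ('a \<Rightarrow> 'k::field) set \<Rightarrow> (('a \<Rightarrow> 'k) \<Rightarrow> 'k) \<Rightarrow> bool" where
  "character X A \<epsilon> \<longleftrightarrow>
     (\<forall>c. \<epsilon> (const_on X c) = c) \<and>
     (\<forall>f\<in>A. \<forall>g\<in>A. \<epsilon> (f + g) = \<epsilon> f + \<epsilon> g \<and> \<epsilon> (f * g) = \<epsilon> f * \<epsilon> g)"

text \<open>
  An affine variety over an algebraically closed field is given by its set \<open>X\<close> of points and its
  algebra \<open>A\<close> of regular functions: a finitely generated algebra of functions on \<open>X\<close> for
  which evaluation is a bijection from \<open>X\<close> onto the algebra homomorphisms from \<open>A\<close> to
  the field. The uniqueness of \<open>x\<close> expresses that \<open>A\<close> separates points.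
\<close>

definition affine_variety :: "'a set \<Rightarrow> ('a \<Rightarrow> 'k::alg_closed_field) set \<Rightarrow> bool" where
  "affine_variety X A \<longleftrightarrow>
     (\<exists>F. finite F \<and> F \<subseteq> functions_on X \<and> A = generated_algebra X F) \<and>
     (\<forall>\<epsilon>. character X A \<epsilon> \<longrightarrow> (\<exists>!x. x \<in> X \<and> (\<forall>f\<in>A. \<epsilon> f = f x)))"

definition zariski :: "'a set \<Rightarrow> ('a \<Rightarrow> 'k::field) set \<Rightarrow> 'a topology" where
  "zariski X A = topology_generated_by {{x \<in> X. f x \<noteq> 0} | f. f \<in> A}"

definition pullback :: "'a set \<Rightarrow> ('a \<Rightarrow> 'b) \<Rightarrow> ('b \<Rightarrow> 'k::field) \<Rightarrow> 'a \<Rightarrow> 'k" where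
  "pullback X \<phi> f = (\<lambda>x. if x \<in> X then f (\<phi> x) else 0)"

definition variety_morphism ::
  "'a set \<Rightarrow> ('a \<Rightarrow> 'k::field) set \<Rightarrow> 'b set \<Rightarrow> ('b \<Rightarrow> 'k) set \<Rightarrow> ('a \<Rightarrow> 'b) \<Rightarrow> bool" where
  "variety_morphism X A Y B \<phi> \<longleftrightarrow> \<phi> \<in> X \<rightarrow> Y \<and> (\<forall>f\<in>B. pullback X \<phi> f \<in> A)"

text \<open>The image of the tensor product of \<open>A\<close> and \<open>B\<close>, i.e. the regular functions on the product variety.\<close>

definition product_functions ::
  "('a \<Rightarrow> 'k::field) set \<Rightarrow> ('b \<Rightarrow> 'k) set \<Rightarrow> ('a \<times> 'b \<Rightarrow> 'k) set" where
  "product_functions A B =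
     {\<lambda>(x, y). \<Sum>i<n. g i x * h i y | (n::nat) g h. \<forall>i<n. g i \<in> A \<and> h i \<in> B}"

definition dominant :: "'a set \<Rightarrow> 'b set \<Rightarrow> ('b \<Rightarrow> 'k::field) set \<Rightarrow> ('a \<Rightarrow> 'b) \<Rightarrow> bool" where
  "dominant X Y B \<phi> \<longleftrightarrow> (zariski Y B) closure_of (\<phi> ` X) = Y"


section \<open>Reductive groups\<close>

definition algebraic_group :: "('g, 'm) monoid_scheme \<Rightarrow> ('g \<Rightarrow> 'k::alg_closed_field) set \<Rightarrow> bool" where
  "algebraic_group G A \<longleftrightarrow>
     group G \<and> affine_variety (carrier G) A \<and>
     variety_morphism (carrier G \<times> carrier G) (product_functions A A) (carrier G) A
       (\<lambda>(x, y). x \<otimes>\<^bsub>G\<^esub> y) \<and>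
     variety_morphism (carrier G) A (carrier G) A (\<lambda>x. inv\<^bsub>G\<^esub> x)"

definition left_translate :: "('g, 'm) monoid_scheme \<Rightarrow> 'g \<Rightarrow> ('g \<Rightarrow> 'k::field) \<Rightarrow> 'g \<Rightarrow> 'k" where
  "left_translate G g f = pullback (carrier G) (\<lambda>x. inv\<^bsub>G\<^esub> g \<otimes>\<^bsub>G\<^esub> x) f"

definition right_translate :: "('g, 'm) monoid_scheme \<Rightarrow> 'g \<Rightarrow> ('g \<Rightarrow> 'k::field) \<Rightarrow> 'g \<Rightarrow> 'k" where
  "right_translate G g f = pullback (carrier G) (\<lambda>x. x \<otimes>\<^bsub>G\<^esub> g) f"

text \<open>
  An element is unipotent if right translation by it is a locally unipotent operator on the
  algebra of regular functions.
\<close>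

definition unipotent :: "('g, 'm) monoid_scheme \<Rightarrow> ('g \<Rightarrow> 'k::field) set \<Rightarrow> 'g \<Rightarrow> bool" where
  "unipotent G A u \<longleftrightarrow> (\<forall>f\<in>A. \<exists>n. ((\<lambda>h. right_translate G u h - h) ^^ n) f = 0)"

text \<open>Reductivity: the unipotent radical is trivial.\<close>

definition connected_reductive_group ::
  "('g, 'm) monoid_scheme \<Rightarrow> ('g \<Rightarrow> 'k::alg_closed_field) set \<Rightarrow> bool" where
  "connected_reductive_group G A \<longleftrightarrow>
     algebraic_group G A \<and> connected_space (zariski (carrier G) A) \<and>
     (\<forall>N. N \<lhd> G \<and> closedin (zariski (carrier G) A) N \<and> connectedin (zariski (carrier G) A) N \<and>
          (\<forall>u\<in>N. unipotent G A u) \<longrightarrow> N = {\<one>\<^bsub>G\<^esub>})"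

text \<open>Only the values of \<open>\<sigma>\<close> on the carrier matter, and the order of \<open>\<sigma>\<close> is exactly two.\<close>

definition group_involution ::
  "('g, 'm) monoid_scheme \<Rightarrow> ('g \<Rightarrow> 'k::field) set \<Rightarrow> ('g \<Rightarrow> 'g) \<Rightarrow> bool" where
  "group_involution G A \<sigma> \<longleftrightarrow>
     \<sigma> \<in> hom G G \<and> variety_morphism (carrier G) A (carrier G) A \<sigma> \<and>
     (\<forall>x\<in>carrier G. \<sigma> (\<sigma> x) = x) \<and> (\<exists>x\<in>carrier G. \<sigma> x \<noteq> x)"


section \<open>The Lie algebra of an algebraic group\<close>

type_synonym ('g, 'k) operator = "('g \<Rightarrow> 'k) \<Rightarrow> 'g \<Rightarrow> 'k"

definition scale :: "'k \<Rightarrow> ('g, 'k) operator \<Rightarrow> ('g, 'k::field) operator" where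
  "scale c D = (\<lambda>f x. c * D f x)"

text \<open>
  The Lie algebra consists of the left invariant derivations of \<open>A\<close>. They are extended by zero
  outside \<open>A\<close>, so that equal derivations of \<open>A\<close> are equal as total functions.
\<close>

definition derivations :: "'a set \<Rightarrow> ('a \<Rightarrow> 'k::field) set \<Rightarrow> ('a, 'k) operator set" where
  "derivations X A =
     {D. (\<forall>f\<in>A. D f \<in> A) \<and> (\<forall>f. f \<notin> A \<longrightarrow> D f = 0) \<and>
         (\<forall>c. D (const_on X c) = 0) \<and>
         (\<forall>f\<in>A. \<forall>g\<in>A. D (f + g) = D f + D g \<and> D (f * g) = D f * g + f * D g)}"

definition lie_algebra ::
  "('g, 'm) monoid_scheme \<Rightarrow> ('g \<Rightarrow> 'k::field) set \<Rightarrow> ('g, 'k) operator set" where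
  "lie_algebra G A =
     {D \<in> derivations (carrier G) A.
        \<forall>g\<in>carrier G. \<forall>f\<in>A. D (left_translate G g f) = left_translate G g (D f)}"

definition lie_bracket :: "('g, 'k) operator \<Rightarrow> ('g, 'k) operator \<Rightarrow> ('g, 'k::field) operator" where
  "lie_bracket D E = (\<lambda>f. D (E f) - E (D f))"

text \<open>
  A left invariant derivation \<open>D\<close> corresponds to the tangent vector \<open>f \<mapsto> D f \<one>\<close> at the identity.
  The differential of an endomorphism \<open>\<sigma>\<close> maps this tangent vector to
  \<open>f \<mapsto> D (pullback (carrier G) \<sigma> f) \<one>\<close>; the value at \<open>g\<close> of the corresponding left
  invariant derivation is obtained by evaluating this vector on the translate \<open>x \<mapsto> f (g \<otimes> x)\<close>.
\<close>

definition differential ::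
  "('g, 'm) monoid_scheme \<Rightarrow> ('g \<Rightarrow> 'k::field) set \<Rightarrow> ('g \<Rightarrow> 'g) \<Rightarrow> ('g, 'k) operator \<Rightarrow> ('g, 'k) operator"
  where
  "differential G A \<sigma> D = (\<lambda>f g. if f \<in> A \<and> g \<in> carrier G
     then D (pullback (carrier G) \<sigma> (left_translate G (inv\<^bsub>G\<^esub> g) f)) \<one>\<^bsub>G\<^esub> else 0)"

definition eigen_part ::
  "('g, 'm) monoid_scheme \<Rightarrow> ('g \<Rightarrow> 'k::field) set \<Rightarrow> ('g \<Rightarrow> 'g) \<Rightarrow> ('g \<Rightarrow> 'g) \<Rightarrow> nat \<Rightarrow> nat \<Rightarrow>
   ('g, 'k) operator set" where
  "eigen_part G A \<sigma>\<^sub>1 \<sigma>\<^sub>2 i j =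
     {D \<in> lie_algebra G A. differential G A \<sigma>\<^sub>1 D = scale ((-1) ^ i) D \<and>
                           differential G A \<sigma>\<^sub>2 D = scale ((-1) ^ j) D}"

definition lie_centraliser ::
  "('g, 'm) monoid_scheme \<Rightarrow> ('g \<Rightarrow> 'k::field) set \<Rightarrow> ('g, 'k) operator \<Rightarrow> ('g, 'k) operator set" where
  "lie_centraliser G A D = {E \<in> lie_algebra G A. lie_bracket D E = 0}"

text \<open>
  A linear subspace \<open>V\<close> is regarded as an affine space; its regular functions are the polynomials
  in the linear forms on \<open>V\<close>.
\<close>

definition linear_forms :: "('g, 'k) operator set \<Rightarrow> (('g, 'k::field) operator \<Rightarrow> 'k) set" where
  "linear_forms V = {l \<in> functions_on V.
     (\<forall>D\<in>V. \<forall>E\<in>V. l (D + E) = l D + l E) \<and> (\<forall>c. \<forall>D\<in>V. l (scale c D) = c * l D)}"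

definition polynomial_functions :: "('g, 'k) operator set \<Rightarrow> (('g, 'k::field) operator \<Rightarrow> 'k) set" where
  "polynomial_functions V = generated_algebra V (linear_forms V)"

end

theory Submission
  imports Defs "Jordan_Normal_Form.Determinant"
begin

text \<open>
  The differential of the commutator map at \<open>(x, y)\<close> is \<open>(\<xi>, \<eta>) \<mapsto> [x, \<eta>] + [\<xi>, y]\<close>, and in
  characteristic \<open>0\<close> a polynomial map is dominant if and only if its differential is onto at some
  point. The Lie algebra of a reductive group carries a nondegenerate invariant form that is also
  invariant under the two involutions, so the four eigenspaces are pairwise orthogonal, and the
  orthogonal complement of the image of the differential in \<open>\<gg>\<^sub>0\<^sub>1\<close> consists of the elements
  commuting with \<open>x\<close> and \<open>y\<close>.

  The form is the trace form on a faithful finite-dimensional module \<open>V\<close> of regular functions. Its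
  radical \<open>\<nn>\<close> consists of nilpotent elements: for \<open>D \<in> \<nn>\<close> and a \<open>\<rat>\<close>-linear map \<open>\<phi>\<close> from the ground field to
  \<open>\<rat>\<close>, the operator acting as \<open>\<phi> \<mu>\<close> on the generalised \<open>\<mu>\<close>-eigenspace of \<open>D\<close> lies in the
  Lie algebra, and pairing it with \<open>D\<close> gives \<open>\<Sum> \<phi> \<mu> * \<mu> = 0\<close>, hence \<open>\<Sum> (\<phi> \<mu>)\<^sup>2 = 0\<close>. By Engel's
  theorem \<open>\<nn>\<close> strictly lowers a flag in \<open>V\<close>. The elements of the group acting trivially on the
  quotients of this flag form a closed connected normal unipotent subgroup, which is trivial by
  reductivity and contains \<open>exp D\<close> for all \<open>D \<in> \<nn>\<close>.
\<close>

section \<open>Polynomial expressions and the Jacobian criterion\<close>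

text \<open>The form has to be nondegenerate and compatible with two involutions at once, so the
  module depends on a set \<open>F\<close> of generators of the regular functions. It is faithful
  because a derivation is determined on generators, and the involutions act on it once
  \<open>F\<close> is closed under pulling back along them. Points of the group correspond to
  characters of the algebra \<open>A\<close>. Hence an operator on \<open>A\<close> that is
  multiplicative, unital and commutes with left translations is right translation by a point; this
  is how \<open>exp D\<close>, and the powers \<open>u^t\<close> with \<open>t\<close> in the field
  that make the unipotent group connected, become group elements. With the eigenvalues themselves in
  place of \<phi>, the trace would only give a vanishing sum of squares in an algebraically closed
  field, from which nothing follows; rational squares are conclusive. One direction of the Jacobian
  criterion is a Taylor expansion. In the other, a relation is found by counting on a slice of
  maximal rank and carried to the whole space by comparing orders of vanishing.\<close>

lemma homogeneous_system:
  fixes a :: "'x \<Rightarrow> 'y \<Rightarrow> 'k::field"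
  assumes "finite X" "finite Y" "card X < card Y"
  shows "\<exists>c. (\<exists>y\<in>Y. c y \<noteq> 0) \<and> (\<forall>x\<in>X. (\<Sum>y\<in>Y. a x y * c y) = 0)"
  using assms
proof (induction X arbitrary: Y a rule: finite_induct)
  case empty
  then obtain y where "y \<in> Y"
    by (metis card_gt_0_iff card.empty equals0I)
  then show ?case
    by (intro exI[of _ "\<lambda>_. 1"]) auto
next
  case (insert x X)
  show ?case
  proof (cases "\<forall>y\<in>Y. a x y = 0")
    case True
    have "card X < card Y"
      using insert by simp
    then obtain c where "\<exists>y\<in>Y. c y \<noteq> 0" "\<forall>x\<in>X. (\<Sum>y\<in>Y. a x y * c y) = 0"
      using insert.IH[of Y a] insert.prems by blast
    then show ?thesis
      using True by (intro exI[of _ c]) auto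
  next
    case False
    then obtain y0 where y0: "y0 \<in> Y" "a x y0 \<noteq> 0"
      by blast
    define Z where "Z = Y - {y0}"
    \<comment> \<open>The coefficients of the other equations after equation \<open>x\<close> has
      been solved for the unknown \<open>y0\<close>; \<open>c0\<close> below is that
      solution.\<close>
    define b where "b x' y = a x' y - a x' y0 * a x y / a x y0" for x' y
    have Z: "finite Z" "y0 \<notin> Z" "Y = insert y0 Z" "card X < card Z"
      using insert y0 by (auto simp: Z_def)
    then obtain c where c: "\<exists>y\<in>Z. c y \<noteq> 0" "\<And>x'. x' \<in> X \<Longrightarrow> (\<Sum>y\<in>Z. b x' y * c y) = 0"
      using insert.IH[of Z b] by blast
    define c0 where "c0 = - (\<Sum>y\<in>Z. a x y * c y) / a x y0"
    define c' where "c' = c(y0 := c0)"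
    have sum_c': "(\<Sum>y\<in>Y. f y * c' y) = f y0 * c0 + (\<Sum>y\<in>Z. f y * c y)" for f :: "'y \<Rightarrow> 'k"
    proof -
      have "(\<Sum>y\<in>Z. f y * c' y) = (\<Sum>y\<in>Z. f y * c y)"
        using Z by (intro sum.cong) (auto simp: c'_def)
      then show ?thesis
        using Z by (simp add: c'_def)
    qed
    have "(\<Sum>y\<in>Y. a x y * c' y) = 0"
      using y0 by (simp add: sum_c' c0_def)
    moreover have "(\<Sum>y\<in>Y. a x' y * c' y) = 0" if "x' \<in> X" for x'
    proof -
      have "(\<Sum>y\<in>Z. b x' y * c y) =
          (\<Sum>y\<in>Z. a x' y * c y) - a x' y0 / a x y0 * (\<Sum>y\<in>Z. a x y * c y)"
        by (simp add: b_def algebra_simps sum_subtractf sum_distrib_left)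
      then show ?thesis
        using c(2)[OF that] by (simp add: sum_c' c0_def)
    qed
    moreover have "\<exists>y\<in>Y. c' y \<noteq> 0"
      using c(1) Z by (auto simp: c'_def)
    ultimately show ?thesis
      by (intro exI[of _ c']) auto
  qed
qed

section \<open>Polynomials as expression trees\<close>

datatype 'k pexp = Var nat | Con 'k | Add "'k pexp" "'k pexp" | Mul "'k pexp" "'k pexp"

text \<open>The map \<kappa> embeds the constants in an arbitrary ring, so one tree can be read over
  the field, along a line as a polynomial in one parameter, or along a family of lines as a
  polynomial in two. Taylor coefficients then are coefficients of univariate polynomials.\<close>

primrec ev :: "('k \<Rightarrow> 'r::comm_ring_1) \<Rightarrow> (nat \<Rightarrow> 'r) \<Rightarrow> 'k pexp \<Rightarrow> 'r" where
  "ev \<kappa> x (Var i) = x i"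
| "ev \<kappa> x (Con c) = \<kappa> c"
| "ev \<kappa> x (Add e f) = ev \<kappa> x e + ev \<kappa> x f"
| "ev \<kappa> x (Mul e f) = ev \<kappa> x e * ev \<kappa> x f"

primrec pd :: "nat \<Rightarrow> 'k::comm_ring_1 pexp \<Rightarrow> 'k pexp" where
  "pd j (Var i) = Con (if i = j then 1 else 0)"
| "pd j (Con c) = Con 0"
| "pd j (Add e f) = Add (pd j e) (pd j f)"
| "pd j (Mul e f) = Add (Mul (pd j e) f) (Mul e (pd j f))"

primrec psubst :: "(nat \<Rightarrow> 'k pexp) \<Rightarrow> 'k pexp \<Rightarrow> 'k pexp" where
  "psubst P (Var i) = P i"
| "psubst P (Con c) = Con c"
| "psubst P (Add e f) = Add (psubst P e) (psubst P f)"
| "psubst P (Mul e f) = Mul (psubst P e) (psubst P f)"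

primrec pvars :: "'k pexp \<Rightarrow> nat set" where
  "pvars (Var i) = {i}"
| "pvars (Con c) = {}"
| "pvars (Add e f) = pvars e \<union> pvars f"
| "pvars (Mul e f) = pvars e \<union> pvars f"

text \<open>An upper bound for the degree, since cancellations inside a tree are not noticed.
  Counting zeros only takes such a bound.\<close>

primrec pdeg :: "'k pexp \<Rightarrow> nat" where
  "pdeg (Var i) = 1"
| "pdeg (Con c) = 0"
| "pdeg (Add e f) = max (pdeg e) (pdeg f)"
| "pdeg (Mul e f) = pdeg e + pdeg f"

text \<open>Trees have only binary sums and products, so a finite index set must be put into some
  order before a sum over it can be written down.\<close>

definition enum_list :: "'i set \<Rightarrow> 'i list" where
  "enum_list I = (SOME is. set is = I \<and> distinct is)"

lemma enum_list:
  assumes "finite I"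
  shows "set (enum_list I) = I" "distinct (enum_list I)"
  unfolding enum_list_def using someI_ex[OF finite_distinct_list[OF assms]] by auto

definition psum :: "('i \<Rightarrow> 'k::comm_ring_1 pexp) \<Rightarrow> 'i set \<Rightarrow> 'k pexp" where
  "psum f I = foldr (\<lambda>i e. Add (f i) e) (enum_list I) (Con 0)"

definition pprod :: "('i \<Rightarrow> 'k::comm_ring_1 pexp) \<Rightarrow> 'i set \<Rightarrow> 'k pexp" where
  "pprod f I = foldr (\<lambda>i e. Mul (f i) e) (enum_list I) (Con 1)"

lemma ev_psum:
  assumes "finite I" "\<kappa> 0 = 0"
  shows "ev \<kappa> x (psum f I) = (\<Sum>i\<in>I. ev \<kappa> x (f i))"
proof -
  have "ev \<kappa> x (foldr (\<lambda>i e. Add (f i) e) is (Con 0)) = (\<Sum>i\<in>set is. ev \<kappa> x (f i))"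
    if "distinct is" for "is"
    using that assms by (induction "is") auto
  from this[OF enum_list(2)[OF assms(1)]] show ?thesis
    by (simp add: psum_def enum_list assms(1))
qed

lemma ev_pprod:
  assumes "finite I" "\<kappa> 1 = 1"
  shows "ev \<kappa> x (pprod f I) = (\<Prod>i\<in>I. ev \<kappa> x (f i))"
proof -
  have "ev \<kappa> x (foldr (\<lambda>i e. Mul (f i) e) is (Con 1)) = (\<Prod>i\<in>set is. ev \<kappa> x (f i))"
    if "distinct is" for "is"
    using that assms by (induction "is") auto
  from this[OF enum_list(2)[OF assms(1)]] show ?thesis
    by (simp add: pprod_def enum_list assms(1))
qed

lemma pvars_psum: "finite I \<Longrightarrow> pvars (psum f I) = (\<Union>i\<in>I. pvars (f i))"
proof -
  have "pvars (foldr (\<lambda>i e. Add (f i) e) is (Con 0)) = (\<Union>i\<in>set is. pvars (f i))" for "is"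
    by (induction "is") auto
  then show "finite I \<Longrightarrow> ?thesis"
    by (simp add: psum_def enum_list)
qed

lemma pvars_pprod: "finite I \<Longrightarrow> pvars (pprod f I) = (\<Union>i\<in>I. pvars (f i))"
proof -
  have "pvars (foldr (\<lambda>i e. Mul (f i) e) is (Con 1)) = (\<Union>i\<in>set is. pvars (f i))" for "is"
    by (induction "is") auto
  then show "finite I \<Longrightarrow> ?thesis"
    by (simp add: pprod_def enum_list)
qed

lemma pdeg_psum:
  assumes "finite I" "\<And>i. i \<in> I \<Longrightarrow> pdeg (f i) \<le> d"
  shows "pdeg (psum f I) \<le> d"
proof -
  have "(\<forall>i\<in>set is. pdeg (f i) \<le> d) \<Longrightarrow> pdeg (foldr (\<lambda>i e. Add (f i) e) is (Con 0)) \<le> d" for "is"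
    by (induction "is") auto
  from this[of "enum_list I"] show ?thesis
    using assms by (simp add: psum_def enum_list)
qed

lemma pdeg_pprod:
  assumes "finite I"
  shows "pdeg (pprod f I) = (\<Sum>i\<in>I. pdeg (f i))"
proof -
  have "pdeg (foldr (\<lambda>i e. Mul (f i) e) is (Con 1)) = (\<Sum>i\<in>set is. pdeg (f i))"
    if "distinct is" for "is"
    using that by (induction "is") auto
  from this[OF enum_list(2)[OF assms]] show ?thesis
    by (simp add: pprod_def enum_list assms)
qed

lemma ev_hom:
  assumes "\<And>a b. h (a + b) = h a + h b" "\<And>a b. h (a * b) = h a * h b"
  shows "h (ev \<kappa> x e) = ev (\<lambda>c. h (\<kappa> c)) (\<lambda>i. h (x i)) e"
  by (induction e) (auto simp: assms)

lemma poly_ev: "poly (ev \<kappa> x e) r = ev (\<lambda>c. poly (\<kappa> c) r) (\<lambda>i. poly (x i) r) e"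
  by (rule ev_hom) auto

lemma poly_ev_const: "poly (ev (\<lambda>c. [:c:]) x e) r = ev id (\<lambda>i. poly (x i) r) e"
  by (simp add: poly_ev id_def)

lemma poly_ev_const2: "poly (ev (\<lambda>c. [:[:c:]:]) x e) r = ev (\<lambda>c. [:c:]) (\<lambda>i. poly (x i) r) e"
  by (simp add: poly_ev)

lemma ev_psubst: "ev \<kappa> x (psubst P e) = ev \<kappa> (\<lambda>i. ev \<kappa> x (P i)) e"
  by (induction e) auto

lemma ev_cong: "(\<And>i. i \<in> pvars e \<Longrightarrow> x i = y i) \<Longrightarrow> ev \<kappa> x e = ev \<kappa> y e"
  by (induction e) auto

lemma pvars_psubst: "pvars (psubst P e) = (\<Union>i\<in>pvars e. pvars (P i))"
  by (induction e) auto

lemma pdeg_psubst: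
  assumes "\<And>i. i \<in> pvars e \<Longrightarrow> pdeg (P i) \<le> d"
  shows "pdeg (psubst P e) \<le> pdeg e * d"
  using assms
proof (induction e)
  case (Add e f)
  then have *: "pdeg (psubst P e) \<le> pdeg e * d" "pdeg (psubst P f) \<le> pdeg f * d"
    by auto
  have "pdeg e * d \<le> max (pdeg e) (pdeg f) * d" "pdeg f * d \<le> max (pdeg e) (pdeg f) * d"
    by auto
  with * show ?case
    unfolding psubst.simps pdeg.simps by (meson max.boundedI order.trans)
next
  case (Mul e f)
  then have "pdeg (psubst P e) \<le> pdeg e * d" "pdeg (psubst P f) \<le> pdeg f * d"
    by auto
  then show ?case
    by (simp add: algebra_simps)
qed auto

lemma degree_ev:
  fixes x :: "nat \<Rightarrow> 'k::comm_ring_1 poly"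
  assumes "\<And>i. degree (x i) \<le> 1"
  shows "degree (ev (\<lambda>c. [:c:]) x e) \<le> pdeg e"
proof (induction e)
  case (Mul e f)
  then show ?case
    by (auto intro: order.trans[OF degree_mult_le])
qed (use assms in \<open>auto intro: degree_add_le\<close>)

text \<open>The chain rule at parameter 0. The coefficient ring is general because the rule is
  applied both at a point and along a line, where the coefficients are themselves polynomials in
  another parameter.\<close>

lemma coeff_1_ev:
  fixes x :: "nat \<Rightarrow> 'r::comm_ring_1 poly"
  assumes "finite I" "pvars e \<subseteq> I" "\<kappa> 0 = 0" "\<kappa> 1 = 1"
  shows "coeff (ev (\<lambda>c. [:\<kappa> c:]) x e) 1 =
    (\<Sum>i\<in>I. ev \<kappa> (\<lambda>i. coeff (x i) 0) (pd i e) * coeff (x i) 1)"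
  using assms(2)
proof (induction e)
  case (Var j)
  have "(\<Sum>i\<in>I. ev \<kappa> (\<lambda>i. coeff (x i) 0) (pd i (Var j)) * coeff (x i) 1) =
      (\<Sum>i\<in>I. if i = j then coeff (x i) 1 else 0)"
    by (intro sum.cong) (auto simp: assms)
  then show ?case
    using Var assms(1) by (simp add: sum.delta)
next
  case (Add e f)
  then show ?case
    by (simp add: algebra_simps sum.distrib)
next
  case (Mul e f)
  have *: "coeff (ev (\<lambda>c. [:\<kappa> c:]) x e) 0 = ev \<kappa> (\<lambda>i. coeff (x i) 0) e" for e
    using poly_ev[of "\<lambda>c. [:\<kappa> c:]" x e 0] by (simp add: poly_0_coeff_0)
  show ?case
    using Mul by (simp add: coeff_mult * algebra_simps sum.distrib sum_distrib_left)
qed (auto simp: assms)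

lemma pderiv_ev:
  fixes x :: "nat \<Rightarrow> 'k::idom poly"
  assumes "finite I" "pvars e \<subseteq> I"
  shows "pderiv (ev (\<lambda>c. [:c:]) x e) = (\<Sum>i\<in>I. ev (\<lambda>c. [:c:]) x (pd i e) * pderiv (x i))"
  using assms(2)
proof (induction e)
  case (Var j)
  have "(\<Sum>i\<in>I. ev (\<lambda>c. [:c:]) x (pd i (Var j)) * pderiv (x i)) =
      (\<Sum>i\<in>I. if i = j then pderiv (x i) else 0)"
    by (intro sum.cong) auto
  then show ?case
    using Var assms(1) by (simp add: sum.delta)
next
  case (Mul e f)
  then show ?case
    by (simp add: pderiv_mult algebra_simps sum.distrib sum_distrib_left)
qed (auto simp: pderiv_add pderiv_pCons algebra_simps sum.distrib)

lemma coeff_poly_const: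
  fixes h :: "'k::comm_ring_1 poly poly"
  shows "coeff (poly h [:c:]) b = poly (map_poly (\<lambda>p. coeff p b) h) c"
  by (induction h) (auto simp: map_poly_pCons)

lemma poly_poly_0:
  fixes h :: "'k::comm_ring_1 poly poly"
  shows "poly (poly h r) 0 = poly (poly h [:poly r 0:]) 0"
  by (induction h) auto

text \<open>Write \<open>t\<close> for the inner and \<open>s\<close> for the outer variable. The
  field is infinite, so vanishing to order \<open>a\<close> in \<open>t\<close> for each constant
  \<open>s\<close> means that \<open>t^a\<close> divides \<open>h\<close>. In
  \<open>h = t^a * g\<close>, substituting \<open>r\<close> for \<open>s\<close> leaves as
  coefficient of \<open>t^a\<close> the value of \<open>g\<close> at \<open>t = 0\<close>, which
  sees only the constant term of \<open>r\<close>.\<close>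

lemma bivariate_order:
  fixes h :: "'k::field_char_0 poly poly"
  assumes "\<And>d b. b < a \<Longrightarrow> coeff (poly h [:d:]) b = 0"
  shows "b < a \<Longrightarrow> coeff (coeff h i) b = 0"
    and "coeff (poly h r) a = coeff (poly h [:poly r 0:]) a"
proof -
  have *: "coeff (coeff h i) b = 0" if "b < a" for b i
  proof -
    have "map_poly (\<lambda>p. coeff p b) h = 0"
      using assms[OF that] by (simp add: coeff_poly_const poly_all_0_iff_0[symmetric])
    then have "coeff (map_poly (\<lambda>p. coeff p b) h) i = 0"
      by simp
    then show ?thesis
      by (simp add: coeff_map_poly)
  qed
  then show "b < a \<Longrightarrow> coeff (coeff h i) b = 0" .
  have "[:monom 1 a:] dvd h"
    using * by (simp add: const_poly_dvd_iff monom_1_dvd_iff')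
  then obtain g where g: "h = [:monom 1 a:] * g"
    by blast
  have "coeff (poly h s) a = poly (poly g s) 0" for s
    by (simp add: g coeff_monom_mult poly_0_coeff_0)
  then show "coeff (poly h r) a = coeff (poly h [:poly r 0:]) a"
    using poly_poly_0[of g r] by simp
qed

lemma poly_map_poly_const:
  fixes w :: "'k::comm_ring_1 poly"
  shows "poly (map_poly (\<lambda>x. [:x:]) w) [:d:] = [:poly w d:]"
    and "poly (map_poly (\<lambda>x. [:x:]) w) [:0, 1:] = w"
  by (induction w) (auto simp: map_poly_pCons)

section \<open>The Jacobian criterion for algebraic independence\<close>

definition jac :: "(nat \<Rightarrow> 'k::comm_ring_1 pexp) \<Rightarrow> nat \<Rightarrow> (nat \<Rightarrow> 'k) \<Rightarrow> (nat \<Rightarrow> 'k) \<Rightarrow> nat \<Rightarrow> 'k" where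
  "jac P n p v i = (\<Sum>j<n. ev id p (pd j (P i)) * v j)"

definition jac_surj :: "(nat \<Rightarrow> 'k::comm_ring_1 pexp) \<Rightarrow> nat \<Rightarrow> nat \<Rightarrow> (nat \<Rightarrow> 'k) \<Rightarrow> bool" where
  "jac_surj P n m p \<longleftrightarrow> (\<forall>c. \<exists>v. \<forall>i<m. jac P n p v i = c i)"

text \<open>Take a direction \<open>w0\<close> in which \<open>F\<close> has the least order of
  vanishing at the image point. Surjectivity of the differential provides a line through
  \<open>p\<close> whose image curve has tangent \<open>w0\<close>. Along this curve
  \<open>F\<close> has the same leading coefficient as along the straight line, so it cannot vanish
  identically.\<close>

lemma jac_surj_imp_independent:
  fixes P :: "nat \<Rightarrow> 'k::field_char_0 pexp"
  assumes "jac_surj P n m p" and P: "\<And>i. i < m \<Longrightarrow> pvars (P i) \<subseteq> {..<n}"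
    and F: "pvars F \<subseteq> {..<m}" and zero: "\<And>q. ev id (\<lambda>i. ev id q (P i)) F = 0"
  shows "ev id x F = 0"
proof (rule ccontr)
  assume nz: "ev id x F \<noteq> 0"
  define c where "c i = ev id p (P i)" for i
  define G where "G w = ev (\<lambda>c. [:c:]) (\<lambda>i. [:c i, w i:]) F" for w
  \<comment> \<open>Parameter 1 in the direction \<open>x - c\<close> is the point \<open>x\<close>
    itself.\<close>
  have "poly (G (\<lambda>i. x i - c i)) 1 \<noteq> 0"
    using nz by (simp add: G_def poly_ev_const)
  then have "G (\<lambda>i. x i - c i) \<noteq> 0"
    by auto
  then have ex: "\<exists>a. \<exists>w. coeff (G w) a \<noteq> 0"
    by (auto simp: poly_eq_iff)
  define a where "a = (LEAST a. \<exists>w. coeff (G w) a \<noteq> 0)"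
  obtain w0 where w0: "coeff (G w0) a \<noteq> 0"
    using LeastI_ex[OF ex] unfolding a_def by blast
  have low: "coeff (G w) b = 0" if "b < a" for w b
    using not_less_Least[of b "\<lambda>a. \<exists>w. coeff (G w) a \<noteq> 0"] that unfolding a_def by blast
  obtain v where v: "\<And>i. i < m \<Longrightarrow> jac P n p v i = w0 i"
    using assms(1) unfolding jac_surj_def by blast
  define Q where "Q i = ev (\<lambda>c. [:c:]) (\<lambda>j. [:p j, v j:]) (P i)" for i
  \<comment> \<open>The image curve is \<open>c + t * w'(t)\<close>; its varying direction
    \<open>w'\<close> takes the value \<open>w0\<close> at \<open>t = 0\<close>.\<close>
  define w' where "w' i = poly_shift 1 (Q i)" for i
  have "coeff (Q i) 0 = c i" for i
    by (simp add: Q_def c_def poly_ev_const flip: poly_0_coeff_0)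
  then have Q: "Q i = pCons (c i) (w' i)" for i
    by (intro poly_eqI) (auto simp: w'_def coeff_poly_shift coeff_pCons split: nat.splits)
  have w'_0: "poly (w' i) 0 = w0 i" if "i < m" for i
  proof -
    have "poly (w' i) 0 = coeff (Q i) 1"
      by (simp add: Q poly_0_coeff_0)
    also have "\<dots> = jac P n p v i"
      using coeff_1_ev[of "{..<n}" "P i" id "\<lambda>j. [:p j, v j:]"] P[OF that]
      by (simp add: Q_def jac_def)
    finally show ?thesis
      using v[OF that] by simp
  qed
  \<comment> \<open>Two parameters separate the distance \<open>t\<close> from the direction
    \<open>w' s\<close>: constant \<open>s\<close> gives a straight line from \<open>c\<close>,
    while \<open>s = t\<close> gives the image curve.\<close>
  define h where "h = ev (\<lambda>c. [:[:c:]:])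
    (\<lambda>i. [:[:c i:]:] + Polynomial.smult [:0, 1:] (map_poly (\<lambda>x. [:x:]) (w' i))) F"
  have hd: "poly h [:d:] = G (\<lambda>i. poly (w' i) d)" for d
    by (simp add: h_def G_def poly_ev_const2 poly_map_poly_const)
  have "poly h [:0, 1:] = ev (\<lambda>c. [:c:]) Q F"
    by (simp add: h_def poly_ev_const2 poly_map_poly_const flip: Q)
  moreover have "poly (ev (\<lambda>c. [:c:]) Q F) t = 0" for t
    using zero[of "\<lambda>j. poly [:p j, v j:] t"] by (simp add: poly_ev_const Q_def)
  ultimately have "poly h [:0, 1:] = 0"
    using poly_all_0_iff_0 by metis
  then have "coeff (poly h [:0:]) a = 0"
    using bivariate_order(2)[of a h "[:0, 1:]"] low by (simp add: hd)
  moreover have "poly h [:0:] = G w0"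
    unfolding hd unfolding G_def using F w'_0 by (intro ev_cong) auto
  ultimately show False
    using w0 by simp
qed

text \<open>The coordinates are freed one at a time: with the others fixed, the tree is a univariate
  polynomial of degree at most \<open>pdeg e\<close> with \<open>pdeg e + 1\<close> zeros.\<close>

lemma ev_zero_if_zero_on_grid:
  fixes e :: "'k::field_char_0 pexp"
  assumes "pvars e \<subseteq> {..<r}"
    and grid: "\<And>s. (\<forall>j<r. s j \<le> pdeg e) \<Longrightarrow> ev id (\<lambda>j. of_nat (s j)) e = 0"
  shows "ev id x e = 0"
proof -
  \<comment> \<open>Coordinates below \<open>k\<close> are arbitrary, those from \<open>k\<close> on
    lie in the grid; the case \<open>k = r\<close> is the claim.\<close>
  have "k \<le> r \<Longrightarrow> (\<forall>j. k \<le> j \<and> j < r \<longrightarrow> (\<exists>n\<le>pdeg e. x j = of_nat n)) \<Longrightarrow> ev id x e = 0" for k x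
  proof (induction k arbitrary: x)
    case 0
    then obtain s where s: "\<And>j. j < r \<Longrightarrow> s j \<le> pdeg e \<and> x j = of_nat (s j)"
      by (metis le0)
    then have "ev id x e = ev id (\<lambda>j. of_nat (s j)) e"
      using assms(1) by (intro ev_cong) auto
    then show ?case
      using grid s by metis
  next
    case (Suc k)
    define p where "p = ev (\<lambda>c. [:c:]) (\<lambda>j. if j = k then [:0, 1:] else [:x j:]) e"
    have p: "poly p y = ev id (x(k := y)) e" for y
      unfolding p_def poly_ev_const by (intro ev_cong) auto
    have "degree p \<le> pdeg e"
      unfolding p_def by (rule degree_ev) auto
    moreover have "poly p (of_nat n) = 0" if "n \<le> pdeg e" for n
      unfolding p using that Suc.prems by (intro Suc.IH) auto
    ultimately have "p = 0"
      by (intro poly_eqI_degree[of "of_nat ` {..pdeg e}"]) (auto simp: card_image inj_on_def)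
    then show ?case
      using p[of "x k"] by (simp add: id_def)
  qed
  from this[OF order.refl, of x] show ?thesis
    by (meson not_less)
qed

text \<open>Counting: there are \<open>(N + 1)^m\<close> interpolation polynomials in
  \<open>m\<close> variables, while a relation among the \<open>Q i\<close> has to be tested only at
  a number of grid points that grows like \<open>N^r\<close>.\<close>

lemma algebraically_dependent:
  fixes Q :: "nat \<Rightarrow> 'k::field_char_0 pexp"
  assumes Q: "\<And>i. i < m \<Longrightarrow> pvars (Q i) \<subseteq> {..<r}" and "r < m"
  obtains F x where "pvars F \<subseteq> {..<m}" "ev id x F \<noteq> 0"
    "\<And>s. ev id (\<lambda>i. ev id s (Q i)) F = 0"
proof -
  define d where "d = (\<Sum>i<m. pdeg (Q i))"
  have d: "pdeg (Q i) \<le> d" if "i < m" for i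
    unfolding d_def using that by (intro member_le_sum) auto
  \<comment> \<open>With this value \<open>(m * N * d + 1)^r\<close> is at most
    \<open>N^r * (m * d + 1)^r = N^(r + 1)\<close>, which is less than
    \<open>(N + 1)^m\<close>.\<close>
  define N where "N = (m * d + 1) ^ r"
  have "N \<ge> 1"
    by (simp add: N_def)
  define B where "B = PiE {..<m} (\<lambda>_. {..N})"
  define S where "S = PiE {..<r} (\<lambda>_. {..m * N * d})"
  have fin: "finite B" "finite S"
    by (auto simp: B_def S_def intro: finite_PiE)
  have "card S = (m * N * d + 1) ^ r"
    by (simp add: S_def card_PiE)
  also have "\<dots> \<le> (N * (m * d + 1)) ^ r"
    using \<open>N \<ge> 1\<close> by (intro power_mono) (auto simp: algebra_simps)
  also have "\<dots> = N ^ r * N"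
    by (simp only: power_mult_distrib N_def)
  also have "\<dots> = N ^ Suc r"
    by simp
  also have "\<dots> < (N + 1) ^ Suc r"
    by (intro power_strict_mono) auto
  also have "\<dots> \<le> (N + 1) ^ m"
    using \<open>r < m\<close> by (intro power_increasing) auto
  also have "\<dots> = card B"
    by (simp add: B_def card_PiE)
  finally have card: "card S < card B" .
  \<comment> \<open>Lagrange polynomials on the grid \<open>{0..N}^m\<close>, without their
    denominators. Each vanishes at all nodes except its own, so a combination with
    \<open>c \<beta> \<noteq> 0\<close> is visibly nonzero at the node \<beta>.\<close>
  define L :: "(nat \<Rightarrow> nat) \<Rightarrow> 'k pexp" where
    "L \<beta> = pprod (\<lambda>i. pprod (\<lambda>a. Add (Var i) (Con (- of_nat a))) ({..N} - {\<beta> i})) {..<m}" for \<beta>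
  have ev_L: "ev id y (L \<beta>) = (\<Prod>i<m. \<Prod>a\<in>{..N} - {\<beta> i}. y i - of_nat a)" for y \<beta>
    by (simp add: L_def ev_pprod)
  obtain c where c: "\<exists>\<beta>\<in>B. c \<beta> \<noteq> 0"
    "\<And>s. s \<in> S \<Longrightarrow> (\<Sum>\<beta>\<in>B. ev id (\<lambda>i. ev id (\<lambda>j. of_nat (s j)) (Q i)) (L \<beta>) * c \<beta>) = 0"
    using homogeneous_system[OF fin(2,1) card, of "\<lambda>s \<beta>. ev id (\<lambda>i. ev id (\<lambda>j. of_nat (s j)) (Q i)) (L \<beta>)"]
    by blast
  define F where "F = psum (\<lambda>\<beta>. Mul (L \<beta>) (Con (c \<beta>))) B"
  have ev_F: "ev id y F = (\<Sum>\<beta>\<in>B. ev id y (L \<beta>) * c \<beta>)" for y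
    using fin by (simp add: F_def ev_psum)
  have F: "pvars F \<subseteq> {..<m}"
    using fin by (auto simp: F_def pvars_psum L_def pvars_pprod)
  have "pdeg (L \<beta>) = m * N" if "\<beta> \<in> B" for \<beta>
  proof -
    have "card ({..N} - {\<beta> i}) = N" if "i < m" for i
      using \<open>\<beta> \<in> B\<close> that by (subst card_Diff_singleton) (auto simp: B_def PiE_iff)
    then show ?thesis
      by (simp add: L_def pdeg_pprod)
  qed
  then have degF: "pdeg F \<le> m * N"
    unfolding F_def using fin by (intro pdeg_psum) auto
  define F' where "F' = psubst Q F"
  have "pdeg F' \<le> pdeg F * d"
    unfolding F'_def using F d by (intro pdeg_psubst) auto
  also have "\<dots> \<le> m * N * d"
    using degF by simp
  finally have degF': "pdeg F' \<le> m * N * d" .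
  have varF': "pvars F' \<subseteq> {..<r}"
    using F Q by (fastforce simp: F'_def pvars_psubst)
  have zero: "ev id s F' = 0" for s
  proof (rule ev_zero_if_zero_on_grid[OF varF'])
    fix s assume s: "\<forall>j<r. s j \<le> pdeg F'"
    define s' where "s' = restrict s {..<r}"
    have "s' \<in> S"
      using s degF' by (auto simp: S_def s'_def intro: order.trans)
    then have "ev id (\<lambda>j. of_nat (s' j)) F' = 0"
      using c(2) by (simp add: F'_def ev_psubst ev_F)
    moreover have "ev id (\<lambda>j. of_nat (s' j)) F' = ev id (\<lambda>j. of_nat (s j)) F'"
      using varF' by (intro ev_cong) (auto simp: s'_def)
    ultimately show "ev id (\<lambda>j. of_nat (s j)) F' = 0"
      by simp
  qed
  obtain \<beta> where \<beta>: "\<beta> \<in> B" "c \<beta> \<noteq> 0"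
    using c(1) by blast
  have "ev id (\<lambda>i. of_nat (\<beta> i)) (L \<gamma>) = 0" if "\<gamma> \<in> B - {\<beta>}" for \<gamma>
  proof -
    have "\<exists>i<m. \<gamma> i \<noteq> \<beta> i"
    proof (rule ccontr)
      assume "\<not> ?thesis"
      then have "\<gamma> = \<beta>"
        using that \<beta>(1) unfolding B_def by (intro PiE_ext[of \<gamma> "{..<m}" _ \<beta>]) auto
      then show False
        using that by simp
    qed
    then obtain i where i: "i < m" "\<gamma> i \<noteq> \<beta> i"
      by blast
    have "\<beta> i \<in> {..N} - {\<gamma> i}"
      using \<beta>(1) i by (auto simp: B_def)
    then have "(\<Prod>a\<in>{..N} - {\<gamma> i}. of_nat (\<beta> i) - of_nat a) = (0::'k)"
      by (intro prod_zero) auto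
    then show ?thesis
      unfolding ev_L using i by (intro prod_zero) auto
  qed
  then have "ev id (\<lambda>i. of_nat (\<beta> i)) F = ev id (\<lambda>i. of_nat (\<beta> i)) (L \<beta>) * c \<beta>"
    unfolding ev_F using fin \<beta> by (subst sum.remove[of _ \<beta>]) auto
  also have "\<dots> \<noteq> 0"
    using \<beta> by (auto simp: ev_L)
  finally have "ev id (\<lambda>i. of_nat (\<beta> i)) F \<noteq> 0" .
  then show ?thesis
    using F zero by (intro that) (auto simp: F'_def ev_psubst)
qed

lemma jac_add_scale:
  "jac P n p (\<lambda>x. v x + c * w x) i = jac P n p v i + c * jac P n p w i"
  by (simp add: jac_def sum_distrib_left algebra_simps sum.distrib)

lemma jac_sum:
  "jac P n p (\<lambda>x. \<Sum>j\<in>I. c j * l j x) i = (\<Sum>j\<in>I. c j * jac P n p (l j) i)"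
  unfolding jac_def sum_distrib_left by (subst sum.swap) (simp add: algebra_simps)

text \<open>If a vector killed by the first \<open>r\<close> rows were not killed by row
  \<open>r\<close>, a multiple of it could correct the last coordinate of a combination of the
  \<open>l j\<close> without disturbing the others, and all \<open>r + 1\<close> rows would be
  onto.\<close>

lemma jac_row_dependent:
  fixes P :: "nat \<Rightarrow> 'k::field pexp"
  assumes onto: "\<And>c. \<exists>a. \<forall>i<r. (\<Sum>j<r. a j * jac P n p (l j) i) = c i"
    and not_onto: "\<not> jac_surj P n (Suc r) p"
    and y: "\<And>i. i < r \<Longrightarrow> jac P n p y i = 0"
  shows "jac P n p y r = 0"
proof (rule ccontr)
  assume nz: "jac P n p y r \<noteq> 0"
  have "\<exists>v. \<forall>i<Suc r. jac P n p v i = c i" for c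
  proof -
    obtain a where a: "\<And>i. i < r \<Longrightarrow> (\<Sum>j<r. a j * jac P n p (l j) i) = c i"
      using onto by blast
    define u where "u x = (\<Sum>j<r. a j * l j x)" for x
    have u: "jac P n p u i = c i" if "i < r" for i
      using a[OF that] by (simp add: u_def[abs_def] jac_sum)
    define b where "b = (c r - jac P n p u r) / jac P n p y r"
    have "jac P n p (\<lambda>x. u x + b * y x) i = c i" if "i < Suc r" for i
      unfolding jac_add_scale using that y nz u by (cases "i = r") (auto simp: b_def)
    then show ?thesis
      by blast
  qed
  then show False
    using not_onto unfolding jac_surj_def by blast
qed

interpretation poly_eval: comm_ring_hom "\<lambda>p. poly p t" for t :: "'k::comm_ring_1"
  by standard auto

text \<open>Cramer's rule by the adjugate matrix, with the determinant left as a factor: the entries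
  will be polynomials in a parameter, where one cannot divide.\<close>

lemma cramer_solution:
  fixes M :: "'r::comm_ring_1 mat"
  assumes M: "M \<in> carrier_mat r r"
  obtains c where "\<And>i. i < r \<Longrightarrow> (\<Sum>j<r. M $$ (i, j) * c j) = Determinant.det M * u i"
proof -
  define A where "A = adj_mat M"
  have A: "A \<in> carrier_mat r r" "M * A = Determinant.det M \<cdot>\<^sub>m 1\<^sub>m r"
    using adj_mat[OF M] by (auto simp: A_def)
  have MA: "(\<Sum>j<r. M $$ (i, j) * A $$ (j, k)) = Determinant.det M * (if i = k then 1 else 0)"
    if "i < r" "k < r" for i k
  proof -
    have "(M * A) $$ (i, k) = (\<Sum>j<r. M $$ (i, j) * A $$ (j, k))"
      using M A(1) that by (auto simp: scalar_prod_def atLeast0LessThan intro!: sum.cong)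
    then show ?thesis
      using that by (simp add: A(2))
  qed
  define c where "c j = (\<Sum>k<r. A $$ (j, k) * u k)" for j
  have "(\<Sum>j<r. M $$ (i, j) * c j) = Determinant.det M * u i" if "i < r" for i
  proof -
    have "(\<Sum>j<r. M $$ (i, j) * c j) = (\<Sum>k<r. (\<Sum>j<r. M $$ (i, j) * A $$ (j, k)) * u k)"
      unfolding c_def sum_distrib_left sum_distrib_right
      by (subst sum.swap) (simp add: mult.assoc)
    also have "\<dots> = (\<Sum>k<r. if k = i then Determinant.det M * u k else 0)"
      using that by (intro sum.cong) (auto simp: MA)
    finally show ?thesis
      using that by simp
  qed
  then show ?thesis
    by (rule that)
qed

text \<open>Restrict the first \<open>r + 1\<close> components to an \<open>r\<close>-dimensional
  affine slice where the first \<open>r\<close> of them have full rank at one point; there they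
  satisfy a relation \<open>F\<close>. Their joint differential has rank at most \<open>r\<close>
  everywhere, so a transversal derivative of \<open>F\<close> composed with \<open>P\<close> is, up
  to a nonzero factor, a combination of derivatives along the slice. Those do not lower the order of
  vanishing, whereas in characteristic 0 the transversal derivative lowers it by one.\<close>

lemma not_jac_surj_imp_dependent:
  fixes P :: "nat \<Rightarrow> 'k::field_char_0 pexp"
  assumes P: "\<And>i. i < m \<Longrightarrow> pvars (P i) \<subseteq> {..<n}"
    and not_surj: "\<And>p. \<not> jac_surj P n m p"
  obtains F x where "pvars F \<subseteq> {..<m}" "ev id x F \<noteq> 0"
    "\<And>q. ev id (\<lambda>i. ev id q (P i)) F = 0"
proof -
  \<comment> \<open>The least number of components whose joint differential is nowhere onto; one
    component less is onto at some point.\<close>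
  define k where "k = (LEAST k. \<forall>p. \<not> jac_surj P n k p)"
  have k: "\<not> jac_surj P n k p" for p
    unfolding k_def using LeastI[of "\<lambda>k. \<forall>p. \<not> jac_surj P n k p" m] not_surj by blast
  have "k \<le> m"
    unfolding k_def using not_surj by (intro Least_le) blast
  have "k \<noteq> 0"
    using k[of "\<lambda>_. 0"] by (intro notI) (simp add: jac_surj_def)
  then obtain r where r: "k = Suc r"
    using not0_implies_Suc by blast
  have not_onto: "\<not> jac_surj P n (Suc r) p" for p
    using k r by simp
  have "\<exists>p. jac_surj P n r p"
    using not_less_Least[of r "\<lambda>k. \<forall>p. \<not> jac_surj P n k p"] r unfolding k_def by simp
  then obtain p where p: "jac_surj P n r p"
    by blast
  have "\<exists>v. \<forall>i<r. jac P n p v i = (if i = j then 1 else 0)" for j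
    using spec[OF p[unfolded jac_surj_def], of "\<lambda>i. if i = j then 1 else 0"] by simp
  then obtain l where l: "\<And>i j. i < r \<Longrightarrow> jac P n p (l j) i = (if i = j then 1 else 0)"
    by metis
  \<comment> \<open>The slice through \<open>p\<close> spanned by the directions \<open>l j\<close>,
    which are dual to the first \<open>r\<close> rows of the differential at
    \<open>p\<close>.\<close>
  define S where "S s x = p x + (\<Sum>j<r. s j * l j x)" for s x
  define Q where "Q i = psubst (\<lambda>x. Add (Con (p x)) (psum (\<lambda>j. Mul (Var j) (Con (l j x))) {..<r})) (P i)" for i
  have ev_Q: "ev id s (Q i) = ev id (S s) (P i)" for s i
    unfolding Q_def ev_psubst by (rule ev_cong) (simp add: ev_psum S_def)
  have "pvars (Q i) \<subseteq> {..<r}" for i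
    by (auto simp: Q_def pvars_psubst pvars_psum)
  then obtain F x where F: "pvars F \<subseteq> {..<Suc r}" "ev id x F \<noteq> 0"
    and F_slice: "\<And>s. ev id (\<lambda>i. ev id (S s) (P i)) F = 0"
    using algebraically_dependent[of "Suc r" Q r] unfolding ev_Q by (metis lessI)
  have Pr: "pvars (P i) \<subseteq> {..<n}" if "i < Suc r" for i
    using P that \<open>k \<le> m\<close> r by simp
  define F' where "F' = psubst P F"
  have ev_F': "ev \<kappa> q F' = ev \<kappa> (\<lambda>i. ev \<kappa> q (P i)) F" for \<kappa> and q :: "nat \<Rightarrow> 'r::comm_ring_1"
    by (simp add: F'_def ev_psubst)
  have "ev id q F' = 0" for q
  proof (rule ccontr)
    assume nz: "ev id q F' \<noteq> 0"
    define v where "v x = q x - p x" for x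
    \<comment> \<open>The restriction of \<open>F'\<close> to the line through the slice point
      \<open>S s\<close> in the direction \<open>v\<close>; from \<open>p\<close> itself,
      \<open>q\<close> is reached at parameter 1.\<close>
    define G where "G s = ev (\<lambda>c. [:c:]) (\<lambda>x. [:S s x, v x:]) F'" for s
    have "poly (G (\<lambda>_. 0)) 1 = ev id q F'"
      by (simp add: G_def poly_ev_const S_def v_def)
    then have "G (\<lambda>_. 0) \<noteq> 0"
      using nz by auto
    then have ex: "\<exists>a. \<exists>s. coeff (G s) a \<noteq> 0"
      by (auto simp: poly_eq_iff)
    define a where "a = (LEAST a. \<exists>s. coeff (G s) a \<noteq> 0)"
    obtain s1 where s1: "coeff (G s1) a \<noteq> 0"
      using LeastI_ex[OF ex] unfolding a_def by blast
    have low: "coeff (G s) b = 0" if "b < a" for s b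
      using not_less_Least[of b "\<lambda>a. \<exists>s. coeff (G s) a \<noteq> 0"] that unfolding a_def by blast
    have "coeff (G s) 0 = 0" for s
      using F_slice[of s] by (simp add: G_def poly_ev_const ev_F' flip: poly_0_coeff_0)
    then have "a \<noteq> 0"
      using s1 by metis
    \<comment> \<open>The coefficient of order \<open>a\<close> is nonzero at \<open>s1\<close> and
      the Jacobian minor is nonzero at \<open>p\<close>. Along the line from \<open>p\<close> to
      \<open>S s1\<close>, with parameter \<tau>, both are polynomials, so both are nonzero at a
      common \<tau>.\<close>
    define h1 where "h1 = ev (\<lambda>c. [:[:c:]:]) (\<lambda>x. [:[:p x, v x:], [:\<Sum>j<r. s1 j * l j x:]:]) F'"
    have h1: "poly h1 [:\<tau>:] = G (\<lambda>j. \<tau> * s1 j)" for \<tau>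
    proof -
      have "(\<Sum>j<r. \<tau> * s1 j * l j x) = \<tau> * (\<Sum>j<r. s1 j * l j x)" for x
        by (simp add: sum_distrib_left mult.assoc)
      then show ?thesis
        by (simp add: h1_def G_def S_def poly_ev_const2 mult.commute)
    qed
    define G0 where "G0 = map_poly (\<lambda>p. coeff p a) h1"
    have G0: "poly G0 \<tau> = coeff (G (\<lambda>j. \<tau> * s1 j)) a" for \<tau>
      by (simp add: G0_def h1 flip: coeff_poly_const)
    define \<Delta> where "\<Delta> = Determinant.det (mat r r (\<lambda>(i, j). \<Sum>x<n.
        ev (\<lambda>c. [:c:]) (\<lambda>x. [:p x, \<Sum>j<r. s1 j * l j x:]) (pd x (P i)) * [:l j x:]))"
    have S_line: "p x + \<tau> * (\<Sum>j<r. s1 j * l j x) = S (\<lambda>j. \<tau> * s1 j) x" for \<tau> x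
      by (simp add: S_def sum_distrib_left mult.assoc)
    have \<Delta>: "poly \<Delta> \<tau> = Determinant.det (mat r r (\<lambda>(i, j). jac P n (S (\<lambda>j. \<tau> * s1 j)) (l j) i))" for \<tau>
      unfolding \<Delta>_def
      by (subst poly_eval.hom_det[symmetric], intro arg_cong[of _ _ Determinant.det] eq_matI)
        (auto simp: jac_def poly_sum poly_ev_const S_line mult.commute)
    have "S (\<lambda>_. 0) = p"
      by (auto simp: S_def)
    then have "mat r r (\<lambda>(i, j). jac P n (S (\<lambda>_. 0)) (l j) i) = 1\<^sub>m r"
      by (intro eq_matI) (auto simp: l)
    then have "poly \<Delta> 0 = 1"
      by (simp add: \<Delta>)
    moreover have "poly G0 1 \<noteq> 0"
      using s1 by (simp add: G0)
    ultimately have "G0 * \<Delta> \<noteq> 0"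
      by auto
    then obtain \<tau> where \<tau>: "poly (G0 * \<Delta>) \<tau> \<noteq> 0"
      using poly_all_0_iff_0 by blast
    define s0 where "s0 j = \<tau> * s1 j" for j
    define q0 where "q0 = S s0"
    have s0: "coeff (G s0) a \<noteq> 0" "Determinant.det (mat r r (\<lambda>(i, j). jac P n q0 (l j) i)) \<noteq> 0"
      using \<tau> by (auto simp: G0 \<Delta> s0_def[abs_def] q0_def)
    define \<gamma> where "\<gamma> x = [:q0 x, v x:]" for x
    define D where "D i x = ev (\<lambda>c. [:c:]) \<gamma> (pd x (P i))" for i x
    \<comment> \<open>Derivatives of the components along the line through \<open>q0\<close>:
      \<open>u\<close> in the line's own direction, \<open>w j\<close> in the slice direction
      \<open>l j\<close>.\<close>
    define u where "u i = (\<Sum>x<n. D i x * [:v x:])" for i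
    define w where "w j i = (\<Sum>x<n. D i x * [:l j x:])" for j i
    define \<gamma>t where "\<gamma>t t x = poly (\<gamma> x) t" for t x
    have poly_D: "poly (D i x) t = ev id (\<gamma>t t) (pd x (P i))" for i x t
      by (simp add: D_def poly_ev_const \<gamma>t_def[abs_def])
    have poly_u: "poly (u i) t = jac P n (\<gamma>t t) v i" for i t
      by (simp add: u_def jac_def poly_sum poly_D mult.commute)
    have poly_w: "poly (w j i) t = jac P n (\<gamma>t t) (l j) i" for i j t
      by (simp add: w_def jac_def poly_sum poly_D mult.commute)
    define M where "M = mat r r (\<lambda>(i, j). w j i)"
    have M: "M \<in> carrier_mat r r"
      by (simp add: M_def)
    define \<delta> where "\<delta> = Determinant.det M"
    have poly_\<delta>: "poly \<delta> t = Determinant.det (mat r r (\<lambda>(i, j). jac P n (\<gamma>t t) (l j) i))" for t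
      unfolding \<delta>_def M_def
      by (subst poly_eval.hom_det[symmetric], intro arg_cong[of _ _ Determinant.det] eq_matI)
        (auto simp: poly_w)
    have "\<gamma>t 0 = q0"
      by (auto simp: \<gamma>t_def \<gamma>_def)
    then have \<delta>0: "coeff \<delta> 0 \<noteq> 0"
      using s0(2) by (simp add: poly_\<delta> flip: poly_0_coeff_0)
    obtain c where c: "\<And>i. i < r \<Longrightarrow> (\<Sum>j<r. M $$ (i, j) * c j) = \<delta> * u i"
      unfolding \<delta>_def using cramer_solution[OF M] by metis
    have cu: "\<delta> * u i = (\<Sum>j<r. c j * w j i)" if "i < Suc r" for i
    proof (cases "i < r")
      case True
      then show ?thesis
        using c[OF True] by (simp add: M_def mult.commute)
    next
      case False
      with that have [simp]: "i = r"
        by simp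
      \<comment> \<open>The additional factor \<delta> makes the identity trivial at parameters
        where the minor vanishes; at the others row \<open>r\<close> depends on the preceding
        rows.\<close>
      have "poly (\<delta> * (\<delta> * u r - (\<Sum>j<r. c j * w j r))) t = 0" for t
      proof (cases "poly \<delta> t = 0")
        case nz: False
        define Mt where "Mt = mat r r (\<lambda>(i, j). jac P n (\<gamma>t t) (l j) i)"
        have "\<exists>a. \<forall>i<r. (\<Sum>j<r. a j * jac P n (\<gamma>t t) (l j) i) = b i" for b
        proof -
          obtain a where "\<And>i. i < r \<Longrightarrow> (\<Sum>j<r. Mt $$ (i, j) * a j) = Determinant.det Mt * (b i / Determinant.det Mt)"
            by (rule cramer_solution[of Mt r "\<lambda>i. b i / Determinant.det Mt"]) (auto simp: Mt_def)
          then show ?thesis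
            using nz by (intro exI[of _ a]) (simp add: Mt_def poly_\<delta> mult.commute)
        qed
        moreover define y where "y x = (\<Sum>j<r. - poly (c j) t * l j x) + poly \<delta> t * v x" for x
        have y: "jac P n (\<gamma>t t) y i = poly (\<delta> * u i - (\<Sum>j<r. c j * w j i)) t" for i
          unfolding y_def[abs_def] jac_add_scale jac_sum
          by (simp add: poly_sum poly_u poly_w sum_negf)
        have "jac P n (\<gamma>t t) y i = 0" if "i < r" for i
          unfolding y using c[OF that] that by (simp add: M_def mult.commute)
        ultimately have "jac P n (\<gamma>t t) y r = 0"
          using jac_row_dependent[OF _ not_onto] by metis
        then show ?thesis
          by (simp add: y)
      qed simp
      then have "\<delta> * (\<delta> * u r - (\<Sum>j<r. c j * w j r)) = 0"
        using poly_all_0_iff_0 by blast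
      moreover have "\<delta> \<noteq> 0"
        using \<delta>0 by auto
      ultimately show ?thesis
        by simp
    qed
    define \<alpha> where "\<alpha> i = ev (\<lambda>c. [:c:]) (\<lambda>i. ev (\<lambda>c. [:c:]) \<gamma> (P i)) (pd i F)" for i
    have G_s0: "G s0 = ev (\<lambda>c. [:c:]) (\<lambda>i. ev (\<lambda>c. [:c:]) \<gamma> (P i)) F"
      by (simp add: G_def ev_F' \<gamma>_def[abs_def] q0_def)
    have dG: "pderiv (G s0) = (\<Sum>i<Suc r. \<alpha> i * u i)"
    proof -
      have "pderiv (ev (\<lambda>c. [:c:]) \<gamma> (P i)) = u i" if "i < Suc r" for i
        using pderiv_ev[of "{..<n}" "P i" \<gamma>] Pr[OF that]
        by (simp add: u_def D_def \<gamma>_def pderiv_pCons)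
      then show ?thesis
        unfolding G_s0 \<alpha>_def using pderiv_ev[of "{..<Suc r}" F] F(1) by simp
    qed
    \<comment> \<open>This sum is the derivative of \<open>F'\<close> in the slice direction
      \<open>l j\<close> along the line. Moving \<open>s0\<close> in its \<open>j\<close>-th
      coordinate by \<epsilon> keeps the order of vanishing at least \<open>a\<close>, hence the
      coefficient of \<epsilon> vanishes to that order as well.\<close>
    have \<alpha>w: "coeff (\<Sum>i<Suc r. \<alpha> i * w j i) b = 0" if "b < a" "j < r" for j b
    proof -
      define h where "h = ev (\<lambda>c. [:[:c:]:]) (\<lambda>x. [:\<gamma> x, [:l j x:]:]) F'"
      have "poly h [:\<epsilon>:] = G (s0(j := s0 j + \<epsilon>))" for \<epsilon>
      proof -
        have "S (s0(j := s0 j + \<epsilon>)) x = q0 x + \<epsilon> * l j x" for x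
        proof -
          have "(\<Sum>i<r. (s0(j := s0 j + \<epsilon>)) i * l i x) = (\<Sum>i<r. s0 i * l i x + (if i = j then \<epsilon> * l j x else 0))"
            by (intro sum.cong) (auto simp: algebra_simps)
          then show ?thesis
            using \<open>j < r\<close> by (simp add: S_def q0_def sum.distrib)
        qed
        then show ?thesis
          by (simp add: h_def G_def poly_ev_const2 \<gamma>_def mult.commute)
      qed
      then have "coeff (coeff h 1) b = 0"
        using low \<open>b < a\<close> by (intro bivariate_order(1)[of a]) auto
      moreover have "coeff h 1 = (\<Sum>i<Suc r. \<alpha> i * w j i)"
      proof -
        have 0: "coeff (ev (\<lambda>c. [:[:c:]:]) (\<lambda>x. [:\<gamma> x, [:l j x:]:]) (P i)) 0 = ev (\<lambda>c. [:c:]) \<gamma> (P i)" for i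
          by (simp add: poly_ev_const2 flip: poly_0_coeff_0)
        have 1: "coeff (ev (\<lambda>c. [:[:c:]:]) (\<lambda>x. [:\<gamma> x, [:l j x:]:]) (P i)) 1 = w j i" if "i < Suc r" for i
          using coeff_1_ev[of "{..<n}" "P i" "\<lambda>c. [:c:]" "\<lambda>x. [:\<gamma> x, [:l j x:]:]"] Pr[OF that]
          by (simp add: w_def D_def one_pCons)
        show ?thesis
          unfolding h_def ev_F'
          using coeff_1_ev[of "{..<Suc r}" F "\<lambda>c. [:c:]" "\<lambda>i. ev (\<lambda>c. [:[:c:]:]) (\<lambda>x. [:\<gamma> x, [:l j x:]:]) (P i)"] F(1)
          by (simp add: 0 1[simplified] \<alpha>_def one_pCons)
      qed
      ultimately show ?thesis
        by simp
    qed
    have "\<delta> * pderiv (G s0) = (\<Sum>i<Suc r. \<alpha> i * (\<delta> * u i))"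
      unfolding dG sum_distrib_left by (intro sum.cong) (auto simp: algebra_simps)
    also have "\<dots> = (\<Sum>i<Suc r. \<alpha> i * (\<Sum>j<r. c j * w j i))"
      using cu by (intro sum.cong) auto
    also have "\<dots> = (\<Sum>j<r. c j * (\<Sum>i<Suc r. \<alpha> i * w j i))"
      unfolding sum_distrib_left by (subst sum.swap) (simp only: mult.left_commute)
    finally have eq: "\<delta> * pderiv (G s0) = (\<Sum>j<r. c j * (\<Sum>i<Suc r. \<alpha> i * w j i))" .
    have "coeff (\<delta> * pderiv (G s0)) (a - 1) = 0"
      unfolding eq coeff_sum
    proof (intro sum.neutral ballI)
      fix j assume "j \<in> {..<r}"
      then show "coeff (c j * (\<Sum>i<Suc r. \<alpha> i * w j i)) (a - 1) = 0"
        using \<alpha>w \<open>a \<noteq> 0\<close> unfolding coeff_mult by (intro sum.neutral) auto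
    qed
    \<comment> \<open>\<open>G s0\<close> has order exactly \<open>a\<close> and \<delta> does not
      vanish at 0, so only the lowest terms contribute; the factor \<open>of_nat a\<close> is
      nonzero in characteristic 0.\<close>
    moreover have "coeff (\<delta> * pderiv (G s0)) (a - 1) = coeff \<delta> 0 * (of_nat a * coeff (G s0) a)"
    proof -
      have "coeff (\<delta> * pderiv (G s0)) (a - 1) =
          (\<Sum>i\<le>a - 1. if i = 0 then coeff \<delta> 0 * (of_nat a * coeff (G s0) a) else 0)"
        unfolding coeff_mult
      proof (intro sum.cong refl)
        fix i assume "i \<in> {..a - 1}"
        then show "coeff \<delta> i * coeff (pderiv (G s0)) (a - 1 - i) =
            (if i = 0 then coeff \<delta> 0 * (of_nat a * coeff (G s0) a) else 0)"
          using \<open>a \<noteq> 0\<close> low[of "Suc (a - 1 - i)" s0] by (auto simp: coeff_pderiv)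
      qed
      then show ?thesis
        by simp
    qed
    ultimately show False
      using \<delta>0 s0(1) \<open>a \<noteq> 0\<close> by simp
  qed
  then show ?thesis
    using F \<open>k \<le> m\<close> r by (intro that[of F x]) (auto simp: ev_F')
qed

section \<open>Linear operators\<close>

no_notation vector_scalar_mult (infixl "*s" 70)

text \<open>Linearity is demanded on the subspace only: elements of the Lie algebra are total
  functions whose values outside the regular functions are a convention.\<close>

definition (in vector_space) endo_on :: "'b set \<Rightarrow> ('b \<Rightarrow> 'b) \<Rightarrow> bool" where
  "endo_on V T \<longleftrightarrow> (\<forall>x\<in>V. T x \<in> V) \<and> (\<forall>x\<in>V. \<forall>y\<in>V. T (x + y) = T x + T y) \<and>
     (\<forall>c. \<forall>x\<in>V. T (c *s x) = c *s T x)"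

definition (in vector_space) trace :: "'b set \<Rightarrow> ('b \<Rightarrow> 'b) \<Rightarrow> 'a" where
  "trace B T = (\<Sum>b\<in>B. representation B (T b) b)"

definition (in vector_space) geigen :: "('b \<Rightarrow> 'b) \<Rightarrow> 'b set \<Rightarrow> 'a \<Rightarrow> 'b set" where
  "geigen D V \<mu> = {x \<in> V. \<exists>n. ((\<lambda>y. D y - \<mu> *s y) ^^ n) x = 0}"

context vector_space
begin

lemma endo_onD:
  assumes "endo_on V T"
  shows "x \<in> V \<Longrightarrow> T x \<in> V" "x \<in> V \<Longrightarrow> y \<in> V \<Longrightarrow> T (x + y) = T x + T y"
    "x \<in> V \<Longrightarrow> T (c *s x) = c *s T x"
  using assms by (auto simp: endo_on_def)

lemma endo_on_zero: "endo_on V T \<Longrightarrow> subspace V \<Longrightarrow> T 0 = 0"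
  using endo_onD(3)[of V T 0 0] subspace_0[of V] by simp

lemma endo_on_minus: "endo_on V T \<Longrightarrow> x \<in> V \<Longrightarrow> T (- x) = - T x"
  using endo_onD(3)[of V T x "-1"] by simp

lemma endo_on_diff:
  assumes "endo_on V T" "subspace V" "x \<in> V" "y \<in> V"
  shows "T (x - y) = T x - T y"
  using endo_onD(2)[OF assms(1,3), of "- y"] assms
  by (simp add: endo_on_minus subspace_neg)

lemma endo_on_sum:
  assumes "endo_on V T" "subspace V" "\<And>i. i \<in> I \<Longrightarrow> f i \<in> V"
  shows "T (\<Sum>i\<in>I. f i) = (\<Sum>i\<in>I. T (f i))"
  using assms(3)
proof (induction I rule: infinite_finite_induct)
  case (insert i I)
  then show ?case
    using assms(1,2) by (simp add: endo_onD(2) subspace_sum)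
qed (use assms in \<open>auto simp: endo_on_zero\<close>)

lemma endo_on_funpow: "endo_on V T \<Longrightarrow> endo_on V (T ^^ n)"
  by (induction n) (auto simp: endo_on_def)

lemma endo_on_comp: "endo_on V S \<Longrightarrow> endo_on V T \<Longrightarrow> endo_on V (\<lambda>x. S (T x))"
  by (auto simp: endo_on_def)

lemma endo_on_sub_scale:
  assumes "endo_on V T" "subspace V"
  shows "endo_on V (\<lambda>x. T x - c *s x)"
  using assms by (auto simp: endo_on_def subspace_diff subspace_scale algebra_simps)

lemma family_dependent:
  assumes "finite I" "finite S" "card S < card I" "\<And>i. i \<in> I \<Longrightarrow> f i \<in> span S"
  obtains c where "\<exists>i\<in>I. c i \<noteq> 0" "(\<Sum>i\<in>I. c i *s f i) = 0"
proof -
  have "\<forall>i\<in>I. \<exists>u. f i = (\<Sum>s\<in>S. u s *s s)"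
    using assms(4) span_finite[OF assms(2)] by auto
  then obtain u where u: "\<And>i. i \<in> I \<Longrightarrow> f i = (\<Sum>s\<in>S. u i s *s s)"
    by metis
  obtain c where c: "\<exists>i\<in>I. c i \<noteq> 0" "\<And>s. s \<in> S \<Longrightarrow> (\<Sum>i\<in>I. u i s * c i) = 0"
    using homogeneous_system[OF assms(2,1,3), of "\<lambda>s i. u i s"] by blast
  have "(\<Sum>i\<in>I. c i *s f i) = (\<Sum>i\<in>I. \<Sum>s\<in>S. (u i s * c i) *s s)"
    by (intro sum.cong) (auto simp: u scale_sum_right mult.commute)
  also have "\<dots> = (\<Sum>s\<in>S. (\<Sum>i\<in>I. u i s * c i) *s s)"
    by (subst sum.swap) (simp add: scale_sum_left)
  also have "\<dots> = 0"
    using c(2) by simp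
  finally show ?thesis
    using c(1) that by blast
qed

lemma finite_basis:
  assumes "subspace V" "V \<subseteq> span S" "finite S"
  obtains B where "finite B" "independent B" "span B = V"
proof -
  obtain B where B: "B \<subseteq> V" "independent B" "V \<subseteq> span B"
    using maximal_independent_subset by metis
  have "finite B"
    using independent_span_bound[OF assms(3) B(2)] B(1) assms(2) by auto
  moreover have "span B = V"
    using B assms(1) by (simp add: span_subspace)
  ultimately show ?thesis
    using B that by blast
qed

subsection \<open>Traces\<close>

lemma representation_endo:
  assumes B: "finite B" "independent B"
    and C: "finite C" "independent C" "span C = span B"
    and T: "endo_on (span B) T" and x: "x \<in> span B"
  shows "representation B (T x) b = (\<Sum>c\<in>C. representation C x c * representation B (T c) b)"
proof -
  have C_B: "c \<in> span B" if "c \<in> C" for c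
    using that C span_base by auto
  then have Tc: "T c \<in> span B" if "c \<in> C" for c
    using that C_B T endo_onD(1) by blast
  have "x = (\<Sum>c\<in>C. representation C x c *s c)"
    using C x by (simp add: sum_representation_eq)
  then have "T x = T (\<Sum>c\<in>C. representation C x c *s c)"
    by simp
  also have "\<dots> = (\<Sum>c\<in>C. representation C x c *s T c)"
    using C_B T
    by (subst endo_on_sum[where V = "span B"]) (auto simp: endo_onD(3) span_scale)
  finally have "representation B (T x) b =
      (\<Sum>c\<in>C. representation B (representation C x c *s T c) b)"
    using B(2) Tc by (simp add: representation_sum span_scale)
  then show ?thesis
    using B(2) Tc by (simp add: representation_scale)
qed

text \<open>Expanding through the other basis turns both traces into the same double sum over pairs
  of basis vectors.\<close>

lemma trace_basis_independent:
  assumes B: "finite B" "independent B"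
    and C: "finite C" "independent C" "span C = span B" and T: "endo_on (span B) T"
  shows "trace C T = trace B T"
proof -
  have id: "endo_on (span B) (\<lambda>x. x)"
    by (simp add: endo_on_def)
  have "trace B T = (\<Sum>b\<in>B. \<Sum>c\<in>C. representation C (T b) c * representation B c b)"
    unfolding trace_def
  proof (intro sum.cong refl)
    fix b assume "b \<in> B"
    then have "T b \<in> span B"
      using T by (simp add: endo_onD(1) span_base)
    then show "representation B (T b) b = (\<Sum>c\<in>C. representation C (T b) c * representation B c b)"
      using representation_endo[OF B C id] by blast
  qed
  also have "\<dots> = (\<Sum>c\<in>C. \<Sum>b\<in>B. representation B c b * representation C (T b) c)"
    by (subst sum.swap) (simp add: mult.commute)
  also have "\<dots> = trace C T"
    unfolding trace_def
  proof (intro sum.cong refl)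
    fix c assume "c \<in> C"
    then have "endo_on (span C) T" "c \<in> span C"
      using T C by (auto intro: span_base)
    from representation_endo[OF C(1,2) B C(3)[symmetric] this, of c]
    show "(\<Sum>b\<in>B. representation B c b * representation C (T b) c) = representation C (T c) c"
      by simp
  qed
  finally show ?thesis ..
qed

lemma trace_comm:
  assumes B: "finite B" "independent B"
    and "endo_on (span B) S" "endo_on (span B) T"
  shows "trace B (\<lambda>x. S (T x)) = trace B (\<lambda>x. T (S x))"
proof -
  have *: "trace B (\<lambda>x. S (T x)) =
      (\<Sum>b\<in>B. \<Sum>c\<in>B. representation B (T b) c * representation B (S c) b)"
    if "endo_on (span B) S" "endo_on (span B) T" for S T
    unfolding trace_def using that
    by (intro sum.cong refl representation_endo[OF B B]) (auto simp: endo_onD(1) span_base)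
  show ?thesis
    unfolding *[OF assms(3,4)] *[OF assms(4,3)] by (subst sum.swap) (simp add: mult.commute)
qed

lemma trace_cong: "(\<And>x. x \<in> B \<Longrightarrow> S x = T x) \<Longrightarrow> trace B S = trace B T"
  by (simp add: trace_def)

lemma trace_add:
  assumes B: "finite B" "independent B"
    and "endo_on (span B) S" "endo_on (span B) T"
  shows "trace B (\<lambda>x. S x + T x) = trace B S + trace B T"
  unfolding trace_def using assms B(2)
  by (simp add: representation_add endo_onD(1) span_base flip: sum.distrib)

lemma trace_diff:
  assumes B: "finite B" "independent B"
    and "endo_on (span B) S" "endo_on (span B) T"
  shows "trace B (\<lambda>x. S x - T x) = trace B S - trace B T"
  unfolding trace_def using assms B(2)
  by (simp add: representation_diff endo_onD(1) span_base flip: sum_subtractf)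

lemma trace_scale:
  assumes B: "finite B" "independent B"
    and "endo_on (span B) S"
  shows "trace B (\<lambda>x. c *s S x) = c * trace B S"
  unfolding trace_def using assms B(2)
  by (simp add: representation_scale endo_onD(1) span_base sum_distrib_left)

subsection \<open>Generalised eigenspaces\<close>

context
  fixes D :: "'b \<Rightarrow> 'b" and V :: "'b set"
  assumes D: "endo_on V D" and V: "subspace V"
begin

lemma endo_shift: "endo_on V (\<lambda>y. D y - \<mu> *s y)"
  by (rule endo_on_sub_scale[OF D V])

lemma endo_shift_pow: "endo_on V ((\<lambda>y. D y - \<mu> *s y) ^^ n)"
  by (rule endo_on_funpow[OF endo_shift])

lemma shift_pow_mono:
  assumes "((\<lambda>y. D y - \<mu> *s y) ^^ n) x = 0" "n \<le> m"
  shows "((\<lambda>y. D y - \<mu> *s y) ^^ m) x = 0"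
proof -
  have "((\<lambda>y. D y - \<mu> *s y) ^^ m) x = ((\<lambda>y. D y - \<mu> *s y) ^^ (m - n)) (((\<lambda>y. D y - \<mu> *s y) ^^ n) x)"
    using assms(2) funpow_add[of "m - n" n "\<lambda>y. D y - \<mu> *s y"] by simp
  then show ?thesis
    using assms(1) endo_on_zero[OF endo_shift_pow V] by simp
qed

lemma geigen_subspace: "subspace (geigen D V \<mu>)"
proof (rule subspaceI)
  show "0 \<in> geigen D V \<mu>"
    using V by (auto simp: geigen_def subspace_0 intro: exI[of _ 0])
next
  fix x y assume "x \<in> geigen D V \<mu>" "y \<in> geigen D V \<mu>"
  then obtain n m where *: "x \<in> V" "y \<in> V" "((\<lambda>y. D y - \<mu> *s y) ^^ n) x = 0"
    "((\<lambda>y. D y - \<mu> *s y) ^^ m) y = 0"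
    by (auto simp: geigen_def)
  then have "((\<lambda>y. D y - \<mu> *s y) ^^ max n m) (x + y) = 0"
    using shift_pow_mono[of n \<mu> x "max n m"] shift_pow_mono[of m \<mu> y "max n m"]
    by (simp add: endo_onD(2)[OF endo_shift_pow])
  then show "x + y \<in> geigen D V \<mu>"
    using * V by (auto simp: geigen_def subspace_add)
next
  fix c x assume "x \<in> geigen D V \<mu>"
  then obtain n where *: "x \<in> V" "((\<lambda>y. D y - \<mu> *s y) ^^ n) x = 0"
    by (auto simp: geigen_def)
  then have "((\<lambda>y. D y - \<mu> *s y) ^^ n) (c *s x) = 0"
    by (simp add: endo_onD(3)[OF endo_shift_pow])
  then show "c *s x \<in> geigen D V \<mu>"
    using * V by (auto simp: geigen_def subspace_scale)
qed

lemma geigen_shift: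
  assumes "x \<in> geigen D V \<mu>"
  shows "D x - \<nu> *s x \<in> geigen D V \<mu>"
proof -
  obtain n where x: "x \<in> V" "((\<lambda>y. D y - \<mu> *s y) ^^ n) x = 0"
    using assms by (auto simp: geigen_def)
  then have "((\<lambda>y. D y - \<mu> *s y) ^^ n) (D x - \<mu> *s x) = 0"
    using shift_pow_mono[of n \<mu> x "Suc n"] by (simp add: funpow_Suc_right del: funpow.simps)
  then have "D x - \<mu> *s x \<in> geigen D V \<mu>"
    using x(1) endo_onD(1)[OF endo_shift] by (auto simp: geigen_def)
  then have "(D x - \<mu> *s x) + (\<mu> - \<nu>) *s x \<in> geigen D V \<mu>"
    using assms geigen_subspace by (simp add: subspace_add subspace_scale)
  then show ?thesis
    by (simp add: algebra_simps)
qed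

text \<open>On this space \<open>D - \<kappa>\<close> is the nonzero scalar
  \<open>\<mu> - \<kappa>\<close> plus a locally nilpotent operator. Induction on the nilpotency
  order takes the place of a geometric series for the inverse.\<close>

lemma shift_surj_on_geigen:
  assumes "x \<in> geigen D V \<mu>" "\<kappa> \<noteq> \<mu>"
  shows "\<exists>y\<in>geigen D V \<mu>. D y - \<kappa> *s y = x"
proof -
  have "x \<in> V \<Longrightarrow> ((\<lambda>y. D y - \<mu> *s y) ^^ n) x = 0 \<Longrightarrow> \<exists>y\<in>geigen D V \<mu>. D y - \<kappa> *s y = x" for n x
  proof (induction n arbitrary: x)
    case 0
    then show ?case
      using geigen_subspace V by (intro bexI[of _ 0]) (auto simp: subspace_0 endo_on_zero[OF D])
  next
    case (Suc n)
    have x: "x \<in> geigen D V \<mu>"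
      using Suc.prems unfolding geigen_def by blast
    have "((\<lambda>y. D y - \<mu> *s y) ^^ n) (D x - \<mu> *s x) = 0"
      using Suc.prems by (simp add: funpow_Suc_right del: funpow.simps)
    then obtain y where y: "y \<in> geigen D V \<mu>" "D y - \<kappa> *s y = D x - \<mu> *s x"
      using Suc.IH[of "D x - \<mu> *s x"] endo_onD(1)[OF endo_shift Suc.prems(1)] by blast
    \<comment> \<open>\<open>D - \<kappa>\<close> sends \<open>x - y\<close> to
      \<open>(D - \<kappa>) x - (D - \<mu>) x = (\<mu> - \<kappa>) x\<close>.\<close>
    define z where "z = (1 / (\<mu> - \<kappa>)) *s (x - y)"
    have z: "z \<in> geigen D V \<mu>"
      unfolding z_def using x y(1) geigen_subspace by (simp add: subspace_scale subspace_diff)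
    have V': "x \<in> V" "y \<in> V"
      using x y by (auto simp: geigen_def)
    have "D z = (1 / (\<mu> - \<kappa>)) *s (D x - D y)"
      unfolding z_def using V' V by (simp add: endo_onD(3)[OF D] subspace_diff endo_on_diff[OF D V])
    then have "D z - \<kappa> *s z = (1 / (\<mu> - \<kappa>)) *s ((D x - \<kappa> *s x) - (D y - \<kappa> *s y))"
      by (simp add: z_def algebra_simps)
    also have "\<dots> = (1 / (\<mu> - \<kappa>)) *s ((\<mu> - \<kappa>) *s x)"
      by (simp add: y(2) algebra_simps)
    also have "\<dots> = x"
      using assms(2) by simp
    finally show ?case
      using z by blast
  qed
  then show ?thesis
    using assms(1) by (auto simp: geigen_def)
qed

lemma shift_pow_eigenvector:
  assumes "x \<in> V" "D x = \<kappa> *s x"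
  shows "((\<lambda>y. D y - \<mu> *s y) ^^ n) x = ((\<kappa> - \<mu>) ^ n) *s x"
proof (induction n)
  case (Suc n)
  then show ?case
    using assms by (simp add: endo_onD(3)[OF D] algebra_simps)
qed simp

lemma shift_inj_on_geigen:
  assumes "x \<in> geigen D V \<mu>" "D x - \<kappa> *s x = 0" "\<kappa> \<noteq> \<mu>"
  shows "x = 0"
proof -
  obtain n where "x \<in> V" "((\<lambda>y. D y - \<mu> *s y) ^^ n) x = 0"
    using assms(1) by (auto simp: geigen_def)
  moreover have "D x = \<kappa> *s x"
    using assms(2) by simp
  ultimately have "(\<kappa> - \<mu>) ^ n *s x = 0"
    using shift_pow_eigenvector[of x \<kappa> n \<mu>] by metis
  then show ?thesis
    using assms(3) by simp
qed

lemma shift_pow_inj_on_geigen: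
  assumes "x \<in> geigen D V \<mu>" "((\<lambda>y. D y - \<kappa> *s y) ^^ n) x = 0" "\<kappa> \<noteq> \<mu>"
  shows "x = 0"
  using assms(1,2)
proof (induction n arbitrary: x)
  case (Suc n)
  have "((\<lambda>y. D y - \<kappa> *s y) ^^ n) (D x - \<kappa> *s x) = 0"
    using Suc.prems(2) by (simp add: funpow_Suc_right del: funpow.simps)
  then have "D x - \<kappa> *s x = 0"
    using Suc.IH geigen_shift[OF Suc.prems(1)] by blast
  then show ?case
    using Suc.prems assms(3) shift_inj_on_geigen by blast
qed simp

lemma geigen_shift_pow: "x \<in> geigen D V \<mu> \<Longrightarrow> ((\<lambda>y. D y - \<nu> *s y) ^^ n) x \<in> geigen D V \<mu>"
  by (induction n) (auto simp: geigen_shift)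

text \<open>A power of \<open>D - \<nu>\<close> removes the summand for \<nu> and stays injective on
  the other generalised eigenspaces.\<close>

lemma geigen_direct:
  assumes "finite S" "\<And>\<mu>. \<mu> \<in> S \<Longrightarrow> c \<mu> \<in> geigen D V \<mu>" "(\<Sum>\<mu>\<in>S. c \<mu>) = 0" "\<mu> \<in> S"
  shows "c \<mu> = 0"
  using assms
proof (induction S arbitrary: c \<mu> rule: finite_induct)
  case (insert \<nu> S)
  obtain n where n: "((\<lambda>y. D y - \<nu> *s y) ^^ n) (c \<nu>) = 0"
    using insert.prems(1)[of \<nu>] by (auto simp: geigen_def)
  define c' where "c' \<mu> = ((\<lambda>y. D y - \<nu> *s y) ^^ n) (c \<mu>)" for \<mu>
  have cV: "c \<mu> \<in> V" if "\<mu> \<in> insert \<nu> S" for \<mu>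
    using insert.prems(1)[OF that] by (simp add: geigen_def)
  have "(\<Sum>\<mu>\<in>insert \<nu> S. c' \<mu>) = ((\<lambda>y. D y - \<nu> *s y) ^^ n) (\<Sum>\<mu>\<in>insert \<nu> S. c \<mu>)"
    unfolding c'_def using cV by (intro endo_on_sum[symmetric, OF endo_shift_pow V]) auto
  then have "(\<Sum>\<mu>\<in>S. c' \<mu>) = 0"
    using insert.hyps insert.prems(2) n endo_on_zero[OF endo_shift_pow V] by (simp add: c'_def)
  then have "c' \<mu> = 0" if "\<mu> \<in> S" for \<mu>
    using insert.IH[of c' \<mu>] insert.prems(1) geigen_shift_pow that by (simp add: c'_def)
  then have *: "c \<mu> = 0" if "\<mu> \<in> S" for \<mu>
    using shift_pow_inj_on_geigen[of "c \<mu>" \<mu> n \<nu>] insert.prems(1)[of \<mu>] insert.hyps(2) that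
    by (auto simp: c'_def)
  then have "c \<nu> = 0"
    using insert.prems(2) insert.hyps by simp
  then show ?case
    using * insert.prems(3) by blast
qed simp

text \<open>Subtract from \<open>x\<close> a vector \<open>y\<close> of the sum that accounts for
  every component of \<open>(D - \<kappa>) x\<close> except the one at \<kappa>, where
  \<open>D - \<kappa>\<close> need not be onto. The difference \<open>x - y\<close> is then itself a
  generalised eigenvector for \<kappa>.\<close>

lemma shift_in_geigen_sum:
  assumes "x \<in> V" "D x - \<kappa> *s x \<in> span (\<Union>\<mu>. geigen D V \<mu>)"
  shows "x \<in> span (\<Union>\<mu>. geigen D V \<mu>)"
proof -
  have "\<exists>y\<in>span (\<Union>\<mu>. geigen D V \<mu>). y \<in> V \<and> z - (D y - \<kappa> *s y) \<in> geigen D V \<kappa>"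
    if "z \<in> span (\<Union>\<mu>. geigen D V \<mu>)" for z
    using that
  proof (induction rule: span_induct_alt)
    case base
    then show ?case
      using geigen_subspace V span_zero by (intro bexI[of _ 0]) (auto simp: subspace_0 endo_on_zero[OF D])
  next
    case (step a z1 z2)
    from step.hyps obtain \<mu> where z1: "z1 \<in> geigen D V \<mu>"
      by blast
    from step.IH obtain y2 where y2: "y2 \<in> span (\<Union>\<mu>. geigen D V \<mu>)" "y2 \<in> V"
      "z2 - (D y2 - \<kappa> *s y2) \<in> geigen D V \<kappa>"
      by blast
    have "\<exists>y1\<in>span (\<Union>\<mu>. geigen D V \<mu>). y1 \<in> V \<and> z1 - (D y1 - \<kappa> *s y1) \<in> geigen D V \<kappa>"
    proof (cases "\<kappa> = \<mu>")
      case True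
      then show ?thesis
        using z1 V span_zero by (intro bexI[of _ 0]) (auto simp: subspace_0 endo_on_zero[OF D])
    next
      case False
      then obtain y where y: "y \<in> geigen D V \<mu>" "D y - \<kappa> *s y = z1"
        using shift_surj_on_geigen[OF z1] by blast
      then have "y \<in> span (\<Union>\<mu>. geigen D V \<mu>)" "y \<in> V"
        by (auto simp: geigen_def intro!: span_base)
      then show ?thesis
        using y(2) geigen_subspace by (intro bexI[of _ y]) (auto simp: subspace_0)
    qed
    then obtain y1 where y1: "y1 \<in> span (\<Union>\<mu>. geigen D V \<mu>)" "y1 \<in> V"
      "z1 - (D y1 - \<kappa> *s y1) \<in> geigen D V \<kappa>"
      by blast
    define y where "y = a *s y1 + y2"
    have "D y = a *s D y1 + D y2"
      using y1(2) y2(2) V by (simp add: y_def endo_onD[OF D] subspace_scale)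
    then have "(a *s z1 + z2) - (D y - \<kappa> *s y) =
        a *s (z1 - (D y1 - \<kappa> *s y1)) + (z2 - (D y2 - \<kappa> *s y2))"
      by (simp add: y_def algebra_simps)
    moreover have "a *s (z1 - (D y1 - \<kappa> *s y1)) + (z2 - (D y2 - \<kappa> *s y2)) \<in> geigen D V \<kappa>"
      using y1(3) y2(3) geigen_subspace by (simp add: subspace_add subspace_scale)
    moreover have "y \<in> span (\<Union>\<mu>. geigen D V \<mu>)" "y \<in> V"
      using y1 y2 V by (auto simp: y_def span_add span_scale subspace_add subspace_scale)
    ultimately show ?case
      by metis
  qed
  then obtain y where y: "y \<in> span (\<Union>\<mu>. geigen D V \<mu>)" "y \<in> V"
    "D x - \<kappa> *s x - (D y - \<kappa> *s y) \<in> geigen D V \<kappa>"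
    using assms(2) by blast
  then obtain n where n: "((\<lambda>y. D y - \<kappa> *s y) ^^ n) (D x - \<kappa> *s x - (D y - \<kappa> *s y)) = 0"
    by (auto simp: geigen_def)
  have "D x - \<kappa> *s x - (D y - \<kappa> *s y) = D (x - y) - \<kappa> *s (x - y)"
    using assms(1) y(2) V by (simp add: endo_on_diff[OF D] algebra_simps)
  then have "((\<lambda>y. D y - \<kappa> *s y) ^^ Suc n) (x - y) = 0"
    using n by (simp add: funpow_Suc_right del: funpow.simps)
  then have "x - y \<in> geigen D V \<kappa>"
    using assms(1) y(2) V unfolding geigen_def by (blast intro: subspace_diff)
  then have "(x - y) + y \<in> span (\<Union>\<mu>. geigen D V \<mu>)"
    using y(1) by (intro span_add) (auto intro: span_base)
  then show ?thesis
    by simp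
qed

end

end

section \<open>Vectors annihilated by a polynomial in an operator\<close>

definition (in vector_space) poly_at :: "'a poly \<Rightarrow> ('b \<Rightarrow> 'b) \<Rightarrow> 'b \<Rightarrow> 'b" where
  "poly_at p D x = (\<Sum>i\<le>degree p. coeff p i *s (D ^^ i) x)"

context vector_space
begin

lemma poly_at_bound: "degree p \<le> n \<Longrightarrow> poly_at p D x = (\<Sum>i\<le>n. coeff p i *s (D ^^ i) x)"
  unfolding poly_at_def by (rule sum.mono_neutral_left) (auto simp: coeff_eq_0)

lemma poly_at_linear_factor:
  assumes D: "endo_on V D" and V: "subspace V" "x \<in> V"
  shows "poly_at ([:- \<kappa>, 1:] * q) D x = poly_at q D (D x - \<kappa> *s x)"
proof -
  define n where "n = Suc (degree q)"
  have "degree ([:- \<kappa>, 1:] * q) \<le> n"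
    unfolding n_def by (rule order.trans[OF degree_mult_le]) simp
  then have "poly_at ([:- \<kappa>, 1:] * q) D x = (\<Sum>i\<le>n. coeff ([:- \<kappa>, 1:] * q) i *s (D ^^ i) x)"
    by (rule poly_at_bound)
  also have "\<dots> = (\<Sum>i\<le>n. coeff (pCons 0 q) i *s (D ^^ i) x) - \<kappa> *s (\<Sum>i\<le>n. coeff q i *s (D ^^ i) x)"
    by (simp add: scale_sum_right algebra_simps flip: sum_subtractf)
  also have "(\<Sum>i\<le>n. coeff (pCons 0 q) i *s (D ^^ i) x) = (\<Sum>i\<le>degree q. coeff q i *s (D ^^ i) (D x))"
    unfolding n_def by (subst sum.atMost_Suc_shift) (simp add: funpow_swap1)
  also have "(\<Sum>i\<le>n. coeff q i *s (D ^^ i) x) = (\<Sum>i\<le>degree q. coeff q i *s (D ^^ i) x)"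
    by (simp add: n_def coeff_eq_0)
  also have "(\<Sum>i\<le>degree q. coeff q i *s (D ^^ i) (D x)) - \<kappa> *s (\<Sum>i\<le>degree q. coeff q i *s (D ^^ i) x)
      = (\<Sum>i\<le>degree q. coeff q i *s ((D ^^ i) (D x) - \<kappa> *s (D ^^ i) x))"
    by (simp add: scale_sum_right sum_subtractf scale_right_diff_distrib mult.commute)
  also have "\<dots> = poly_at q D (D x - \<kappa> *s x)"
    unfolding poly_at_def
  proof (intro sum.cong refl)
    fix i
    have "(D ^^ i) (D x - \<kappa> *s x) = (D ^^ i) (D x) - \<kappa> *s (D ^^ i) x"
      using endo_on_funpow[OF D, of i] V endo_onD(1)[OF D]
      by (simp add: endo_on_diff subspace_scale endo_onD(3))
    then show "coeff q i *s ((D ^^ i) (D x) - \<kappa> *s (D ^^ i) x) = coeff q i *s (D ^^ i) (D x - \<kappa> *s x)"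
      by simp
  qed
  finally show ?thesis .
qed

end

locale alg_closed_vector_space = vector_space scale
  for scale :: "'a::alg_closed_field \<Rightarrow> 'b::ab_group_add \<Rightarrow> 'b" (infixr "*s" 75)
begin

text \<open>Each root of \<open>p\<close> splits off a factor \<open>D - \<kappa>\<close>, and the
  shifted vector is annihilated by the quotient, which has smaller degree.\<close>

lemma in_geigen_sum_if_poly_zero:
  assumes D: "endo_on V D" and V: "subspace V"
    and "x \<in> V" "p \<noteq> 0" "poly_at p D x = 0"
  shows "x \<in> span (\<Union>\<mu>. geigen D V \<mu>)"
  using assms(3-5)
proof (induction "degree p" arbitrary: p x rule: less_induct)
  case less
  show ?case
  proof (cases "degree p = 0")
    case True
    then have "coeff p 0 *s x = 0" "coeff p 0 \<noteq> 0"
      using less.prems leading_coeff_0_iff[of p] by (auto simp: poly_at_def)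
    then show ?thesis
      by (simp add: span_zero)
  next
    case False
    then obtain \<kappa> where "poly p \<kappa> = 0"
      using alg_closed_imp_poly_has_root by blast
    then obtain q where q: "p = [:- \<kappa>, 1:] * q"
      by (auto simp: poly_eq_0_iff_dvd)
    have "q \<noteq> 0"
      using less.prems(2) q by auto
    then have "degree q < degree p"
      unfolding q by (subst degree_mult_eq) auto
    moreover have "D x - \<kappa> *s x \<in> V"
      using less.prems(1) endo_onD(1)[OF endo_shift[OF D V]] by blast
    moreover have "poly_at q D (D x - \<kappa> *s x) = 0"
      using less.prems poly_at_linear_factor[OF D V] q by metis
    ultimately have "D x - \<kappa> *s x \<in> span (\<Union>\<mu>. geigen D V \<mu>)"
      using less.hyps \<open>q \<noteq> 0\<close> by blast
    then show ?thesis
      by (rule shift_in_geigen_sum[OF D V less.prems(1)])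
  qed
qed

lemma subset_geigen_sum:
  assumes D: "endo_on V D" and V: "subspace V" "V \<subseteq> span S" "finite S"
  shows "V \<subseteq> span (\<Union>\<mu>. geigen D V \<mu>)"
proof
  fix x assume x: "x \<in> V"
  define n where "n = card S"
  have "(D ^^ i) x \<in> span S" for i
    using endo_onD(1)[OF endo_on_funpow[OF D] x] V by blast
  then obtain c where c: "\<exists>i\<in>{..n}. c i \<noteq> 0" "(\<Sum>i\<le>n. c i *s (D ^^ i) x) = 0"
    using family_dependent[of "{..n}" S "\<lambda>i. (D ^^ i) x"] V by (auto simp: n_def)
  define p where "p = (\<Sum>i\<le>n. monom (c i) i)"
  have coeff_p: "coeff p i = (if i \<le> n then c i else 0)" for i
    unfolding p_def coeff_sum by (simp add: coeff_monom)
  then have "degree p \<le> n"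
    by (intro degree_le) auto
  then have "poly_at p D x = 0"
    using c(2) by (simp add: poly_at_bound coeff_p)
  moreover have "p \<noteq> 0"
  proof -
    obtain i where "i \<le> n" "c i \<noteq> 0"
      using c(1) by blast
    then have "coeff p i \<noteq> 0"
      by (simp add: coeff_p)
    then show ?thesis
      by auto
  qed
  ultimately show "x \<in> span (\<Union>\<mu>. geigen D V \<mu>)"
    using in_geigen_sum_if_poly_zero[OF D V(1) x] by blast
qed

end

section \<open>Triangular bases of generalised eigenvectors\<close>

definition (in vector_space) triangular :: "('b \<Rightarrow> 'b) \<Rightarrow> 'b set \<Rightarrow> 'b list \<Rightarrow> (nat \<Rightarrow> 'a) \<Rightarrow> bool" where
  "triangular D V bs \<mu> \<longleftrightarrow> distinct bs \<and> independent (set bs) \<and>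
     (\<forall>i<length bs. bs ! i \<in> geigen D V (\<mu> i) \<and>
        D (bs ! i) - \<mu> i *s bs ! i \<in> span (set (take i bs)))"

context vector_space
begin

lemma triangular_stable:
  assumes D: "endo_on V D" and V: "subspace V" and T: "triangular D V bs \<mu>"
  shows "set bs \<subseteq> V" "x \<in> span (set bs) \<Longrightarrow> D x \<in> span (set bs)"
proof -
  show sub: "set bs \<subseteq> V"
    using T by (auto simp: triangular_def geigen_def in_set_conv_nth)
  have b: "D b \<in> span (set bs)" if mem: "b \<in> set bs" for b
  proof -
    obtain i where i: "i < length bs" "b = bs ! i"
      using mem by (metis in_set_conv_nth)
    have "D b - \<mu> i *s b \<in> span (set bs)"
      using T i span_mono[OF set_take_subset[of i bs]] by (auto simp: triangular_def)
    then have "(D b - \<mu> i *s b) + \<mu> i *s b \<in> span (set bs)"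
      by (rule span_add[OF _ span_scale[OF span_base[OF mem]]])
    then show ?thesis
      by simp
  qed
  assume "x \<in> span (set bs)"
  then have "x \<in> V \<and> D x \<in> span (set bs)"
  proof (induction x rule: span_induct_alt)
    case base
    then show ?case
      using endo_on_zero[OF D V] span_zero subspace_0[OF V] by simp
  next
    case (step c a y)
    have a: "a \<in> V"
      using step.hyps sub by (rule rev_subsetD)
    have y: "y \<in> V" "D y \<in> span (set bs)"
      using step.IH by blast+
    have "D (c *s a + y) = c *s D a + D y"
      unfolding endo_onD(2)[OF D subspace_scale[OF V a] y(1)] endo_onD(3)[OF D a] ..
    then show ?case
      using span_add[OF span_scale[OF b[OF step.hyps(1)]] y(2)] V a y(1)
      by (simp add: subspace_add subspace_scale)
  qed
  then show "D x \<in> span (set bs)"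
    by blast
qed

text \<open>Apply \<open>D - \<kappa>\<close> repeatedly to a generalised eigenvector outside the
  span: the vector just before the chain first enters the span is an admissible next basis
  vector.\<close>

lemma triangular_extend:
  assumes D: "endo_on V D" and V: "subspace V" and T: "triangular D V bs \<mu>"
    and gen: "V \<subseteq> span (\<Union>\<mu>. geigen D V \<mu>)" and not: "\<not> V \<subseteq> span (set bs)"
  obtains b \<kappa> where "triangular D V (bs @ [b]) (\<mu>(length bs := \<kappa>))"
proof -
  define U where "U = span (set bs)"
  have "\<not> (\<Union>\<mu>. geigen D V \<mu>) \<subseteq> U"
    using not gen span_minimal[of "\<Union>\<mu>. geigen D V \<mu>" U] by (auto simp: U_def)
  then obtain \<kappa> x where x: "x \<in> geigen D V \<kappa>" "x \<notin> U"
    by blast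
  define f where "f = (\<lambda>y. D y - \<kappa> *s y)"
  obtain k where "(f ^^ k) x = 0"
    using x(1) by (auto simp: geigen_def f_def)
  then have "(f ^^ k) x \<in> U"
    by (simp add: U_def span_zero)
  then obtain m where m: "(f ^^ m) x \<in> U" "\<And>n. n < m \<Longrightarrow> (f ^^ n) x \<notin> U"
    using exists_least_iff[of "\<lambda>n. (f ^^ n) x \<in> U"] by blast
  have "m \<noteq> 0"
    using m(1) x(2) by (intro notI) simp
  then obtain n where n: "m = Suc n"
    using not0_implies_Suc by blast
  define b where "b = (f ^^ n) x"
  have b: "b \<notin> U" "b \<in> geigen D V \<kappa>" "D b - \<kappa> *s b \<in> U"
    using m n geigen_shift_pow[OF D V x(1), of n \<kappa>] by (auto simp: b_def f_def)
  have "b \<notin> set bs"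
    using b(1) span_base by (auto simp: U_def)
  moreover have "independent (insert b (set bs))"
    using T b(1) unfolding triangular_def U_def by (intro independent_insertI) auto
  ultimately have "triangular D V (bs @ [b]) (\<mu>(length bs := \<kappa>))"
    using T b unfolding triangular_def by (auto simp: nth_append less_Suc_eq U_def)
  then show ?thesis
    by (rule that)
qed

text \<open>The basis serves two purposes: generalised eigenvectors make every operator that scales
  the generalised eigenspaces diagonal, and triangularity lets traces be read off from the
  eigenvalues.\<close>

lemma triangular_exists:
  assumes D: "endo_on V D" and V: "subspace V" "V \<subseteq> span S" "finite S"
    and gen: "V \<subseteq> span (\<Union>\<mu>. geigen D V \<mu>)"
  obtains bs \<mu> where "triangular D V bs \<mu>" "span (set bs) = V"
proof -
  define P where "P bs \<longleftrightarrow> (\<exists>\<mu>. triangular D V bs \<mu>)" for bs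
  have "P []"
    using independent_empty by (auto simp: P_def triangular_def)
  moreover have "length bs \<le> card S" if P: "P bs" for bs
  proof -
    obtain \<mu> where T: "triangular D V bs \<mu>"
      using P unfolding P_def by blast
    then have "set bs \<subseteq> span S"
      using triangular_stable(1)[OF D V(1)] V(2) by blast
    then have "card (set bs) \<le> card S"
      using T independent_span_bound[OF V(3)] by (auto simp: triangular_def)
    then show ?thesis
      using T by (simp add: triangular_def distinct_card)
  qed
  ultimately have "\<exists>bs. P bs \<and> (\<forall>bs'. P bs' \<longrightarrow> length bs' \<le> length bs)"
    by (intro ex_has_greatest_nat[of P "[]" length "Suc (card S)"]) (auto simp: less_Suc_eq_le)
  then obtain bs where bs: "P bs" "\<And>bs'. P bs' \<Longrightarrow> length bs' \<le> length bs"
    by blast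
  then obtain \<mu> where T: "triangular D V bs \<mu>"
    unfolding P_def by blast
  have "V \<subseteq> span (set bs)"
  proof (rule ccontr)
    assume "\<not> V \<subseteq> span (set bs)"
    then obtain b \<kappa> where "triangular D V (bs @ [b]) (\<mu>(length bs := \<kappa>))"
      using triangular_extend[OF D V(1) T gen] by metis
    then show False
      using bs(2)[of "bs @ [b]"] by (auto simp: P_def)
  qed
  then have "span (set bs) = V"
    using triangular_stable(1)[OF D V(1) T] V(1) by (simp add: span_subspace)
  then show ?thesis
    using T that by blast
qed

text \<open>\<open>E\<close> is diagonal in the basis and \<open>D\<close> is triangular, so the
  diagonal entries of the product are products of diagonal entries.\<close>

lemma trace_triangular:
  assumes T: "triangular D V bs \<mu>" "span (set bs) = V" and D: "endo_on V D"
    and E: "\<And>i. i < length bs \<Longrightarrow> E (bs ! i) = \<phi> i *s bs ! i"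
  shows "trace (set bs) (\<lambda>x. D (E x)) = (\<Sum>i<length bs. \<phi> i * \<mu> i)"
proof -
  have dist: "distinct bs" and ind: "independent (set bs)"
    using T by (auto simp: triangular_def)
  have "representation (set bs) (D (E (bs ! i))) (bs ! i) = \<phi> i * \<mu> i" if i: "i < length bs" for i
  proof -
    define b where "b = bs ! i"
    define z where "z = D b - \<mu> i *s b"
    have b: "b \<in> set bs" "b \<in> V"
      using i T(2) span_base by (auto simp: b_def)
    have z: "z \<in> span (set (take i bs))"
      using T(1) i by (auto simp: triangular_def z_def b_def)
    have "b \<notin> set (take i bs)"
      using dist i by (auto simp: b_def in_set_conv_nth nth_eq_iff_index_eq)
    then have "representation (set (take i bs)) z b = 0"
      using representation_ne_zero by blast
    then have rep_z: "representation (set bs) z b = 0"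
      using representation_extend[OF ind z set_take_subset] by simp
    have zs: "z \<in> span (set bs)"
      using z span_mono[OF set_take_subset] by blast
    have "D (E b) = \<phi> i *s (\<mu> i *s b + z)"
      using E[OF i] b(2) by (simp add: b_def[symmetric] endo_onD(3)[OF D] z_def)
    then have "representation (set bs) (D (E b)) b =
        \<phi> i * (\<mu> i * representation (set bs) b b + representation (set bs) z b)"
      using ind b(1) zs
      by (simp add: representation_scale representation_add span_add span_scale span_base
          del: scale_scale)
    then show ?thesis
      using ind b(1) rep_z by (simp add: representation_basis b_def)
  qed
  then have "(\<Sum>i<length bs. representation (set bs) (D (E (bs ! i))) (bs ! i)) = (\<Sum>i<length bs. \<phi> i * \<mu> i)"
    by simp
  then show ?thesis
    unfolding trace_def by (simp only: sum.reindex_bij_betw[OF bij_betw_nth[OF dist refl refl], symmetric])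
qed

lemma triangular_nilpotent:
  assumes T: "triangular D V bs \<mu>" "span (set bs) = V" and D: "endo_on V D"
    and \<mu>: "\<And>i. i < length bs \<Longrightarrow> \<mu> i = 0" and "x \<in> V"
  shows "(D ^^ length bs) x = 0"
proof -
  have V: "subspace V"
    using T(2) by auto
  have "k \<le> length bs \<Longrightarrow> x \<in> span (set (take k bs)) \<Longrightarrow> (D ^^ k) x = 0" for k x
  proof (induction k arbitrary: x)
    case (Suc k)
    define b where "b = bs ! k"
    have "set (take (Suc k) bs) = insert b (set (take k bs))"
      using Suc.prems(1) by (simp add: take_Suc_conv_app_nth b_def)
    then obtain c where c: "x - c *s b \<in> span (set (take k bs))"
      using Suc.prems(2) by (auto simp: span_insert)
    have "D b - \<mu> k *s b \<in> span (set (take k bs))"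
      using T(1) Suc.prems(1) by (simp add: triangular_def b_def)
    then have "D b \<in> span (set (take k bs))"
      using \<mu>[of k] Suc.prems(1) by simp
    then have b0: "(D ^^ Suc k) b = 0"
      using Suc.IH[of "D b"] Suc.prems(1) by (simp add: funpow_Suc_right del: funpow.simps)
    have bV: "b \<in> V"
      using T Suc.prems(1) span_base by (auto simp: b_def)
    define y where "y = x - c *s b"
    have y: "y \<in> span (set (take k bs))" "y \<in> V" "x = y + c *s b"
      using c T(2) span_mono[OF set_take_subset] by (auto simp: y_def)
    have "(D ^^ Suc k) y = 0"
      using Suc.IH[OF _ y(1)] Suc.prems(1) endo_on_zero[OF D V] by simp
    then show ?case
      unfolding y(3) using endo_on_funpow[OF D, of "Suc k"] b0 bV y(2) V
      by (simp add: endo_onD(2,3) subspace_scale del: funpow.simps)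
  qed simp
  from this[of "length bs" x] show ?thesis
    using T(2) \<open>x \<in> V\<close> by simp
qed

lemma geigen_scaling_exists:
  assumes D: "endo_on A D" and A: "subspace A" and gen: "A \<subseteq> span (\<Union>\<mu>. geigen D A \<mu>)"
  obtains E where "endo_on A E" "\<And>\<mu> x. x \<in> geigen D A \<mu> \<Longrightarrow> E x = \<phi> \<mu> *s x"
proof -
  \<comment> \<open>\<open>S\<close> may exceed the support of \<open>c\<close>, so that any two
    decompositions can be compared over a common index set.\<close>
  define dec where "dec x c S \<longleftrightarrow> finite S \<and> (\<forall>\<mu>. c \<mu> \<in> geigen D A \<mu>) \<and>
    (\<forall>\<mu>. \<mu> \<notin> S \<longrightarrow> c \<mu> = 0) \<and> x = (\<Sum>\<mu>\<in>S. c \<mu>)" for x c S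
  note G = geigen_subspace[OF D A]
  have dec_mono: "dec x c S'" if "dec x c S" "S \<subseteq> S'" "finite S'" for x c S S'
    using that sum.mono_neutral_left[of S' S c] unfolding dec_def by auto
  have fin: "finite S" if "dec x c S" for x c S
    using that by (simp add: dec_def)
  have dec_Un: "dec x c (S \<union> S')" "dec y c' (S \<union> S')" if "dec x c S" "dec y c' S'" for x y c c' S S'
    using that by (meson dec_mono fin finite_UnI Un_upper1 Un_upper2)+
  have dec_unique: "c = c'" if "dec x c S" "dec x c' S'" for x c c' S S'
  proof
    fix \<mu>
    have dec: "dec x c (S \<union> S')" "dec x c' (S \<union> S')"
      using dec_Un[OF that] by blast+
    then have "(\<Sum>\<mu>\<in>S \<union> S'. c \<mu> - c' \<mu>) = 0"
      by (auto simp: dec_def sum_subtractf)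
    then have "c \<mu> - c' \<mu> = 0" if "\<mu> \<in> S \<union> S'"
      using geigen_direct[OF D A, of "S \<union> S'" "\<lambda>\<mu>. c \<mu> - c' \<mu>" \<mu>] dec G that
      by (auto simp: dec_def subspace_diff)
    then show "c \<mu> = c' \<mu>"
      using dec unfolding dec_def by (metis right_minus_eq)
  qed
  have dec_add: "dec (x + y) (\<lambda>\<mu>. c \<mu> + c' \<mu>) (S \<union> S')" if "dec x c S" "dec y c' S'" for x y c c' S S'
  proof -
    have "dec x c (S \<union> S')" "dec y c' (S \<union> S')"
      using dec_Un[OF that] by blast+
    then show ?thesis
      using G by (auto simp: dec_def sum.distrib subspace_add)
  qed
  have dec_scale: "dec (a *s x) (\<lambda>\<mu>. a *s c \<mu>) S" if "dec x c S" for a x c S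
    using that G by (auto simp: dec_def scale_sum_right subspace_scale)
  have dec_single: "dec x (\<lambda>\<nu>. if \<nu> = \<mu> then x else 0) {\<mu>}" if "x \<in> geigen D A \<mu>" for x \<mu>
    using that G by (auto simp: dec_def subspace_0)
  have dec_exists: "\<exists>c S. dec x c S" if "x \<in> A" for x
  proof -
    have "x \<in> span (\<Union>\<mu>. geigen D A \<mu>)"
      using gen that by blast
    then show ?thesis
    proof (induction rule: span_induct_alt)
      case base
      have "dec 0 (\<lambda>_. 0) {}"
        using G by (auto simp: dec_def subspace_0)
      then show ?case
        by blast
    next
      case (step a x y)
      then show ?case
        using dec_add dec_scale dec_single by blast
    qed
  qed
  define coord where "coord x = (SOME c. \<exists>S. dec x c S)" for x
  define E where "E x = (\<Sum>\<mu> | coord x \<mu> \<noteq> 0. \<phi> \<mu> *s coord x \<mu>)" for x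
  have E: "E x = (\<Sum>\<mu>\<in>S. \<phi> \<mu> *s c \<mu>)" if "dec x c S" for x c S
  proof -
    have "\<exists>S. dec x (coord x) S"
      unfolding coord_def by (rule someI_ex[of "\<lambda>c. \<exists>S. dec x c S"]) (use that in blast)
    then have "coord x = c"
      using dec_unique that by blast
    moreover have "(\<Sum>\<mu> | c \<mu> \<noteq> 0. \<phi> \<mu> *s c \<mu>) = (\<Sum>\<mu>\<in>S. \<phi> \<mu> *s c \<mu>)"
      using that by (intro sum.mono_neutral_left) (auto simp: dec_def)
    ultimately show ?thesis
      by (simp add: E_def)
  qed
  have "endo_on A E"
    unfolding endo_on_def
  proof (intro conjI ballI allI)
    fix x assume x: "x \<in> A"
    then obtain c S where dec: "dec x c S"
      using dec_exists by blast
    have "c \<mu> \<in> A" for \<mu>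
      using dec by (auto simp: dec_def geigen_def)
    then show "E x \<in> A"
      unfolding E[OF dec] using A by (intro subspace_sum subspace_scale) auto
    show "E (a *s x) = a *s E x" for a
      unfolding E[OF dec] E[OF dec_scale[OF dec]] by (simp add: scale_sum_right mult.commute)
  next
    fix x y assume "x \<in> A" "y \<in> A"
    then obtain c S c' S' where dec: "dec x c S" "dec y c' S'"
      using dec_exists by metis
    then have dec': "dec x c (S \<union> S')" "dec y c' (S \<union> S')"
      using dec_Un by blast+
    show "E (x + y) = E x + E y"
      unfolding E[OF dec'(1)] E[OF dec'(2)] E[OF dec_add[OF dec]]
      by (simp add: scale_right_distrib sum.distrib)
  qed
  moreover have "E x = \<phi> \<mu> *s x" if "x \<in> geigen D A \<mu>" for x \<mu>
    using E[OF dec_single[OF that]] by simp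
  ultimately show ?thesis
    by (rule that)
qed

end

section \<open>Engel's theorem\<close>

definition fscale :: "'k \<Rightarrow> ('a \<Rightarrow> 'k::field) \<Rightarrow> 'a \<Rightarrow> 'k" where
  "fscale c f = (\<lambda>x. c * f x)"

lemma fscale_apply: "fscale c f x = c * f x"
  by (simp add: fscale_def)

text \<open>
  As simplification rules, these equations would also rewrite functions in argument positions,
  such as \<open>D 0\<close> to \<open>D (\<lambda>x. 0)\<close>.
\<close>

declare plus_fun_apply [simp del] zero_fun_apply [simp del] times_fun_apply [simp del]
  minus_apply [simp del] uminus_apply [simp del]

lemmas fun_apply = plus_fun_apply zero_fun_apply times_fun_apply minus_apply uminus_apply fscale_apply

interpretation fn: vector_space fscale
  by standard (auto simp: fun_eq_iff fun_apply algebra_simps)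

lemma scale_apply: "scale c D f = fscale c (D f)"
  by (auto simp: scale_def fun_apply)

lemma op_apply:
  fixes D E :: "('g, 'k::field) operator"
  shows "(D + E) f = D f + E f" "(D - E) f = D f - E f" "(- D) f = - D f"
    "(0 :: ('g, 'k) operator) f = 0" "scale c D f = fscale c (D f)"
  by (simp_all add: fun_apply scale_apply)

interpretation opr: vector_space scale
  by standard (auto simp: fun_eq_iff scale_def fun_apply algebra_simps)

definition word :: "('g, 'k) operator list \<Rightarrow> ('g, 'k) operator" where
  "word Ds f = foldr (\<lambda>D. D) Ds f"

lemma word_simps [simp]:
  "word [] f = f" "word (D # Ds) f = D (word Ds f)" "word (Ds @ Es) f = word Ds (word Es f)"
  by (simp_all add: word_def)

text \<open>The ascending series of common annihilators of products of operators from
  \<open>K\<close>. That \<open>K\<close> acts nilpotently as a whole on \<open>V\<close> means that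
  the series reaches \<open>V\<close>; words of operators avoid quotient spaces.\<close>

definition flag :: "('g, 'k::field) operator set \<Rightarrow> ('g \<Rightarrow> 'k) set \<Rightarrow> nat \<Rightarrow> ('g \<Rightarrow> 'k) set" where
  "flag K V i = {f \<in> V. \<forall>Ds. set Ds \<subseteq> K \<and> length Ds = i \<longrightarrow> word Ds f = 0}"

lemma word_endo_on:
  assumes "\<And>D. D \<in> set Ds \<Longrightarrow> fn.endo_on V D"
  shows "fn.endo_on V (word Ds)"
  using assms
proof (induction Ds)
  case Nil
  have "word [] = (\<lambda>f. f)"
    by (rule ext) simp
  then show ?case
    by (simp add: fn.endo_on_def)
next
  case (Cons D Ds)
  have "word (D # Ds) = (\<lambda>f. D (word Ds f))"
    by (rule ext) simp
  then show ?case
    using Cons fn.endo_on_comp[of V D "word Ds"] by simp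
qed

locale operators_on =
  fixes L :: "('g, 'k::field) operator set" and V :: "('g \<Rightarrow> 'k) set"
  assumes V: "fn.subspace V" and endo: "\<And>D. D \<in> L \<Longrightarrow> fn.endo_on V D"
begin

lemma flag_0: "flag K V 0 = {0}"
  using V by (auto simp: flag_def fn.subspace_0)

lemma flag_Suc:
  assumes "K \<subseteq> L"
  shows "flag K V (Suc i) = {f \<in> V. \<forall>D\<in>K. D f \<in> flag K V i}"
proof -
  have "D f \<in> V" if "D \<in> K" "f \<in> V" for D f
    using that assms endo by (auto simp: fn.endo_on_def)
  moreover have "(\<forall>Ds. set Ds \<subseteq> K \<and> length Ds = Suc i \<longrightarrow> word Ds f = 0) \<longleftrightarrow>
      (\<forall>D\<in>K. \<forall>Ds. set Ds \<subseteq> K \<and> length Ds = i \<longrightarrow> word Ds (D f) = 0)" for f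
  proof (intro iffI ballI allI impI)
    fix D Ds
    assume *: "\<forall>Ds. set Ds \<subseteq> K \<and> length Ds = Suc i \<longrightarrow> word Ds f = 0"
      and D: "D \<in> K" "set Ds \<subseteq> K \<and> length Ds = i"
    show "word Ds (D f) = 0"
      using *[rule_format, of "Ds @ [D]"] D by simp
  next
    fix Ds
    assume *: "\<forall>D\<in>K. \<forall>Ds. set Ds \<subseteq> K \<and> length Ds = i \<longrightarrow> word Ds (D f) = 0"
      and Ds: "set Ds \<subseteq> K \<and> length Ds = Suc i"
    then obtain Es D where Es: "Ds = Es @ [D]" "length Es = i"
      by (metis length_Suc_conv_rev)
    show "word Ds f = 0"
      using *[rule_format, of D Es] Ds Es by simp
  qed
  ultimately show ?thesis
    by (auto simp: flag_def)
qed

lemma flag_subspace: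
  assumes "K \<subseteq> L"
  shows "fn.subspace (flag K V i)"
proof (rule fn.subspaceI)
  have endo: "fn.endo_on V (word Ds)" if "set Ds \<subseteq> K" for Ds
    using that assms endo by (intro word_endo_on) auto
  show "0 \<in> flag K V i"
    using endo fn.endo_on_zero V by (auto simp: flag_def fn.subspace_0)
  show "f + g \<in> flag K V i" if "f \<in> flag K V i" "g \<in> flag K V i" for f g
    using that endo V by (auto simp: flag_def fn.subspace_add fn.endo_on_def)
  show "fscale c f \<in> flag K V i" if "f \<in> flag K V i" for c f
    using that endo V fn.scale_zero_right[of c]
    by (auto simp: flag_def fn.subspace_scale fn.endo_on_def)
qed

lemma flag_Suc_mono:
  assumes "K \<subseteq> L"
  shows "flag K V i \<subseteq> flag K V (Suc i)"
proof
  fix f assume f: "f \<in> flag K V i"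
  have "word Ds f = 0" if Ds: "set Ds \<subseteq> K" "length Ds = Suc i" for Ds
  proof -
    obtain D Es where "Ds = D # Es"
      using Ds(2) by (cases Ds) auto
    then show ?thesis
      using f Ds assms fn.endo_on_zero[OF endo V] by (auto simp: flag_def)
  qed
  then show "f \<in> flag K V (Suc i)"
    using f by (auto simp: flag_def)
qed

lemma flag_mono:
  assumes "K \<subseteq> L" "i \<le> j"
  shows "flag K V i \<subseteq> flag K V j"
  using assms(2) by (induction j rule: dec_induct) (use flag_Suc_mono[OF assms(1)] in auto)

lemma flag_lower:
  assumes "K \<subseteq> L" "D \<in> K" "f \<in> flag K V i"
  shows "D f \<in> flag K V (i - 1)"
proof (cases i)
  case 0
  then show ?thesis
    using assms flag_0 fn.endo_on_zero[OF endo V] by auto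
next
  case (Suc j)
  then show ?thesis
    using assms flag_Suc by auto
qed

end

locale nil_lie_algebra = operators_on L V
  for L :: "('g, 'k::field) operator set" and V +
  assumes L: "opr.subspace L" and bracket: "\<And>D E. D \<in> L \<Longrightarrow> E \<in> L \<Longrightarrow> lie_bracket D E \<in> L"
    and faithful: "\<And>D. D \<in> L \<Longrightarrow> (\<And>f. f \<in> V \<Longrightarrow> D f = 0) \<Longrightarrow> D = 0"
    and finite_dim: "\<exists>T. finite T \<and> L \<subseteq> opr.span T"
    and nil: "\<And>D. D \<in> L \<Longrightarrow> \<exists>e. \<forall>f\<in>V. (D ^^ e) f = 0"
begin

lemma L_eqI:
  assumes "D \<in> L" "E \<in> L" "\<And>f. f \<in> V \<Longrightarrow> D f = E f"
  shows "D = E"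
proof -
  have "D - E = 0"
    using assms L by (intro faithful) (auto simp: opr.subspace_diff op_apply)
  then show ?thesis
    by simp
qed

lemma bracket_comm: "lie_bracket E D = - lie_bracket D E"
  by (auto simp: lie_bracket_def fun_eq_iff fun_apply)

lemma bracket_linear:
  assumes "D \<in> L" "E \<in> L" "F \<in> L"
  shows "lie_bracket D (scale c E + F) = scale c (lie_bracket D E) + lie_bracket D F"
proof (rule L_eqI)
  show "lie_bracket D (scale c E + F) \<in> L" "scale c (lie_bracket D E) + lie_bracket D F \<in> L"
    using assms L bracket by (auto intro!: opr.subspace_add opr.subspace_scale)
  fix f assume f: "f \<in> V"
  note endo' = fn.endo_onD[OF endo[OF assms(1)]] fn.endo_onD[OF endo[OF assms(2)]]
    fn.endo_onD[OF endo[OF assms(3)]]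
  have *: "D (fscale c (E f) + F f) = fscale c (D (E f)) + D (F f)"
    using f endo' V by (simp add: fn.subspace_scale)
  have "lie_bracket D (scale c E + F) f = fscale c (D (E f)) + D (F f) - (fscale c (E (D f)) + F (D f))"
    by (simp add: lie_bracket_def op_apply *)
  then show "lie_bracket D (scale c E + F) f = (scale c (lie_bracket D E) + lie_bracket D F) f"
    by (simp add: lie_bracket_def op_apply fn.scale_right_diff_distrib)
qed

text \<open>If bracketing with \<open>K\<close> always had a result outside \<open>K\<close>, it
  could be repeated forever. Every such bracket lowers by one the bound on how far the operator can
  raise the flag of \<open>K\<close>, so eventually the operator is zero, which lies in
  \<open>K\<close>.\<close>

lemma normalising_element:
  assumes K: "K \<subseteq> L" "K \<noteq> L" "0 \<in> K" and d: "flag K V d = V"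
  obtains x where "x \<in> L" "x \<notin> K" "\<And>k. k \<in> K \<Longrightarrow> lie_bracket k x \<in> K"
proof (rule ccontr)
  assume no: "\<not> thesis"
  have step: "\<exists>k\<in>K. lie_bracket k x \<notin> K" if "x \<in> L" "x \<notin> K" for x
    using no \<open>x \<in> L\<close> \<open>x \<notin> K\<close> \<open>\<And>x. \<lbrakk>x \<in> L; x \<notin> K; \<And>k. k \<in> K \<Longrightarrow> lie_bracket k x \<in> K\<rbrakk> \<Longrightarrow> thesis\<close> by blast
  have "\<exists>y. y \<in> L \<and> y \<notin> K \<and> (\<forall>i. \<forall>f\<in>flag K V i. y f \<in> flag K V (i + d - n))" for n
  proof (induction n)
    case 0
    obtain y where y: "y \<in> L" "y \<notin> K"
      using K by blast
    have "y f \<in> flag K V (i + d)" if "f \<in> flag K V i" for f i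
    proof -
      have "y f \<in> V"
        using that y endo by (auto simp: flag_def fn.endo_on_def)
      then show ?thesis
        using d flag_mono[OF K(1), of d "i + d"] by auto
    qed
    then show ?case
      using y by (intro exI[of _ y]) auto
  next
    case (Suc n)
    then obtain y where y: "y \<in> L" "y \<notin> K"
      and shift: "\<And>i f. f \<in> flag K V i \<Longrightarrow> y f \<in> flag K V (i + d - n)"
      by blast
    obtain k where k: "k \<in> K" "lie_bracket k y \<notin> K"
      using step y by blast
    have "lie_bracket k y f \<in> flag K V (i + d - Suc n)" if f: "f \<in> flag K V i" for f i
    proof -
      have "k (y f) \<in> flag K V (i + d - Suc n)"
        using flag_lower[OF K(1) k(1) shift[OF f]] by simp
      moreover have "y (k f) \<in> flag K V (i + d - Suc n)"
      \<comment> \<open>Subtraction is truncated: \<open>flag_lower\<close> gains nothing at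
        \<open>i = 0\<close>, but there \<open>f\<close> is zero.\<close>
      proof (cases i)
        case 0
        then have "f = 0"
          using f flag_0 by auto
        moreover have "k \<in> L"
          using k(1) K(1) by blast
        ultimately have "y (k f) = 0"
          using fn.endo_on_zero[OF endo V] y(1) by metis
        then show ?thesis
          using fn.subspace_0[OF flag_subspace[OF K(1)]] by simp
      next
        case (Suc j)
        then show ?thesis
          using shift[OF flag_lower[OF K(1) k(1) f]] by simp
      qed
      ultimately show ?thesis
        using flag_subspace[OF K(1)] by (simp add: lie_bracket_def fn.subspace_diff)
    qed
    moreover have "lie_bracket k y \<in> L"
      using k(1) K(1) y(1) bracket by blast
    ultimately show ?case
      using k(2) by blast
  qed
  \<comment> \<open>An arbitrary operator starts with the bound \<open>d\<close>, the length of the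
    flag; after \<open>2 * d\<close> brackets \<open>V\<close>, which is level \<open>d\<close>, is
    sent to level 0.\<close>
  from this[of "2 * d"] obtain y where y: "y \<in> L" "y \<notin> K"
    "\<And>i f. f \<in> flag K V i \<Longrightarrow> y f \<in> flag K V (i + d - 2 * d)"
    by blast
  have "y f = 0" if "f \<in> V" for f
    using y(3)[of f d] that d flag_0 by (simp add: mult_2)
  then have "y = 0"
    using faithful y(1) by blast
  then show False
    using y(2) K(3) by simp
qed

text \<open>Since \<open>x\<close> normalises \<open>K\<close>, it preserves the flag of
  \<open>K\<close>. On each quotient of the flag \<open>K\<close> acts by zero, so a word in
  \<open>K'\<close> acts as a multiple of a power of \<open>x\<close>, and \<open>e\<close> letters
  descend one level; \<open>d * e\<close> letters descend all of them.\<close>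

lemma extension_nilpotent:
  assumes K: "K \<subseteq> L" "opr.subspace K" and d: "flag K V d = V"
    and x: "x \<in> L" "\<And>k. k \<in> K \<Longrightarrow> lie_bracket k x \<in> K"
    and K': "\<And>D. D \<in> K' \<Longrightarrow> \<exists>k\<in>K. \<exists>c. D = k + scale c x"
  shows "\<exists>d'. flag K' V d' = V"
proof -
  obtain e where e: "\<And>f. f \<in> V \<Longrightarrow> (x ^^ e) f = 0"
    using nil[OF x(1)] by blast
  note sub = flag_subspace[OF K(1)]
  have flag_V: "f \<in> V" if "f \<in> flag K V i" for f i
    using that by (simp add: flag_def)
  have x_flag: "x f \<in> flag K V i" if "f \<in> flag K V i" for f i
    using that
  proof (induction i arbitrary: f)
    case 0
    then show ?case
      using fn.endo_on_zero[OF endo[OF x(1)] V] unfolding flag_0 by (metis singletonD singletonI)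
  next
    case (Suc i)
    have "k (x f) \<in> flag K V i" if k: "k \<in> K" for k
    proof -
      have "x (k f) \<in> flag K V i" "lie_bracket k x f \<in> flag K V i"
        using Suc k x(2) flag_Suc[OF K(1)] by auto
      then have "x (k f) + lie_bracket k x f \<in> flag K V i"
        using sub by (simp add: fn.subspace_add)
      then show ?thesis
        by (simp add: lie_bracket_def)
    qed
    moreover have "x f \<in> V"
      using flag_V[OF Suc.prems] endo[OF x(1)] by (simp add: fn.endo_on_def)
    ultimately show ?case
      using flag_Suc[OF K(1)] by auto
  qed
  have xpow_flag: "(x ^^ j) f \<in> flag K V i" if "f \<in> flag K V i" for f i j
    using that by (induction j) (auto intro: x_flag)
  have k_flag: "k f \<in> flag K V i" if "k \<in> K" "f \<in> flag K V i" for k f i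
    using flag_lower[OF K(1) that] flag_mono[OF K(1), of "i - 1" i] by auto
  have K'_flag: "D f \<in> flag K V i" if D: "D \<in> K'" and f: "f \<in> flag K V i" for D f i
  proof -
    obtain k c where "k \<in> K" "D = k + scale c x"
      using K'[OF D] by blast
    then show ?thesis
      using f sub by (simp add: op_apply fn.subspace_add fn.subspace_scale k_flag x_flag)
  qed
  have endo': "fn.endo_on V D" if D: "D \<in> K'" for D
  proof -
    obtain k c where "k \<in> K" "D = k + scale c x"
      using K'[OF D] by blast
    then have "D \<in> L"
      using K(1) x(1) L by (auto intro!: opr.subspace_add opr.subspace_scale)
    then show ?thesis
      by (rule endo)
  qed
  \<comment> \<open>A congruence modulo level \<open>i\<close>; the scalar \<open>c\<close> is the
    product of the coefficients of \<open>x\<close> in the letters.\<close>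
  have power: "\<exists>c. word Ds f - fscale c ((x ^^ length Ds) f) \<in> flag K V i"
    if f: "f \<in> flag K V (Suc i)" and "set Ds \<subseteq> K'" for f i Ds
    using that(2)
  proof (induction Ds)
    case Nil
    show ?case
      using fn.subspace_0[OF sub] by (intro exI[of _ 1]) simp
  next
    case (Cons D Ds)
    then obtain c where c: "word Ds f - fscale c ((x ^^ length Ds) f) \<in> flag K V i"
      by auto
    obtain k b where k: "k \<in> K" "D = k + scale b x"
      using K' Cons.prems by force
    define u where "u = word Ds f - fscale c ((x ^^ length Ds) f)"
    define y where "y = (x ^^ length Ds) f"
    have y: "y \<in> flag K V (Suc i)"
      unfolding y_def using f by (rule xpow_flag)
    have u: "u \<in> flag K V i"
      using c by (simp add: u_def)
    have w: "word Ds f = u + fscale c y"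
      by (simp add: u_def y_def)
    have D: "D (word Ds f) = D u + fscale c (D y)"
      unfolding w using endo'[of D] Cons.prems flag_V[OF u] flag_V[OF y] V
      by (simp add: fn.endo_onD fn.subspace_scale)
    have "D (word Ds f) - fscale (c * b) (x y) = D u + fscale c (k y)"
      unfolding D by (simp add: k(2) op_apply fn.scale_right_distrib)
    also have "\<dots> \<in> flag K V i"
      using K'_flag u k(1) y flag_Suc[OF K(1)] Cons.prems sub
      by (intro fn.subspace_add fn.subspace_scale) auto
    finally show ?case
      by (intro exI[of _ "c * b"]) (simp add: y_def)
  qed
  have drop: "word Ds f \<in> flag K V i" if "f \<in> flag K V (Suc i)" "set Ds \<subseteq> K'" "length Ds = e" for f i Ds
    using power[OF that(1,2)] that(3) e[OF flag_V[OF that(1)]] by auto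
  have "word Ds f = 0" if "f \<in> flag K V i" "set Ds \<subseteq> K'" "length Ds = i * e" for i f Ds
    using that
  proof (induction i arbitrary: f Ds)
    case 0
    then show ?case
      using flag_0 by simp
  next
    case (Suc i)
    define Ds1 where "Ds1 = take (i * e) Ds"
    define Ds2 where "Ds2 = drop (i * e) Ds"
    have Ds: "Ds = Ds1 @ Ds2" "length Ds1 = i * e" "length Ds2 = e" "set Ds1 \<subseteq> K'" "set Ds2 \<subseteq> K'"
      using Suc.prems set_take_subset[of "i * e" Ds] set_drop_subset[of "i * e" Ds]
      by (auto simp: Ds1_def Ds2_def)
    then show ?case
      using Suc.IH[OF drop[OF Suc.prems(1)]] by simp
  qed
  then have "flag K' V (d * e) = V"
    using d unfolding flag_def by blast
  then show ?thesis
    by blast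
qed

text \<open>A maximal subalgebra acting nilpotently must be everything, since otherwise a
  normalising element outside it would enlarge it.\<close>

theorem engel: "\<exists>d. flag L V d = V"
proof -
  obtain T where T: "finite T" "L \<subseteq> opr.span T"
    using finite_dim by blast
  \<comment> \<open>Subalgebras are represented by their bases, so that a maximal one can be chosen
    by cardinality.\<close>
  define P where "P S \<longleftrightarrow> S \<subseteq> L \<and> finite S \<and> opr.independent S \<and>
    (\<forall>D\<in>opr.span S. \<forall>E\<in>opr.span S. lie_bracket D E \<in> opr.span S) \<and>
    (\<exists>d. flag (opr.span S) V d = V)" for S
  have span_L: "opr.span S \<subseteq> L" if "S \<subseteq> L" for S
    using that L by (rule opr.span_minimal)
  have "flag {0} V 1 = V"
    by (auto simp: flag_def length_Suc_conv op_apply)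
  moreover have "lie_bracket 0 0 = (0 :: ('g, 'k) operator)"
    by (simp add: lie_bracket_def op_apply fun_eq_iff)
  ultimately have "P {}"
    unfolding P_def opr.span_empty using opr.independent_empty by blast
  moreover have "card S < Suc (card T)" if "P S" for S
  proof -
    have "opr.independent S" "S \<subseteq> opr.span T"
      using that T(2) unfolding P_def by blast+
    then show ?thesis
      using opr.independent_span_bound[OF T(1), of S] by (simp add: less_Suc_eq_le)
  qed
  ultimately have "\<exists>S. P S \<and> (\<forall>S'. P S' \<longrightarrow> card S' \<le> card S)"
    by (intro ex_has_greatest_nat[of P "{}" card "Suc (card T)"]) auto
  then obtain S where S: "P S" "\<And>S'. P S' \<Longrightarrow> card S' \<le> card S"
    by blast
  define K where "K = opr.span S"
  have K: "K \<subseteq> L" "opr.subspace K" "0 \<in> K"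
    using S(1) span_L opr.span_zero by (auto simp: K_def P_def)
  have K_bracket: "lie_bracket D E \<in> K" if "D \<in> K" "E \<in> K" for D E
    using S(1) that unfolding P_def K_def by blast
  obtain d where d: "flag K V d = V"
    using S(1) unfolding P_def K_def by blast
  have "K = L"
  proof (rule ccontr)
    assume "K \<noteq> L"
    then obtain x where x: "x \<in> L" "x \<notin> K" "\<And>k. k \<in> K \<Longrightarrow> lie_bracket k x \<in> K"
      using normalising_element[OF K(1) _ K(3) d] by metis
    define S' where "S' = insert x S"
    have S': "S' \<subseteq> L" "finite S'" "opr.independent S'" "card S' = Suc (card S)"
    proof -
      have S: "S \<subseteq> L" "finite S" "opr.independent S" "x \<notin> opr.span S"
        using S(1) x(2) unfolding P_def K_def by blast+
      then have "x \<notin> S"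
        using opr.span_base by blast
      then show "S' \<subseteq> L" "finite S'" "opr.independent S'" "card S' = Suc (card S)"
        using S x(1) opr.independent_insertI by (auto simp: S'_def)
    qed
    have K': "\<exists>k\<in>K. \<exists>c. D = k + scale c x" if D: "D \<in> opr.span S'" for D
    proof -
      obtain c where "D - scale c x \<in> K"
        using D by (auto simp: S'_def opr.span_insert K_def)
      then show ?thesis
        by (intro bexI[of _ "D - scale c x"] exI[of _ c]) auto
    qed
    have K_sub: "K \<subseteq> opr.span S'"
      unfolding K_def S'_def by (rule opr.span_mono) auto
    have "x \<in> opr.span S'"
      unfolding S'_def by (rule opr.span_base) simp
    have "lie_bracket D E \<in> opr.span S'" if DE: "D \<in> opr.span S'" "E \<in> opr.span S'" for D E
    proof -
      obtain k c k' c' where k: "k \<in> K" "D = k + scale c x" "k' \<in> K" "E = k' + scale c' x"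
        using K'[OF DE(1)] K'[OF DE(2)] by blast
      then have kL: "k \<in> L" "k' \<in> L" "D \<in> L" "E \<in> L"
        using K(1) DE S'(1) span_L by blast+
      have "lie_bracket D E = scale c' (lie_bracket D x) + lie_bracket D k'"
        using bracket_linear[OF kL(3) x(1) kL(2), of c'] k(4) by (simp add: add.commute)
      moreover have "lie_bracket D x = lie_bracket k x"
      proof -
        have "lie_bracket x D = scale c (lie_bracket x x) + lie_bracket x k"
          using bracket_linear[OF x(1) x(1) kL(1), of c] k(2) by (simp add: add.commute)
        moreover have "lie_bracket x x = 0"
          by (simp add: lie_bracket_def op_apply fun_eq_iff)
        ultimately show ?thesis
          using bracket_comm[of D x] bracket_comm[of k x] by simp
      qed
      moreover have "lie_bracket D k' \<in> K"
      proof -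
        have "lie_bracket k' D = scale c (lie_bracket k' x) + lie_bracket k' k"
          using bracket_linear[OF kL(2) x(1) kL(1), of c] k(2) by (simp add: add.commute)
        then have "lie_bracket k' D \<in> K"
          using x(3) k K_bracket K(2) by (simp add: opr.subspace_add opr.subspace_scale)
        then show ?thesis
          using bracket_comm[of D k'] K(2) by (simp add: opr.subspace_neg)
      qed
      ultimately have "lie_bracket D E \<in> K"
        using x(3) k(1) K(2) by (simp add: opr.subspace_add opr.subspace_scale)
      then show ?thesis
        using K_sub by blast
    qed
    moreover have "\<exists>d'. flag (opr.span S') V d' = V"
      using extension_nilpotent[OF K(1,2) d x(1,3) K'] by blast
    ultimately have "P S'"
      using S' unfolding P_def by blast
    then show False
      using S(2)[of S'] S'(4) by simp
  qed
  then show ?thesis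
    using d by blast
qed

end

section \<open>Algebraic groups\<close>

lemma sum_fun_apply: "(\<Sum>i\<in>I. f i) x = (\<Sum>i\<in>I. f i x)"
  by (induction I rule: infinite_finite_induct) (auto simp: fun_apply)

lemma const_on_mult:
  assumes "f \<in> functions_on X"
  shows "const_on X c * f = fscale c f"
  using assms by (auto simp: const_on_def functions_on_def fun_eq_iff fun_apply)

lemma fscale_mult:
  "fscale c f * g = fscale c (f * g)" "f * fscale c g = fscale c (f * g)"
  by (auto simp: fun_eq_iff fun_apply)

lemma generated_algebra_functions_on:
  assumes "F \<subseteq> functions_on X" "f \<in> generated_algebra X F"
  shows "f \<in> functions_on X"
  using assms(2)
proof induction
  case (generator f)
  then show ?case
    using assms(1) by blast
qed (auto simp: functions_on_def const_on_def fun_apply)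

lemma generated_algebra_least:
  assumes "F \<subseteq> generated_algebra X E" "f \<in> generated_algebra X F"
  shows "f \<in> generated_algebra X E"
  using assms(2)
proof induction
  case (generator f)
  then show ?case
    using assms(1) by blast
qed (auto intro: generated_algebra.intros)

locale alg_group = group G for G :: "('g, 'm) monoid_scheme" (structure) +
  fixes A :: "('g \<Rightarrow> 'k::alg_closed_field) set"
  assumes algebraic: "algebraic_group G A"
begin

abbreviation unit :: "'g \<Rightarrow> 'k" where
  "unit \<equiv> const_on (carrier G) 1"

lemma generators:
  obtains F where "finite F" "F \<subseteq> functions_on (carrier G)" "A = generated_algebra (carrier G) F"
  using algebraic unfolding algebraic_group_def affine_variety_def by blast

lemma A_functions: "f \<in> A \<Longrightarrow> f \<in> functions_on (carrier G)"
  by (metis generators generated_algebra_functions_on)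

lemma A_outside: "f \<in> A \<Longrightarrow> x \<notin> carrier G \<Longrightarrow> f x = 0"
  using A_functions by (auto simp: functions_on_def)

lemma A_eqI:
  assumes "f \<in> A" "g \<in> A" "\<And>x. x \<in> carrier G \<Longrightarrow> f x = g x"
  shows "f = g"
  using assms A_outside by (metis ext)

lemma A_closed:
  shows "const_on (carrier G) c \<in> A" "f \<in> A \<Longrightarrow> g \<in> A \<Longrightarrow> f + g \<in> A"
    "f \<in> A \<Longrightarrow> g \<in> A \<Longrightarrow> f * g \<in> A"
  using generators by (metis generated_algebra.intros)+

lemma A_scale: "f \<in> A \<Longrightarrow> fscale c f \<in> A"
  using A_closed(1,3) const_on_mult[OF A_functions] by metis

lemma const_on_unit: "const_on (carrier G) c = fscale c unit"
  by (auto simp: const_on_def fun_eq_iff fun_apply)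

lemma A_subspace: "fn.subspace A"
proof (rule fn.subspaceI)
  have "const_on (carrier G) 0 = (0 :: 'g \<Rightarrow> 'k)"
    by (auto simp: const_on_def fun_apply)
  then show "0 \<in> A"
    using A_closed(1) by metis
qed (auto intro: A_closed A_scale)

lemma unit_mult: "f \<in> A \<Longrightarrow> unit * f = f"
  using const_on_mult[OF A_functions, of f 1] by simp

lemma unit_one: "unit \<one> = 1"
  by (simp add: const_on_def)

text \<open>A presentation of the comultiplication of \<open>f\<close> as a finite sum of tensors.
  Such presentations are not unique, hence a relation.\<close>

definition comult :: "('g \<Rightarrow> 'k) \<Rightarrow> nat \<Rightarrow> (nat \<Rightarrow> 'g \<Rightarrow> 'k) \<Rightarrow> (nat \<Rightarrow> 'g \<Rightarrow> 'k) \<Rightarrow> bool" where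
  "comult f n g h \<longleftrightarrow> (\<forall>i<n. g i \<in> A \<and> h i \<in> A) \<and>
     (\<forall>x\<in>carrier G. \<forall>y\<in>carrier G. f (x \<otimes> y) = (\<Sum>i<n. g i x * h i y))"

lemma comultD:
  assumes "comult f n g h"
  shows "i < n \<Longrightarrow> g i \<in> A" "i < n \<Longrightarrow> h i \<in> A"
    "x \<in> carrier G \<Longrightarrow> y \<in> carrier G \<Longrightarrow> f (x \<otimes> y) = (\<Sum>i<n. g i x * h i y)"
  using assms by (auto simp: comult_def)

lemma comult_exists:
  assumes "f \<in> A"
  shows "\<exists>n g h. comult f n g h"
proof -
  have "pullback (carrier G \<times> carrier G) (\<lambda>(x, y). x \<otimes> y) f \<in> product_functions A A"
    using algebraic assms by (auto simp: algebraic_group_def variety_morphism_def)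
  then show ?thesis
    unfolding product_functions_def mem_Collect_eq
  proof (elim exE conjE, intro exI)
    fix n :: nat and g h :: "nat \<Rightarrow> 'g \<Rightarrow> 'k"
    assume *: "pullback (carrier G \<times> carrier G) (\<lambda>(x, y). x \<otimes> y) f = (\<lambda>(x, y). \<Sum>i<n. g i x * h i y)"
      "\<forall>i<n. g i \<in> A \<and> h i \<in> A"
    have "f (x \<otimes> y) = (\<Sum>i<n. g i x * h i y)" if "x \<in> carrier G" "y \<in> carrier G" for x y
      using fun_cong[OF *(1), of "(x, y)"] that by (simp add: pullback_def)
    then show "comult f n g h"
      using *(2) by (simp add: comult_def)
  qed
qed

lemma left_translate_apply: "x \<in> carrier G \<Longrightarrow> left_translate G g f x = f (inv g \<otimes> x)"
  and right_translate_apply: "x \<in> carrier G \<Longrightarrow> right_translate G g f x = f (x \<otimes> g)"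
  by (simp_all add: left_translate_def right_translate_def pullback_def)

lemma translate_outside: "x \<notin> carrier G \<Longrightarrow> left_translate G g f x = 0"
  "x \<notin> carrier G \<Longrightarrow> right_translate G g f x = 0"
  by (simp_all add: left_translate_def right_translate_def pullback_def)

lemma left_translate_A:
  assumes "g \<in> carrier G" "f \<in> A"
  shows "left_translate G g f \<in> A"
proof -
  obtain n a b where "comult f n a b"
    using comult_exists[OF assms(2)] by blast
  note ab = comultD[OF this]
  have "left_translate G g f = (\<Sum>i<n. fscale (a i (inv g)) (b i))"
  proof
    fix x
    show "left_translate G g f x = (\<Sum>i<n. fscale (a i (inv g)) (b i)) x"
    proof (cases "x \<in> carrier G")
      case True
      then show ?thesis
        using assms(1) ab(3)[of "inv g" x] by (simp add: left_translate_apply sum_fun_apply fun_apply)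
    next
      case False
      then show ?thesis
        using A_outside[OF ab(2)] by (simp add: translate_outside sum_fun_apply fun_apply)
    qed
  qed
  also have "\<dots> \<in> A"
    using ab(1,2) by (intro fn.subspace_sum[OF A_subspace] A_scale) auto
  finally show ?thesis .
qed

lemma right_translate_A:
  assumes "g \<in> carrier G" "f \<in> A"
  shows "right_translate G g f \<in> A"
proof -
  obtain n a b where "comult f n a b"
    using comult_exists[OF assms(2)] by blast
  note ab = comultD[OF this]
  have "right_translate G g f = (\<Sum>i<n. fscale (b i g) (a i))"
  proof
    fix x
    show "right_translate G g f x = (\<Sum>i<n. fscale (b i g) (a i)) x"
    proof (cases "x \<in> carrier G")
      case True
      then show ?thesis
        using assms(1) ab(3)[of x g]
        by (simp add: right_translate_apply sum_fun_apply fun_apply mult.commute)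
    next
      case False
      then show ?thesis
        using A_outside[OF ab(1)] by (simp add: translate_outside sum_fun_apply fun_apply)
    qed
  qed
  also have "\<dots> \<in> A"
    using ab(1,2) by (intro fn.subspace_sum[OF A_subspace] A_scale) auto
  finally show ?thesis .
qed

subsection \<open>Left invariant operators\<close>

definition left_invariant :: "('g, 'k) operator \<Rightarrow> bool" where
  "left_invariant T \<longleftrightarrow> fn.endo_on A T \<and>
     (\<forall>g\<in>carrier G. \<forall>f\<in>A. T (left_translate G g f) = left_translate G g (T f))"

lemma left_invariantD:
  assumes "left_invariant T"
  shows "fn.endo_on A T" "f \<in> A \<Longrightarrow> T f \<in> A"
    "g \<in> carrier G \<Longrightarrow> f \<in> A \<Longrightarrow> T (left_translate G g f) = left_translate G g (T f)"
  using assms by (auto simp: left_invariant_def fn.endo_on_def)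

lemma left_invariant_apply:
  assumes "left_invariant T" "f \<in> A" "x \<in> carrier G"
  shows "T f x = T (left_translate G (inv x) f) \<one>"
  using assms by (simp add: left_invariantD(3) left_translate_apply)

text \<open>The left translates of \<open>f\<close> are combinations of the fixed functions
  \<open>h i\<close>, so a left invariant operator is known on \<open>f\<close> from the values of
  the \<open>T (h i)\<close> at the identity. In particular all such operators send \<open>f\<close>
  into the span of the \<open>g i\<close>; this is the source of all finiteness below.\<close>

lemma left_invariant_formula:
  assumes T: "left_invariant T" and f: "f \<in> A"
    and comult: "comult f n g h"
  shows "T f = (\<Sum>i<n. fscale (T (h i) \<one>) (g i))"
proof (rule A_eqI)
  note gh = comultD[OF comult]
  show "T f \<in> A"
    using T f by (rule left_invariantD(2))
  show "(\<Sum>i<n. fscale (T (h i) \<one>) (g i)) \<in> A"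
    using gh(1) by (intro fn.subspace_sum[OF A_subspace] A_scale) auto
  fix x assume x: "x \<in> carrier G"
  have "left_translate G (inv x) f = (\<Sum>i<n. fscale (g i x) (h i))"
  proof
    fix y
    show "left_translate G (inv x) f y = (\<Sum>i<n. fscale (g i x) (h i)) y"
      using gh(3)[OF x, of y] x A_outside[OF gh(2)]
      by (cases "y \<in> carrier G") (simp_all add: left_translate_apply translate_outside sum_fun_apply fun_apply)
  qed
  then have "T f x = T (\<Sum>i<n. fscale (g i x) (h i)) \<one>"
    using left_invariant_apply[OF T f x] by simp
  also have "T (\<Sum>i<n. fscale (g i x) (h i)) = (\<Sum>i<n. fscale (g i x) (T (h i)))"
    using left_invariantD(1)[OF T] A_subspace gh(2)
    by (subst fn.endo_on_sum[where V = A]) (auto simp: A_scale fn.endo_onD(3))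
  finally show "T f x = (\<Sum>i<n. fscale (T (h i) \<one>) (g i)) x"
    by (simp add: sum_fun_apply fun_apply mult.commute)
qed

lemma left_translate_linear:
  "left_translate G g (f + f') = left_translate G g f + left_translate G g f'"
  "left_translate G g (f - f') = left_translate G g f - left_translate G g f'"
  "left_translate G g (fscale c f) = fscale c (left_translate G g f)"
  "left_translate G g (f * f') = left_translate G g f * left_translate G g f'"
  by (auto simp: left_translate_def pullback_def fun_eq_iff fun_apply)

lemma right_translate_linear:
  "right_translate G g (f + f') = right_translate G g f + right_translate G g f'"
  "right_translate G g (f - f') = right_translate G g f - right_translate G g f'"
  "right_translate G g (fscale c f) = fscale c (right_translate G g f)"
  "right_translate G g (f * f') = right_translate G g f * right_translate G g f'"
  by (auto simp: right_translate_def pullback_def fun_eq_iff fun_apply)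

lemma left_invariant_id: "left_invariant (\<lambda>f. f)"
  by (simp add: left_invariant_def fn.endo_on_def)

lemma left_invariant_comp:
  assumes "left_invariant S" "left_invariant T"
  shows "left_invariant (\<lambda>f. S (T f))"
  using assms by (auto simp: left_invariant_def fn.endo_on_comp) (auto simp: fn.endo_on_def)

lemma left_invariant_right_translate:
  assumes "u \<in> carrier G"
  shows "left_invariant (right_translate G u)"
  unfolding left_invariant_def
proof (intro conjI ballI)
  show "fn.endo_on A (right_translate G u)"
    using assms by (auto simp: fn.endo_on_def right_translate_A right_translate_linear)
  fix g f assume "g \<in> carrier G" "f \<in> A"
  then show "right_translate G u (left_translate G g f) = left_translate G g (right_translate G u f)"
    using assms
    by (auto simp: fun_eq_iff left_translate_def right_translate_def pullback_def m_assoc)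
qed

lemma right_translate_mult:
  assumes "g \<in> carrier G" "h \<in> carrier G" "f \<in> A"
  shows "right_translate G (g \<otimes> h) f = right_translate G g (right_translate G h f)"
  using assms by (auto simp: fun_eq_iff right_translate_def pullback_def m_assoc)

lemma right_translate_one: "f \<in> A \<Longrightarrow> right_translate G \<one> f = f"
  by (intro A_eqI) (auto simp: right_translate_A right_translate_apply)

lemma right_translate_inverse:
  assumes "g \<in> carrier G" "f \<in> A"
  shows "right_translate G g (right_translate G (inv g) f) = f"
    "right_translate G (inv g) (right_translate G g f) = f"
  using right_translate_mult[of g "inv g" f] right_translate_mult[of "inv g" g f] assms
  by (simp_all add: right_translate_one)

lemma right_translate_unit: "u \<in> carrier G \<Longrightarrow> right_translate G u unit = unit"
  by (auto simp: fun_eq_iff right_translate_def pullback_def const_on_def)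

lemma character_point: "character (carrier G) A \<epsilon> \<Longrightarrow> \<exists>!x. x \<in> carrier G \<and> (\<forall>f\<in>A. \<epsilon> f = f x)"
  using algebraic unfolding algebraic_group_def affine_variety_def by blast

lemma right_translate_eqD:
  assumes "u \<in> carrier G" "v \<in> carrier G" "\<And>f. f \<in> A \<Longrightarrow> right_translate G u f = right_translate G v f"
  shows "u = v"
proof -
  have val: "f u = f v" if "f \<in> A" for f
    using fun_cong[OF assms(3)[OF that], of \<one>] assms(1,2) by (simp add: right_translate_apply)
  have char: "character (carrier G) A (\<lambda>f. f u)"
    using assms(1) by (auto simp: character_def const_on_def fun_apply)
  then have "\<exists>!x. x \<in> carrier G \<and> (\<forall>f\<in>A. f u = f x)"
    by (rule character_point)
  then show ?thesis
    using assms(1,2) val by blast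
qed

text \<open>Evaluating \<open>T f\<close> at the identity gives a character of the algebra, hence a
  point \<open>u\<close>; left invariance spreads the equality from the identity to all
  points.\<close>

lemma left_invariant_homomorphism:
  assumes T: "left_invariant T" and mult: "\<And>f g. f \<in> A \<Longrightarrow> g \<in> A \<Longrightarrow> T (f * g) = T f * T g"
    and unit: "T unit = unit"
  obtains u where "u \<in> carrier G" "\<And>f. f \<in> A \<Longrightarrow> T f = right_translate G u f"
proof -
  note endo = fn.endo_onD[OF left_invariantD(1)[OF T]]
  have "character (carrier G) A (\<lambda>f. T f \<one>)"
    unfolding character_def
  proof (intro conjI allI ballI)
    fix c
    have "T (const_on (carrier G) c) = fscale c unit"
      using endo(3)[OF A_closed(1)] unit by (simp add: const_on_unit[of c])
    then show "T (const_on (carrier G) c) \<one> = c"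
      by (simp add: fun_apply unit_one)
  qed (simp_all add: endo mult fun_apply)
  from character_point[OF this]
  obtain u where u: "u \<in> carrier G" "\<forall>f\<in>A. T f \<one> = f u"
    by (elim ex1E conjE)
  have "T f = right_translate G u f" if f: "f \<in> A" for f
  proof (rule A_eqI)
    fix x assume x: "x \<in> carrier G"
    have "T f x = left_translate G (inv x) f u"
      using left_invariant_apply[OF T f x] u(2) left_translate_A[OF inv_closed[OF x] f] by simp
    then show "T f x = right_translate G u f x"
      using x u(1) by (simp add: left_translate_apply right_translate_apply)
  qed (use f u(1) T in \<open>simp_all add: left_invariantD right_translate_A\<close>)
  then show ?thesis
    using u(1) that by blast
qed

subsection \<open>The Lie algebra\<close>

lemma lieI:
  assumes T: "left_invariant T" and leibniz: "\<And>f g. f \<in> A \<Longrightarrow> g \<in> A \<Longrightarrow> T (f * g) = T f * g + f * T g"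
    and out: "\<And>f. f \<notin> A \<Longrightarrow> T f = 0"
  shows "T \<in> lie_algebra G A"
proof -
  note endo = fn.endo_onD[OF left_invariantD(1)[OF T]]
  have unit: "unit \<in> A"
    by (rule A_closed(1))
  have "T unit = T unit + T unit"
    using leibniz[OF unit unit] unit_mult[OF unit] unit_mult[OF endo(1)[OF unit]]
    by (simp add: mult.commute)
  then have "T unit = 0"
    by simp
  then have "T (const_on (carrier G) c) = 0" for c
    using endo(3)[OF unit, of c] by (simp add: const_on_unit[of c])
  then show ?thesis
    using T endo leibniz out by (auto simp: lie_algebra_def derivations_def left_invariantD)
qed

lemma lieD:
  assumes D: "D \<in> lie_algebra G A"
  shows "f \<notin> A \<Longrightarrow> D f = 0" "D (const_on (carrier G) c) = 0"
    "f \<in> A \<Longrightarrow> g \<in> A \<Longrightarrow> D (f * g) = D f * g + f * D g" "left_invariant D"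
proof -
  show *: "f \<notin> A \<Longrightarrow> D f = 0" "D (const_on (carrier G) c) = 0"
    "f \<in> A \<Longrightarrow> g \<in> A \<Longrightarrow> D (f * g) = D f * g + f * D g" for f g c
    using D by (auto simp: lie_algebra_def derivations_def)
  have D_A: "f \<in> A \<Longrightarrow> D f \<in> A" for f
    using D by (auto simp: lie_algebra_def derivations_def)
  have "D (fscale c f) = fscale c (D f)" if f: "f \<in> A" for c f
    using *(3)[OF A_closed(1) f, of c] const_on_mult[OF A_functions, of f c]
      const_on_mult[OF A_functions, of "D f" c] *(2) D_A f by simp
  then show "left_invariant D"
    using D by (auto simp: left_invariant_def fn.endo_on_def lie_algebra_def derivations_def)
qed

lemma lie_endo: "D \<in> lie_algebra G A \<Longrightarrow> fn.endo_on A D"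
  using lieD(4) left_invariantD(1) by blast

lemma lie_A: "D \<in> lie_algebra G A \<Longrightarrow> D f \<in> A"
  using lie_endo lieD(1) fn.subspace_0[OF A_subspace] by (metis fn.endo_onD(1))

lemma lie_subspace: "opr.subspace (lie_algebra G A)"
proof (rule opr.subspaceI)
  have 0: "left_translate G g 0 = 0" for g
    by (auto simp: left_translate_def pullback_def fun_eq_iff fun_apply)
  show "0 \<in> lie_algebra G A"
    using A_subspace by (intro lieI) (auto simp: op_apply left_invariant_def fn.endo_on_def fn.subspace_0 0)
next
  fix D E assume D: "D \<in> lie_algebra G A" and E: "E \<in> lie_algebra G A"
  show "D + E \<in> lie_algebra G A"
  proof (rule lieI)
    show "left_invariant (D + E)"
      using left_invariantD[OF lieD(4)[OF D]] left_invariantD[OF lieD(4)[OF E]] A_subspace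
      by (auto simp: left_invariant_def fn.endo_on_def op_apply left_translate_linear A_closed
          fn.scale_right_distrib)
  qed (auto simp: op_apply lieD[OF D] lieD[OF E] algebra_simps)
next
  fix c D assume D: "D \<in> lie_algebra G A"
  show "scale c D \<in> lie_algebra G A"
  proof (rule lieI)
    show "left_invariant (scale c D)"
      using left_invariantD[OF lieD(4)[OF D]] A_subspace
      by (auto simp: left_invariant_def fn.endo_on_def op_apply left_translate_linear A_scale
          fn.scale_right_distrib mult.commute)
  qed (auto simp: op_apply lieD[OF D] fscale_mult fn.scale_right_distrib)
qed

lemma lie_bracket_closed:
  assumes D: "D \<in> lie_algebra G A" and E: "E \<in> lie_algebra G A"
  shows "lie_bracket D E \<in> lie_algebra G A"
proof (rule lieI)
  note D' = left_invariantD[OF lieD(4)[OF D]] fn.endo_onD[OF lie_endo[OF D]] lie_A[OF D]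
  note E' = left_invariantD[OF lieD(4)[OF E]] fn.endo_onD[OF lie_endo[OF E]] lie_A[OF E]
  show "left_invariant (lie_bracket D E)"
    using D' E' A_subspace
    by (auto simp: left_invariant_def fn.endo_on_def lie_bracket_def left_translate_linear
        fn.subspace_diff fn.scale_right_diff_distrib left_translate_A)
  show "lie_bracket D E (f * g) = lie_bracket D E f * g + f * lie_bracket D E g"
    if "f \<in> A" "g \<in> A" for f g
    using that D' E' by (simp add: lie_bracket_def lieD[OF D] lieD[OF E] A_closed algebra_simps)
  have "D 0 = 0" "E 0 = 0"
    using fn.endo_on_zero[OF lie_endo A_subspace] D E by auto
  then show "lie_bracket D E f = 0" if "f \<notin> A" for f
    using that by (simp add: lie_bracket_def lieD[OF D] lieD[OF E])
qed

lemma lie_eq_0: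
  assumes D: "D \<in> lie_algebra G A" and A: "A = generated_algebra (carrier G) F"
    and zero: "\<And>f. f \<in> F \<Longrightarrow> D f = 0"
  shows "D = 0"
proof
  fix f
  have "D f = 0" if "f \<in> generated_algebra (carrier G) F" for f
    using that
  proof induction
    case (add f g)
    then show ?case
      using fn.endo_onD(2)[OF lie_endo[OF D]] A by simp
  next
    case (mult f g)
    then show ?case
      using lieD(3)[OF D] A by simp
  qed (auto simp: zero lieD(2)[OF D])
  then show "D f = 0 f"
    using lieD(1)[OF D] A by (cases "f \<in> A") (auto simp: op_apply)
qed

text \<open>By the comultiplication formula and the Leibniz rule, an element is determined by its
  values at the identity on the finitely many second factors \<open>h f i\<close> belonging to the
  generators.\<close>

lemma lie_finite_dimensional: "\<exists>T. finite T \<and> lie_algebra G A \<subseteq> opr.span T"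
proof -
  obtain F where F: "finite F" "F \<subseteq> functions_on (carrier G)" "A = generated_algebra (carrier G) F"
    by (rule generators)
  have FA: "f \<in> F \<Longrightarrow> f \<in> A" for f
    using F(3) by (simp add: generated_algebra.generator)
  then have "\<forall>f\<in>F. \<exists>n g h. comult f n g h"
    using comult_exists by blast
  then obtain n g h where gh: "\<And>f. f \<in> F \<Longrightarrow> comult f (n f) (g f) (h f)"
    by metis
  define I where "I = Sigma F (\<lambda>f. {..<n f})"
  have "finite I"
    using F(1) by (simp add: I_def)
  have bound: "card S \<le> card I" if S: "S \<subseteq> lie_algebra G A" "finite S" "opr.independent S" for S
  proof (rule ccontr)
    assume "\<not> card S \<le> card I"
    then have "card I < card S"
      by simp
    from homogeneous_system[OF \<open>finite I\<close> S(2) this, of "\<lambda>p D. D (h (fst p) (snd p)) \<one>"]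
    obtain c where c: "(\<exists>D\<in>S. c D \<noteq> 0) \<and>
        (\<forall>p\<in>I. (\<Sum>D\<in>S. D (h (fst p) (snd p)) \<one> * c D) = 0)"
      by (rule exE)
    define E where "E = (\<Sum>D\<in>S. scale (c D) D)"
    have E: "E \<in> lie_algebra G A"
      unfolding E_def using S(1) lie_subspace by (intro opr.subspace_sum opr.subspace_scale) auto
    have E_apply: "E f x = (\<Sum>D\<in>S. c D * D f x)" for f x
      by (simp add: E_def sum_fun_apply op_apply fscale_apply)
    have "E f = 0" if f: "f \<in> F" for f
    proof -
      have "E (h f i) \<one> = 0" if "i < n f" for i
        using bspec[OF conjunct2[OF c], of "(f, i)"] that f by (simp add: E_apply I_def mult.commute)
      then show ?thesis
        using left_invariant_formula[OF lieD(4)[OF E] FA[OF f] gh[OF f]] by simp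
    qed
    then have "E = 0"
      using lie_eq_0[OF E F(3)] by blast
    then show False
      using conjunct1[OF c] opr.independentD[OF S(3,2) subset_refl, of c] by (auto simp: E_def)
  qed
  obtain B where B: "B \<subseteq> lie_algebra G A" "opr.independent B" "lie_algebra G A \<subseteq> opr.span B"
    using opr.maximal_independent_subset by metis
  have "finite B"
  proof (rule ccontr)
    assume "infinite B"
    then obtain S where S: "S \<subseteq> B" "finite S" "card S = Suc (card I)"
      using infinite_arbitrarily_large by metis
    then have "opr.independent S"
      using B(2) opr.independent_mono by blast
    then show False
      using bound[of S] S B(1) by auto
  qed
  then show ?thesis
    using B(3) by blast
qed

end

section \<open>The trace form\<close>

interpretation fn: alg_closed_vector_space fscale ..

text \<open>Each of the three terms lowers the total nilpotency order \<open>n + m\<close>. The case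
  \<open>c = 0\<close> serves derivations, \<open>c = 1\<close> serves \<open>R - 1\<close> with
  \<open>R\<close> multiplicative; distinct \<open>\<delta>1\<close> and \<open>\<delta>2\<close>
  allow shifts by different eigenvalues.\<close>

lemma nilpotent_product:
  assumes \<delta>: "fn.endo_on A \<delta>" and A: "fn.subspace A" "\<And>f g. f \<in> A \<Longrightarrow> g \<in> A \<Longrightarrow> f * g \<in> A"
    and \<delta>12: "\<And>f. f \<in> A \<Longrightarrow> \<delta>1 f \<in> A" "\<And>f. f \<in> A \<Longrightarrow> \<delta>2 f \<in> A"
    and product: "\<And>f g. f \<in> A \<Longrightarrow> g \<in> A \<Longrightarrow> \<delta> (f * g) = fscale c (\<delta>1 f * \<delta>2 g) + \<delta>1 f * g + f * \<delta>2 g"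
    and "f \<in> A" "g \<in> A" "(\<delta>1 ^^ n) f = 0" "(\<delta>2 ^^ m) g = 0" "n + m \<le> N"
  shows "(\<delta> ^^ N) (f * g) = 0"
  using assms(7-)
proof (induction N arbitrary: f g n m)
  case 0
  then show ?case
    by simp
next
  case (Suc N)
  have pow: "fn.endo_on A (\<delta> ^^ k)" for k
    by (rule fn.endo_on_funpow[OF \<delta>])
  show ?case
  proof (cases "n = 0 \<or> m = 0")
    case True
    then have "f * g = 0"
      using Suc.prems(3,4) by auto
    then show ?thesis
      using fn.endo_on_zero[OF pow A(1), of "Suc N"] by metis
  next
    case False
    then obtain n' m' where nm: "n = Suc n'" "m = Suc m'"
      using not0_implies_Suc by blast
    have f1: "(\<delta>1 ^^ n') (\<delta>1 f) = 0" "\<delta>1 f \<in> A" and g1: "(\<delta>2 ^^ m') (\<delta>2 g) = 0" "\<delta>2 g \<in> A"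
      using Suc.prems nm \<delta>12 by (simp_all add: funpow_Suc_right del: funpow.simps)
    have 1: "(\<delta> ^^ N) (\<delta>1 f * \<delta>2 g) = 0"
      using Suc.IH[OF f1(2) g1(2) f1(1) g1(1)] Suc.prems(5) nm by simp
    have 2: "(\<delta> ^^ N) (\<delta>1 f * g) = 0"
      using Suc.IH[OF f1(2) Suc.prems(2) f1(1) Suc.prems(4)] Suc.prems(5) nm by simp
    have 3: "(\<delta> ^^ N) (f * \<delta>2 g) = 0"
      using Suc.IH[OF Suc.prems(1) g1(2) Suc.prems(3) g1(1)] Suc.prems(5) nm by simp
    have "(\<delta> ^^ Suc N) (f * g) = (\<delta> ^^ N) (fscale c (\<delta>1 f * \<delta>2 g) + \<delta>1 f * g + f * \<delta>2 g)"
      using product[OF Suc.prems(1,2)] by (simp add: funpow_Suc_right del: funpow.simps)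
    also have "\<dots> = fscale c ((\<delta> ^^ N) (\<delta>1 f * \<delta>2 g)) + (\<delta> ^^ N) (\<delta>1 f * g) + (\<delta> ^^ N) (f * \<delta>2 g)"
      using f1(2) g1(2) Suc.prems(1,2) A
      by (simp add: fn.endo_onD(2,3)[OF pow] fn.subspace_add fn.subspace_scale)
    finally show ?thesis
      by (simp add: 1 2 3)
  qed
qed

section \<open>Finite-dimensional modules of regular functions\<close>

context alg_group
begin

text \<open>Stability under all left invariant operators gives a module for the Lie algebra and for
  right translations at the same time, and lets an involution act as soon as it preserves
  \<open>F\<close>.\<close>

definition module_of :: "('g \<Rightarrow> 'k) set \<Rightarrow> ('g \<Rightarrow> 'k) set" where
  "module_of F = fn.span {T f | T f. left_invariant T \<and> f \<in> F}"

lemma module_subspace: "fn.subspace (module_of F)"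
  by (simp add: module_of_def)

lemma module_superset: "F \<subseteq> module_of F"
proof
  fix f assume "f \<in> F"
  then have "f \<in> {T f | T f. left_invariant T \<and> f \<in> F}"
    using left_invariant_id by fastforce
  then show "f \<in> module_of F"
    unfolding module_of_def by (rule fn.span_base)
qed

lemma module_subset:
  assumes "F \<subseteq> A"
  shows "module_of F \<subseteq> A"
  unfolding module_of_def
  using assms left_invariantD(2) by (intro fn.span_minimal[OF _ A_subspace]) auto

lemma module_endo:
  assumes F: "F \<subseteq> A" and T: "left_invariant T"
  shows "fn.endo_on (module_of F) T"
proof -
  note T' = fn.endo_onD[OF left_invariantD(1)[OF T]]
  have "f \<in> A \<and> T f \<in> module_of F" if "f \<in> module_of F" for f
    using that unfolding module_of_def
  proof (induction f rule: fn.span_induct_alt)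
    case base
    then show ?case
      using fn.endo_on_zero[OF left_invariantD(1)[OF T] A_subspace] fn.subspace_0[OF A_subspace] fn.span_zero
      by simp
  next
    case (step c x y)
    from step.hyps obtain S f where x: "x = S f" "left_invariant S" "f \<in> F"
      by blast
    have xA: "x \<in> A"
      using x F left_invariantD(2) by blast
    have "T x \<in> {T f | T f. left_invariant T \<and> f \<in> F}"
      using left_invariant_comp[OF T x(2)] x by fastforce
    then have "T x \<in> fn.span {T f | T f. left_invariant T \<and> f \<in> F}"
      by (rule fn.span_base)
    moreover have "T (fscale c x + y) = fscale c (T x) + T y"
      using step.IH xA by (simp add: T' A_scale)
    ultimately show ?case
      using step.IH xA by (simp add: fn.span_add fn.span_scale A_scale A_closed)
  qed
  then show ?thesis
    using T' unfolding fn.endo_on_def by blast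
qed

lemma module_finite_dimensional:
  assumes F: "finite F" "F \<subseteq> A"
  shows "\<exists>S. finite S \<and> module_of F \<subseteq> fn.span S"
proof -
  have "\<forall>f\<in>F. \<exists>n g h. comult f n g h"
    using comult_exists F by blast
  then obtain n g h where gh: "\<And>f. f \<in> F \<Longrightarrow> comult f (n f) (g f) (h f)"
    by metis
  define S where "S = (\<Union>f\<in>F. g f ` {..<n f})"
  have "finite S"
    using F by (simp add: S_def)
  have "T f \<in> fn.span S" if T: "left_invariant T" and f: "f \<in> F" for T f
  proof -
    have "g f i \<in> S" if "i < n f" for i
      using f that by (auto simp: S_def)
    moreover have "T f = (\<Sum>i<n f. fscale (T (h f i) \<one>) (g f i))"
      using left_invariant_formula[OF T _ gh[OF f]] f F by blast
    ultimately show ?thesis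
      by (auto intro!: fn.span_sum fn.span_scale intro: fn.span_base)
  qed
  then have "module_of F \<subseteq> fn.span S"
    unfolding module_of_def by (intro fn.span_minimal) auto
  then show ?thesis
    using \<open>finite S\<close> by blast
qed

lemma module_in_geigen_sum:
  assumes "finite F" "F \<subseteq> A" "left_invariant D"
  shows "module_of F \<subseteq> fn.span (\<Union>\<mu>. fn.geigen D (module_of F) \<mu>)"
proof -
  obtain S where S: "finite S" "module_of F \<subseteq> fn.span S"
    using module_finite_dimensional[OF assms(1,2)] by blast
  show ?thesis
    by (rule fn.subset_geigen_sum[OF module_endo[OF assms(2,3)] module_subspace S(2,1)])
qed

lemma geigen_mono: "V \<subseteq> W \<Longrightarrow> fn.geigen D V \<mu> \<subseteq> fn.geigen D W \<mu>"
  by (auto simp: fn.geigen_def)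

text \<open>The whole algebra may be infinite-dimensional, but each function lies in a
  finite-dimensional stable module, where the decomposition is available.\<close>

lemma A_in_geigen_sum:
  assumes "left_invariant D"
  shows "A \<subseteq> fn.span (\<Union>\<mu>. fn.geigen D A \<mu>)"
proof
  fix f assume f: "f \<in> A"
  then have "f \<in> fn.span (\<Union>\<mu>. fn.geigen D (module_of {f}) \<mu>)"
    using module_in_geigen_sum[of "{f}" D] module_superset[of "{f}"] assms by blast
  moreover have "(\<Union>\<mu>. fn.geigen D (module_of {f}) \<mu>) \<subseteq> (\<Union>\<mu>. fn.geigen D A \<mu>)"
    using geigen_mono[of "module_of {f}" A D] module_subset[of "{f}"] f by blast
  ultimately show "f \<in> fn.span (\<Union>\<mu>. fn.geigen D A \<mu>)"
    using fn.span_mono by blast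
qed

lemma A_geigen_induct [consumes 2, case_names zero step]:
  assumes D: "left_invariant D" and f: "f \<in> A" and "P 0"
    and step: "\<And>c \<mu> x y. x \<in> fn.geigen D A \<mu> \<Longrightarrow> y \<in> A \<Longrightarrow> P y \<Longrightarrow> P (fscale c x + y)"
  shows "P f"
proof -
  have "f \<in> fn.span (\<Union>\<mu>. fn.geigen D A \<mu>)"
    using A_in_geigen_sum[OF D] f by blast
  then have "f \<in> A \<and> P f"
  proof (induction f rule: fn.span_induct_alt)
    case base
    then show ?case
      using \<open>P 0\<close> fn.subspace_0[OF A_subspace] by blast
  next
    case (step c x y)
    from step.hyps obtain \<mu> where x: "x \<in> fn.geigen D A \<mu>"
      by blast
    then have "x \<in> A"
      by (simp add: fn.geigen_def)
    then show ?case
      using assms(4)[OF x] step.IH A_closed(2) A_scale by blast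
  qed
  then show ?thesis
    by blast
qed

lemma shift_endo:
  "left_invariant D \<Longrightarrow> fn.endo_on A (\<lambda>f. D f - fscale \<mu> f)"
  using fn.endo_on_sub_scale[OF left_invariantD(1) A_subspace] .

lemma geigen_left_translate:
  assumes D: "left_invariant D" and g: "g \<in> carrier G" and f: "f \<in> fn.geigen D A \<mu>"
  shows "left_translate G g f \<in> fn.geigen D A \<mu>"
proof -
  obtain n where n: "f \<in> A" "((\<lambda>f. D f - fscale \<mu> f) ^^ n) f = 0"
    using f by (auto simp: fn.geigen_def)
  have "((\<lambda>f. D f - fscale \<mu> f) ^^ k) (left_translate G g f) =
      left_translate G g (((\<lambda>f. D f - fscale \<mu> f) ^^ k) f)" for k
  proof (induction k)
    case (Suc k)
    have "((\<lambda>f. D f - fscale \<mu> f) ^^ k) f \<in> A"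
      using fn.endo_onD(1)[OF fn.endo_on_funpow[OF shift_endo[OF D]] n(1)] .
    then show ?case
      using Suc left_invariantD(3)[OF D g] by (simp add: left_translate_linear)
  qed simp
  moreover have "left_translate G g 0 = 0"
    by (auto simp: left_translate_def pullback_def fun_eq_iff fun_apply)
  ultimately have "((\<lambda>f. D f - fscale \<mu> f) ^^ n) (left_translate G g f) = 0"
    using n(2) by metis
  then show ?thesis
    using left_translate_A[OF g n(1)] unfolding fn.geigen_def by blast
qed

text \<open>By the Leibniz rule \<open>D - (\<mu> + \<nu>)\<close> acts on products through
  \<open>D - \<mu>\<close> on the first and \<open>D - \<nu>\<close> on the second factor.\<close>

lemma geigen_mult:
  assumes D: "D \<in> lie_algebra G A" and f: "f \<in> fn.geigen D A \<mu>" and g: "g \<in> fn.geigen D A \<nu>"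
  shows "f * g \<in> fn.geigen D A (\<mu> + \<nu>)"
proof -
  obtain n where n: "f \<in> A" "((\<lambda>f. D f - fscale \<mu> f) ^^ n) f = 0"
    using f by (auto simp: fn.geigen_def)
  obtain m where m: "g \<in> A" "((\<lambda>f. D f - fscale \<nu> f) ^^ m) g = 0"
    using g by (auto simp: fn.geigen_def)
  have "((\<lambda>f. D f - fscale (\<mu> + \<nu>) f) ^^ (n + m)) (f * g) = 0"
  proof (rule nilpotent_product[OF shift_endo[OF lieD(4)[OF D]] A_subspace A_closed(3)
        fn.endo_onD(1)[OF shift_endo[OF lieD(4)[OF D]]]
        fn.endo_onD(1)[OF shift_endo[OF lieD(4)[OF D]]] _ n(1) m(1) n(2) m(2)])
    show "D (f * g) - fscale (\<mu> + \<nu>) (f * g) = fscale 0 ((D f - fscale \<mu> f) * (D g - fscale \<nu> g)) +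
        (D f - fscale \<mu> f) * g + f * (D g - fscale \<nu> g)" if "f \<in> A" "g \<in> A" for f g
      using lieD(3)[OF D that] by (simp add: fscale_mult algebra_simps)
  qed auto
  then show ?thesis
    using A_closed(3)[OF n(1) m(1)] unfolding fn.geigen_def by blast
qed

text \<open>
  A derivation grades the algebra of regular functions by its generalised eigenvalues, and an
  additive function of the degree is again a derivation.
\<close>

lemma lie_replica:
  assumes D: "D \<in> lie_algebra G A" and \<phi>: "\<And>a b. \<phi> (a + b) = \<phi> a + \<phi> b"
  obtains E where "E \<in> lie_algebra G A" "\<And>\<mu> f. f \<in> fn.geigen D A \<mu> \<Longrightarrow> E f = fscale (\<phi> \<mu>) f"
proof -
  note DL = lieD(4)[OF D]
  obtain E0 where E0: "fn.endo_on A E0" "\<And>\<mu> f. f \<in> fn.geigen D A \<mu> \<Longrightarrow> E0 f = fscale (\<phi> \<mu>) f"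
    using fn.geigen_scaling_exists[OF lie_endo[OF D] A_subspace A_in_geigen_sum[OF DL], of \<phi>] by metis
  define E where "E f = (if f \<in> A then E0 f else 0)" for f
  have E_endo: "fn.endo_on A E"
    using E0(1) by (auto simp: fn.endo_on_def E_def A_closed A_scale)
  note E' = fn.endo_onD[OF E_endo]
  have E_geigen: "E f = fscale (\<phi> \<mu>) f" and geigen_A: "f \<in> A" if "f \<in> fn.geigen D A \<mu>" for f \<mu>
    using E0(2)[OF that] that by (simp_all add: E_def fn.geigen_def)
  have E_0: "E 0 = 0"
    by (rule fn.endo_on_zero[OF E_endo A_subspace])
  have lt_0: "left_translate G g 0 = 0" for g
    by (auto simp: left_translate_def pullback_def fun_eq_iff fun_apply)
  have "E (left_translate G g f) = left_translate G g (E f)" if g: "g \<in> carrier G" and f: "f \<in> A" for g f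
    using DL f
  proof (induction f rule: A_geigen_induct)
    case zero
    then show ?case
      by (simp add: lt_0 E_0)
  next
    case (step c \<mu> x y)
    note x = step.hyps(1)
    have *: "E (left_translate G g x) = left_translate G g (E x)"
      using E_geigen[OF x] E_geigen[OF geigen_left_translate[OF DL g x]] by (simp add: left_translate_linear)
    show ?case
      using step.IH step.hyps(2) geigen_A[OF x] left_translate_A[OF g]
      by (simp add: left_translate_linear E' A_scale *)
  qed
  then have "left_invariant E"
    using E_endo by (simp add: left_invariant_def)
  \<comment> \<open>Both factors are reduced to generalised eigenvectors by linearity, the second
    inside the first; on eigenvectors the Leibniz rule is the additivity of \<phi>.\<close>
  moreover have "E (f * g) = E f * g + f * E g" if f: "f \<in> A" and g: "g \<in> A" for f g
    using DL f
  proof (induction f rule: A_geigen_induct)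
    case zero
    then show ?case
      by (simp add: E_0)
  next
    case (step c \<mu> x y)
    note x = step.hyps(1)
    have *: "E (x * g) = E x * g + x * E g"
      using DL g
    proof (induction g rule: A_geigen_induct)
      case zero
      then show ?case
        by (simp add: E_0)
    next
      case (step b \<nu> x' y')
      note x' = step.hyps(1)
      have **: "E (x * x') = E x * x' + x * E x'"
        using E_geigen[OF geigen_mult[OF D x x']] E_geigen[OF x] E_geigen[OF x']
        by (simp add: \<phi> fscale_mult fn.scale_left_distrib)
      have "E (x * (fscale b x' + y')) = fscale b (E (x * x')) + E (x * y')"
        using geigen_A[OF x] geigen_A[OF x'] step.hyps(2)
        by (simp add: distrib_left fscale_mult E' A_scale A_closed)
      moreover have "E (fscale b x' + y') = fscale b (E x') + E y'"
        using geigen_A[OF x'] step.hyps(2) by (simp add: E' A_scale)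
      ultimately show ?case
        by (simp only: ** step.IH) (simp add: fscale_mult fn.scale_right_distrib algebra_simps)
    qed
    have "E ((fscale c x + y) * g) = fscale c (E (x * g)) + E (y * g)"
      using geigen_A[OF x] g step.hyps(2)
      by (simp add: distrib_right fscale_mult E' A_scale A_closed)
    moreover have "E (fscale c x + y) = fscale c (E x) + E y"
      using geigen_A[OF x] step.hyps(2) by (simp add: E' A_scale)
    ultimately show ?case
      by (simp only: * step.IH) (simp add: fscale_mult fn.scale_right_distrib algebra_simps)
  qed
  moreover have "E f = 0" if "f \<notin> A" for f
    using that by (simp add: E_def)
  ultimately have "E \<in> lie_algebra G A"
    by (rule lieI)
  then show ?thesis
    using E_geigen by (rule that)
qed

end

text \<open>The field is a vector space over the rationals, and a nonzero element extends to a
  basis. Rational values are what later makes squares nonnegative.\<close>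

lemma rational_linear_functional:
  fixes a :: "'k::field_char_0"
  assumes "a \<noteq> 0"
  obtains \<psi> :: "'k \<Rightarrow> rat" where "\<And>x y. \<psi> (x + y) = \<psi> x + \<psi> y" "\<And>q x. \<psi> (of_rat q * x) = q * \<psi> x" "\<psi> a = 1"
proof -
  interpret p: vector_space_pair "\<lambda>q (x::'k). of_rat q * x" "(*) :: rat \<Rightarrow> rat \<Rightarrow> rat"
    by unfold_locales (auto simp: algebra_simps of_rat_add of_rat_mult)
  have "p.vs1.independent {a}"
    using assms by (simp add: p.vs1.dependent_single)
  from p.linear_independent_extend[OF this, of "\<lambda>_. 1"]
  obtain \<psi> where \<psi>: "Vector_Spaces.linear (\<lambda>q (x::'k). of_rat q * x) (*) \<psi>" "\<psi> a = 1"
    by auto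
  then show ?thesis
    by (intro that[of \<psi>]) (auto simp: Vector_Spaces.linear_iff)
qed

section \<open>The trace form and its radical\<close>

locale generated_alg_group = alg_group G A
  for G :: "('g, 'm) monoid_scheme" (structure) and A :: "('g \<Rightarrow> 'k::{alg_closed_field, field_char_0}) set" +
  fixes F :: "('g \<Rightarrow> 'k) set"
  assumes F: "finite F" "F \<subseteq> functions_on (carrier G)" "A = generated_algebra (carrier G) F"
begin

abbreviation V :: "('g \<Rightarrow> 'k) set" where
  "V \<equiv> module_of F"

abbreviation lie :: "('g, 'k) operator set" where
  "lie \<equiv> lie_algebra G A"

definition basis :: "('g \<Rightarrow> 'k) set" where
  "basis = (SOME B. finite B \<and> fn.independent B \<and> fn.span B = V)"

definition form :: "('g, 'k) operator \<Rightarrow> ('g, 'k) operator \<Rightarrow> 'k" where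
  "form D E = fn.trace basis (\<lambda>f. D (E f))"

definition radical :: "('g, 'k) operator set" where
  "radical = {D \<in> lie. \<forall>E\<in>lie. form D E = 0}"

lemma F_A: "F \<subseteq> A"
  using F(3) by (auto intro: generated_algebra.generator)

lemma V_A: "V \<subseteq> A"
  by (rule module_subset[OF F_A])

lemma basis: "finite basis" "fn.independent basis" "fn.span basis = V"
proof -
  obtain S where S: "finite S" "V \<subseteq> fn.span S"
    using module_finite_dimensional[OF F(1) F_A] by blast
  have "\<exists>B. finite B \<and> fn.independent B \<and> fn.span B = V"
    by (rule fn.finite_basis[OF module_subspace S(2,1)]) blast
  from someI_ex[OF this] show "finite basis" "fn.independent basis" "fn.span basis = V"
    unfolding basis_def by blast+
qed

lemma V_endo: "left_invariant T \<Longrightarrow> fn.endo_on V T"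
  by (rule module_endo[OF F_A])

lemma lie_V_endo: "D \<in> lie \<Longrightarrow> fn.endo_on V D"
  by (rule V_endo[OF lieD(4)])

lemma trace_V_comm: "fn.endo_on V S \<Longrightarrow> fn.endo_on V T \<Longrightarrow>
    fn.trace basis (\<lambda>f. S (T f)) = fn.trace basis (\<lambda>f. T (S f))"
  by (rule fn.trace_comm[OF basis(1,2)]) (simp_all add: basis(3))

lemma trace_V_cong: "(\<And>f. f \<in> V \<Longrightarrow> S f = T f) \<Longrightarrow> fn.trace basis S = fn.trace basis T"
  by (rule fn.trace_cong) (metis basis(3) fn.span_base)

lemma trace_V_diff: "fn.endo_on V S \<Longrightarrow> fn.endo_on V T \<Longrightarrow>
    fn.trace basis (\<lambda>f. S f - T f) = fn.trace basis S - fn.trace basis T"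
  by (rule fn.trace_diff[OF basis(1,2)]) (simp_all add: basis(3))

lemma trace_V_add: "fn.endo_on V S \<Longrightarrow> fn.endo_on V T \<Longrightarrow>
    fn.trace basis (\<lambda>f. S f + T f) = fn.trace basis S + fn.trace basis T"
  by (rule fn.trace_add[OF basis(1,2)]) (simp_all add: basis(3))

lemma trace_V_scale: "fn.endo_on V S \<Longrightarrow>
    fn.trace basis (\<lambda>f. fscale c (S f)) = c * fn.trace basis S"
  by (rule fn.trace_scale[OF basis(1,2)]) (simp_all add: basis(3))

lemma form_comm: "D \<in> lie \<Longrightarrow> E \<in> lie \<Longrightarrow> form D E = form E D"
  unfolding form_def by (rule trace_V_comm[OF lie_V_endo lie_V_endo])

lemma form_add: "D \<in> lie \<Longrightarrow> D' \<in> lie \<Longrightarrow> E \<in> lie \<Longrightarrow> form (D + D') E = form D E + form D' E"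
  unfolding form_def op_apply
  by (rule trace_V_add[OF fn.endo_on_comp[OF lie_V_endo lie_V_endo] fn.endo_on_comp[OF lie_V_endo lie_V_endo]])

lemma form_scale: "D \<in> lie \<Longrightarrow> E \<in> lie \<Longrightarrow> form (scale c D) E = c * form D E"
  unfolding form_def op_apply by (rule trace_V_scale[OF fn.endo_on_comp[OF lie_V_endo lie_V_endo]])

text \<open>Both sides contain the trace of \<open>D E H\<close>; the products \<open>E D H\<close>
  and \<open>D H E\<close> subtracted from it are cyclic permutations of each other.\<close>

lemma form_invariant:
  assumes "D \<in> lie" "E \<in> lie" "H \<in> lie"
  shows "form (lie_bracket D E) H = form D (lie_bracket E H)"
proof -
  note e = lie_V_endo[OF assms(1)] lie_V_endo[OF assms(2)] lie_V_endo[OF assms(3)]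
  note c = fn.endo_on_comp[OF e(1) fn.endo_on_comp[OF e(2,3)]]
    fn.endo_on_comp[OF e(2) fn.endo_on_comp[OF e(1,3)]]
    fn.endo_on_comp[OF e(1) fn.endo_on_comp[OF e(3,2)]]
  have "form (lie_bracket D E) H = fn.trace basis (\<lambda>f. D (E (H f)) - E (D (H f)))"
    by (simp add: form_def lie_bracket_def)
  also have "\<dots> = fn.trace basis (\<lambda>f. D (E (H f))) - fn.trace basis (\<lambda>f. E (D (H f)))"
    by (rule trace_V_diff[OF c(1,2)])
  also have "fn.trace basis (\<lambda>f. E (D (H f))) = fn.trace basis (\<lambda>f. D (H (E f)))"
    by (rule trace_V_comm[OF e(2) fn.endo_on_comp[OF e(1,3)]])
  also have "fn.trace basis (\<lambda>f. D (E (H f))) - fn.trace basis (\<lambda>f. D (H (E f)))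
      = fn.trace basis (\<lambda>f. D (E (H f)) - D (H (E f)))"
    by (rule trace_V_diff[OF c(1,3), symmetric])
  also have "\<dots> = form D (lie_bracket E H)"
    unfolding form_def lie_bracket_def
  proof (rule trace_V_cong)
    fix f assume "f \<in> V"
    then show "D (E (H f)) - D (H (E f)) = D (E (H f) - H (E f))"
      using e by (simp add: fn.endo_on_diff[OF e(1) module_subspace] fn.endo_onD(1)[OF e(2)] fn.endo_onD(1)[OF e(3)])
  qed
  finally show ?thesis .
qed

lemma radical_lie: "D \<in> radical \<Longrightarrow> D \<in> lie"
  by (simp add: radical_def)

lemma radical_subspace: "opr.subspace radical"
proof (rule opr.subspaceI)
  show "0 \<in> radical"
    using opr.subspace_0[OF lie_subspace] form_scale[of 0 _ 0] by (auto simp: radical_def)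
qed (auto simp: radical_def form_add form_scale opr.subspace_add[OF lie_subspace]
    opr.subspace_scale[OF lie_subspace])

lemma radical_bracket: "D \<in> radical \<Longrightarrow> E \<in> lie \<Longrightarrow> lie_bracket D E \<in> radical"
  by (auto simp: radical_def lie_bracket_closed form_invariant)

lemma radical_nilpotent:
  assumes D: "D \<in> radical"
  shows "\<exists>e. \<forall>f\<in>V. (D ^^ e) f = 0"
proof -
  note Dl = radical_lie[OF D]
  obtain S where S: "finite S" "V \<subseteq> fn.span S"
    using module_finite_dimensional[OF F(1) F_A] by blast
  obtain bs \<mu> where T: "fn.triangular D V bs \<mu>" "fn.span (set bs) = V"
    using fn.triangular_exists[OF lie_V_endo[OF Dl] module_subspace S(2,1)
        module_in_geigen_sum[OF F(1) F_A lieD(4)[OF Dl]]] by metis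
  have "\<mu> i = 0" if i: "i < length bs" for i
  proof (rule ccontr)
    assume "\<mu> i \<noteq> 0"
    then obtain \<psi> :: "'k \<Rightarrow> rat" where \<psi>: "\<And>x y. \<psi> (x + y) = \<psi> x + \<psi> y"
      "\<And>q x. \<psi> (of_rat q * x) = q * \<psi> x" "\<psi> (\<mu> i) = 1"
      using rational_linear_functional by metis
    \<comment> \<open>The rationals are embedded back into the field, because the scaling operator
      takes its factors there.\<close>
    define \<phi> :: "'k \<Rightarrow> 'k" where "\<phi> x = of_rat (\<psi> x)" for x
    have "\<phi> (x + y) = \<phi> x + \<phi> y" for x y
      by (simp add: \<phi>_def \<psi>(1) of_rat_add)
    then obtain E where E: "E \<in> lie" "\<And>\<mu> f. f \<in> fn.geigen D A \<mu> \<Longrightarrow> E f = fscale (\<phi> \<mu>) f"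
      using lie_replica[OF Dl] by metis
    have "E (bs ! j) = fscale (\<phi> (\<mu> j)) (bs ! j)" if "j < length bs" for j
      using T(1) that geigen_mono[OF V_A] by (intro E(2)) (auto simp: fn.triangular_def)
    then have "fn.trace (set bs) (\<lambda>f. D (E f)) = (\<Sum>j<length bs. \<phi> (\<mu> j) * \<mu> j)"
      by (rule fn.trace_triangular[OF T lie_V_endo[OF Dl]])
    moreover have "fn.trace (set bs) (\<lambda>f. D (E f)) = form D E"
      unfolding form_def
    proof (rule fn.trace_basis_independent[OF basis(1,2)])
      show "fn.independent (set bs)" "fn.span (set bs) = fn.span basis"
        using T by (simp_all add: fn.triangular_def basis(3))
      show "fn.endo_on (fn.span basis) (\<lambda>f. D (E f))"
        unfolding basis(3) by (rule fn.endo_on_comp[OF lie_V_endo[OF Dl] lie_V_endo[OF E(1)]])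
    qed simp
    ultimately have sum0: "(\<Sum>j<length bs. \<phi> (\<mu> j) * \<mu> j) = 0"
      using D E(1) by (auto simp: radical_def)
    have \<psi>_0: "\<psi> 0 = 0"
      using \<psi>(1)[of 0 0] by simp
    have \<psi>_sum: "\<psi> (\<Sum>j\<in>J. f j) = (\<Sum>j\<in>J. \<psi> (f j))" for f and J :: "nat set"
      by (induction J rule: infinite_finite_induct) (auto simp: \<psi>(1) \<psi>_0)
    \<comment> \<open>Apply \<psi> to the trace relation: its rational linearity takes the factors
      \<open>\<phi> (\<mu> j)\<close> out, leaving a sum of squares of rationals.\<close>
    have "(\<Sum>j<length bs. \<psi> (\<mu> j) * \<psi> (\<mu> j)) = 0"
      using arg_cong[OF sum0, of \<psi>] by (simp add: \<psi>_sum \<psi>_0 \<phi>_def \<psi>(2))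
    then have "\<psi> (\<mu> i) * \<psi> (\<mu> i) = 0"
      using i by (subst (asm) sum_nonneg_eq_0_iff) auto
    then show False
      using \<psi>(3) by simp
  qed
  then show ?thesis
    using fn.triangular_nilpotent[OF T lie_V_endo[OF Dl]] by blast
qed

lemma radical_nil: "nil_lie_algebra radical V"
proof
  show "fn.subspace V"
    by (rule module_subspace)
  show "opr.subspace radical"
    by (rule radical_subspace)
  show "\<exists>T. finite T \<and> radical \<subseteq> opr.span T"
    using lie_finite_dimensional radical_lie by blast
  fix D assume D: "D \<in> radical"
  then show "fn.endo_on V D"
    by (intro lie_V_endo radical_lie)
  show "\<exists>e. \<forall>f\<in>V. (D ^^ e) f = 0"
    using D by (rule radical_nilpotent)
  show "lie_bracket D E \<in> radical" if "E \<in> radical" for E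
    using D that radical_bracket radical_lie by blast
  show "D = 0" if zero: "\<And>f. f \<in> V \<Longrightarrow> D f = 0"
    by (rule lie_eq_0[OF radical_lie[OF D] F(3)]) (use zero module_superset in blast)
qed

sublocale rad: nil_lie_algebra radical V
  by (rule radical_nil)

abbreviation layer :: "nat \<Rightarrow> ('g \<Rightarrow> 'k) set" where
  "layer \<equiv> flag radical V"

lemma layer_A: "f \<in> layer i \<Longrightarrow> f \<in> A"
  using V_A by (auto simp: flag_def)

lemma layer_V: "f \<in> layer i \<Longrightarrow> f \<in> V"
  by (simp add: flag_def)

lemmas layer_subspace = rad.flag_subspace[OF subset_refl]

text \<open>This is the adjoint action of \<open>g\<close>. Inside the trace it moves to the other
  argument as the action of the inverse, under which the Lie algebra is stable too. The value 0
  outside \<open>A\<close> follows the convention for elements of the Lie algebra.\<close>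

lemma right_conjugate_radical:
  assumes g: "g \<in> carrier G" and D: "D \<in> radical"
  defines "D' \<equiv> \<lambda>f. if f \<in> A then right_translate G g (D (right_translate G (inv g) f)) else 0"
  shows "D' \<in> radical"
proof -
  have Dl: "D \<in> lie"
    by (rule radical_lie[OF D])
  have g': "inv g \<in> carrier G"
    using g by simp
  have conj: "(\<lambda>f. if f \<in> A then right_translate G h (E (right_translate G (inv h) f)) else 0) \<in> lie"
    if h: "h \<in> carrier G" and E: "E \<in> lie" for h E
  proof (rule lieI)
    have L: "left_invariant (\<lambda>f. right_translate G h (E (right_translate G (inv h) f)))"
      by (intro left_invariant_comp[OF left_invariant_right_translate[OF h]]
          left_invariant_comp[OF lieD(4)[OF E]] left_invariant_right_translate inv_closed h)
    show "left_invariant (\<lambda>f. if f \<in> A then right_translate G h (E (right_translate G (inv h) f)) else 0)"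
      using L left_translate_A by (auto simp: left_invariant_def fn.endo_on_def A_closed A_scale)
    show "(if f * f' \<in> A then right_translate G h (E (right_translate G (inv h) (f * f'))) else 0) =
      (if f \<in> A then right_translate G h (E (right_translate G (inv h) f)) else 0) * f' +
      f * (if f' \<in> A then right_translate G h (E (right_translate G (inv h) f')) else 0)"
      if "f \<in> A" "f' \<in> A" for f f'
      using that h by (simp add: A_closed right_translate_linear right_translate_A lieD(3)[OF E]
          right_translate_inverse)
  qed auto
  have "form D' E = 0" if E: "E \<in> lie" for E
  proof -
    define E' where "E' f = (if f \<in> A then right_translate G (inv g) (E (right_translate G g f)) else 0)" for f
    have E': "E' \<in> lie"
      using conj[OF g' E] unfolding inv_inv[OF g] E'_def[abs_def] .
    note R = V_endo[OF left_invariant_right_translate[OF g]] V_endo[OF left_invariant_right_translate[OF g']]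
    note e = lie_V_endo[OF Dl] lie_V_endo[OF E]
    have "form D' E = fn.trace basis (\<lambda>f. right_translate G g (D (right_translate G (inv g) (E f))))"
      unfolding form_def D'_def using lie_A[OF E] by simp
    also have "\<dots> = fn.trace basis (\<lambda>f. D (right_translate G (inv g) (E (right_translate G g f))))"
      by (rule trace_V_comm[OF R(1) fn.endo_on_comp[OF e(1) fn.endo_on_comp[OF R(2) e(2)]]])
    also have "\<dots> = form D E'"
      unfolding form_def by (rule trace_V_cong) (use V_A in \<open>auto simp: E'_def\<close>)
    also have "\<dots> = 0"
      using D E' by (simp add: radical_def)
    finally show ?thesis .
  qed
  then show ?thesis
    using conj[OF g Dl] by (simp add: radical_def D'_def)
qed

text \<open>The group normalises the radical, hence preserves the flag that the radical
  defines.\<close>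

lemma layer_right_translate:
  assumes g: "g \<in> carrier G" and f: "f \<in> layer i"
  shows "right_translate G g f \<in> layer i"
  using f
proof (induction i arbitrary: f)
  case 0
  have "right_translate G g 0 = 0"
    by (auto simp: right_translate_def pullback_def fun_eq_iff fun_apply)
  then show ?case
    using 0 unfolding rad.flag_0 by (metis singletonD singletonI)
next
  case (Suc i)
  have fV: "f \<in> V"
    using Suc.prems by (rule layer_V)
  have RV: "right_translate G g f \<in> V"
    using fn.endo_onD(1)[OF V_endo[OF left_invariant_right_translate[OF g]] fV] .
  have "D (right_translate G g f) \<in> layer i" if D: "D \<in> radical" for D
  proof -
    define D' where "D' f = (if f \<in> A then right_translate G (inv g) (D (right_translate G g f)) else 0)" for f
    have "D' \<in> radical"
      using right_conjugate_radical[OF inv_closed[OF g] D] unfolding inv_inv[OF g] D'_def[abs_def] .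
    then have "D' f \<in> layer i"
      using Suc.prems rad.flag_Suc[OF subset_refl] by blast
    then have "right_translate G g (D' f) \<in> layer i"
      by (rule Suc.IH)
    moreover have "right_translate G g (D' f) = D (right_translate G g f)"
      using fV V_A g lie_A[OF radical_lie[OF D]] by (auto simp: D'_def right_translate_inverse)
    ultimately show ?thesis
      by simp
  qed
  then show ?case
    using RV unfolding rad.flag_Suc[OF subset_refl] by blast
qed

end

section \<open>Principal open sets of the Zariski topology\<close>

lemma topspace_zariski: "const_on X (1::'k::field) \<in> B \<Longrightarrow> topspace (zariski X B) = X"
proof -
  assume "const_on X (1::'k) \<in> B"
  then have "X \<in> {{x \<in> X. f x \<noteq> 0} | f. f \<in> B}"
    by (intro CollectI exI[of _ "const_on X 1"]) (auto simp: const_on_def)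
  then show ?thesis
    by (auto simp: zariski_def)
qed

lemma openin_zariski_basic: "f \<in> B \<Longrightarrow> openin (zariski X B) {x \<in> X. f x \<noteq> 0}"
  unfolding zariski_def by (rule topology_generated_by_Basis) blast

text \<open>Principal open sets form a base and not only a subbase, because the intersection of two
  of them belongs to the product of the functions.\<close>

lemma openin_zariski_nonvanishing:
  fixes B :: "('a \<Rightarrow> 'k::field) set"
  assumes B: "const_on X 1 \<in> B" "\<And>f g. f \<in> B \<Longrightarrow> g \<in> B \<Longrightarrow> f * g \<in> B"
    and "openin (zariski X B) E" "x \<in> E"
  shows "\<exists>f\<in>B. f x \<noteq> 0 \<and> {y \<in> X. f y \<noteq> 0} \<subseteq> E"
proof -
  have "generate_topology_on {{x \<in> X. f x \<noteq> 0} | f. f \<in> B} E"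
    using assms(3) by (simp add: zariski_def openin_topology_generated_by_iff)
  then show ?thesis
    using assms(4)
  proof induction
    case (Int a b)
    then obtain f g where fg: "f \<in> B" "f x \<noteq> 0" "{y \<in> X. f y \<noteq> 0} \<subseteq> a"
      "g \<in> B" "g x \<noteq> 0" "{y \<in> X. g y \<noteq> 0} \<subseteq> b"
      by auto
    then show ?case
      using B(2)[OF fg(1,4)] by (intro bexI[of _ "f * g"]) (auto simp: fun_apply)
  next
    case (UN K)
    from UN.prems obtain k where k: "k \<in> K" "x \<in> k"
      by (rule UnionE)
    obtain f where "f \<in> B" "f x \<noteq> 0" "{y \<in> X. f y \<noteq> 0} \<subseteq> k"
      using UN.IH[OF k] by (elim bexE conjE)
    then show ?case
      using k(1) by (intro bexI[of _ f]) auto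
  next
    case (Basis s)
    then obtain f where "f \<in> B" "s = {x \<in> X. f x \<noteq> 0}"
      by auto
    then show ?case
      using Basis.prems by (intro bexI[of _ f]) auto
  qed simp
qed

text \<open>A power series in \<delta>, cut off for each argument at its order of nilpotency. The
  coefficients \<open>1 / fact i\<close> give the exponential, and the binomial coefficients of
  \<open>t\<close> give the power \<open>(1 + \<delta>)^t\<close>.\<close>

definition nil_sum :: "(nat \<Rightarrow> 'k) \<Rightarrow> ('g, 'k::field) operator \<Rightarrow> ('g, 'k) operator" where
  "nil_sum a \<delta> f = (\<Sum>i<(LEAST n. (\<delta> ^^ n) f = 0). fscale (a i) ((\<delta> ^^ i) f))"

lemma funpow_zero_mono:
  fixes \<delta> :: "('g, 'k::field) operator"
  assumes "\<delta> 0 = 0" "(\<delta> ^^ n) f = 0" "n \<le> m"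
  shows "(\<delta> ^^ m) f = 0"
  using assms(3) by (induction m rule: dec_induct) (simp_all add: assms)

lemma nil_sum_eq:
  assumes "\<delta> 0 = 0" "(\<delta> ^^ n) f = 0"
  shows "nil_sum a \<delta> f = (\<Sum>i<n. fscale (a i) ((\<delta> ^^ i) f))"
proof -
  define k where "k = (LEAST n. (\<delta> ^^ n) f = 0)"
  have k: "(\<delta> ^^ k) f = 0" "k \<le> n"
    unfolding k_def using assms(2) by (auto intro: LeastI Least_le)
  have "(\<delta> ^^ i) f = 0" if "k \<le> i" for i
    by (rule funpow_zero_mono[OF assms(1) k(1) that])
  then have "(\<Sum>i<k. fscale (a i) ((\<delta> ^^ i) f)) = (\<Sum>i<n. fscale (a i) ((\<delta> ^^ i) f))"
    using k(2) by (intro sum.mono_neutral_left) auto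
  then show ?thesis
    by (simp add: nil_sum_def k_def)
qed

section \<open>Power series in locally nilpotent operators\<close>

context generated_alg_group
begin

definition locally_nilpotent :: "('g, 'k) operator \<Rightarrow> bool" where
  "locally_nilpotent \<delta> \<longleftrightarrow> left_invariant \<delta> \<and> (\<forall>f\<in>A. \<exists>n. (\<delta> ^^ n) f = 0)"

lemma left_invariant_0: "left_invariant T \<Longrightarrow> T 0 = 0"
  using fn.endo_on_zero[OF left_invariantD(1) A_subspace] .

text \<open>Nilpotency spreads from the generators to sums and products. The constant
  \<open>c\<close> is 0 for derivations and 1 for the difference of a right translation and the
  identity.\<close>

lemma locally_nilpotentI:
  assumes \<delta>: "left_invariant \<delta>" and unit: "\<delta> unit = 0"
    and product: "\<And>f g. f \<in> A \<Longrightarrow> g \<in> A \<Longrightarrow> \<delta> (f * g) = fscale c (\<delta> f * \<delta> g) + \<delta> f * g + f * \<delta> g"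
    and nil: "\<And>f. f \<in> F \<Longrightarrow> \<exists>n. (\<delta> ^^ n) f = 0"
  shows "locally_nilpotent \<delta>"
proof -
  have pow: "fn.endo_on A (\<delta> ^^ n)" for n
    by (rule fn.endo_on_funpow[OF left_invariantD(1)[OF \<delta>]])
  note \<delta>_0 = left_invariant_0[OF \<delta>]
  have "\<exists>n. (\<delta> ^^ n) f = 0" if "f \<in> generated_algebra (carrier G) F" for f
    using that
  proof induction
    case (const c)
    have "\<delta> (const_on (carrier G) c) = 0"
      using fn.endo_onD(3)[OF left_invariantD(1)[OF \<delta>] A_closed(1), of c 1] unit
      by (simp add: const_on_unit[of c])
    then have "(\<delta> ^^ 1) (const_on (carrier G) c) = 0"
      by simp
    then show ?case
      by blast
  next
    case (add f g)
    then obtain n m where "(\<delta> ^^ n) f = 0" "(\<delta> ^^ m) g = 0"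
      by blast
    then have "(\<delta> ^^ (max n m)) f = 0" "(\<delta> ^^ (max n m)) g = 0"
      using funpow_zero_mono[where \<delta> = \<delta>, OF \<delta>_0] by auto
    then have "(\<delta> ^^ (max n m)) (f + g) = 0"
      using add.hyps F(3) by (simp add: fn.endo_onD(2)[OF pow])
    then show ?case
      by blast
  next
    case (mult f g)
    then obtain n m where nm: "(\<delta> ^^ n) f = 0" "(\<delta> ^^ m) g = 0"
      by blast
    have fg: "f \<in> A" "g \<in> A"
      using mult.hyps F(3) by simp_all
    have "(\<delta> ^^ (n + m)) (f * g) = 0"
      by (rule nilpotent_product[OF left_invariantD(1)[OF \<delta>] A_subspace A_closed(3)
            left_invariantD(2)[OF \<delta>] left_invariantD(2)[OF \<delta>] product fg nm order.refl])
    then show ?case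
      by blast
  qed (rule nil)
  then show ?thesis
    using \<delta> unfolding locally_nilpotent_def F(3)[symmetric] by blast
qed

lemma locally_nilpotent_common:
  assumes "locally_nilpotent \<delta>" "f \<in> A" "g \<in> A"
  obtains n where "(\<delta> ^^ n) f = 0" "(\<delta> ^^ n) g = 0"
proof -
  obtain n m where nm: "(\<delta> ^^ n) f = 0" "(\<delta> ^^ m) g = 0"
    using assms unfolding locally_nilpotent_def by blast
  have \<delta>_0: "\<delta> 0 = 0"
    using assms(1) left_invariant_0 by (simp add: locally_nilpotent_def)
  show ?thesis
    using funpow_zero_mono[where \<delta> = \<delta>, OF \<delta>_0 nm(1), of "max n m"] funpow_zero_mono[where \<delta> = \<delta>, OF \<delta>_0 nm(2), of "max n m"]
    by (intro that[of "max n m"]) auto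
qed

lemma nil_sum_left_invariant:
  assumes \<delta>: "locally_nilpotent \<delta>"
  shows "left_invariant (nil_sum a \<delta>)"
proof -
  have L: "left_invariant \<delta>"
    using \<delta> by (simp add: locally_nilpotent_def)
  note \<delta>_0 = left_invariant_0[OF L]
  have pow: "fn.endo_on A (\<delta> ^^ n)" for n
    by (rule fn.endo_on_funpow[OF left_invariantD(1)[OF L]])
  have lt: "(\<delta> ^^ n) (left_translate G g f) = left_translate G g ((\<delta> ^^ n) f)"
    if "g \<in> carrier G" "f \<in> A" for g f n
  proof (induction n)
    case (Suc n)
    then show ?case
      using left_invariantD(3)[OF L that(1) fn.endo_onD(1)[OF pow that(2)]] by simp
  qed simp
  have lt_0: "left_translate G g 0 = 0" for g
    by (auto simp: left_translate_def pullback_def fun_eq_iff fun_apply)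
  have lt_sum: "left_translate G g (\<Sum>i\<in>I. h i) = (\<Sum>i\<in>I. left_translate G g (h i))" for g h and I :: "nat set"
    by (induction I rule: infinite_finite_induct) (simp_all add: lt_0 left_translate_linear)
  show ?thesis
    unfolding left_invariant_def fn.endo_on_def
  proof (intro conjI ballI allI)
    fix f assume f: "f \<in> A"
    obtain n where n: "(\<delta> ^^ n) f = 0"
      using \<delta> f unfolding locally_nilpotent_def by blast
    show "nil_sum a \<delta> f \<in> A"
      unfolding nil_sum_eq[where \<delta> = \<delta>, OF \<delta>_0 n] using fn.endo_onD(1)[OF pow f]
      by (intro fn.subspace_sum[OF A_subspace] A_scale)
    show "nil_sum a \<delta> (fscale c f) = fscale c (nil_sum a \<delta> f)" for c
    proof -
      have "(\<delta> ^^ n) (fscale c f) = 0"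
        using f n by (simp add: fn.endo_onD(3)[OF pow])
      from nil_sum_eq[where \<delta> = \<delta>, OF \<delta>_0 this] show ?thesis
        using f by (simp add: nil_sum_eq[where \<delta> = \<delta>, OF \<delta>_0 n] fn.endo_onD(3)[OF pow] fn.scale_sum_right mult.commute)
    qed
    show "nil_sum a \<delta> (left_translate G g f) = left_translate G g (nil_sum a \<delta> f)"
      if g: "g \<in> carrier G" for g
    proof -
      have "(\<delta> ^^ n) (left_translate G g f) = 0"
        using n by (simp add: lt[OF g f] lt_0)
      from nil_sum_eq[where \<delta> = \<delta>, OF \<delta>_0 this] show ?thesis
        by (simp add: nil_sum_eq[where \<delta> = \<delta>, OF \<delta>_0 n] lt[OF g f] lt_sum left_translate_linear)
    qed
  next
    fix f g assume fg: "f \<in> A" "g \<in> A"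
    then obtain n where n: "(\<delta> ^^ n) f = 0" "(\<delta> ^^ n) g = 0"
      by (rule locally_nilpotent_common[OF \<delta>])
    then have "(\<delta> ^^ n) (f + g) = 0"
      using fg by (simp add: fn.endo_onD(2)[OF pow])
    from nil_sum_eq[where \<delta> = \<delta>, OF \<delta>_0 this]
    show "nil_sum a \<delta> (f + g) = nil_sum a \<delta> f + nil_sum a \<delta> g"
      using fg by (simp add: nil_sum_eq[where \<delta> = \<delta>, OF \<delta>_0 n(1)] nil_sum_eq[where \<delta> = \<delta>, OF \<delta>_0 n(2)]
          fn.endo_onD(2)[OF pow] fn.scale_right_distrib sum.distrib)
  qed
qed

subsection \<open>Exponentials of derivations and powers of unipotent elements\<close>

text \<open>
  For each point \<open>x\<close>, the polynomial \<open>exp (t D) f x\<close> in \<open>t\<close>: multiplicativity in \<open>f\<close> follows from the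
  differential equation.
\<close>

lemma exp_derivation_mult:
  assumes D: "D \<in> lie" "locally_nilpotent D" and fg: "f \<in> A" "g \<in> A"
  shows "nil_sum (\<lambda>i. 1 / fact i) D (f * g) = nil_sum (\<lambda>i. 1 / fact i) D f * nil_sum (\<lambda>i. 1 / fact i) D g"
proof
  fix x
  have L: "left_invariant D"
    by (rule lieD(4)[OF D(1)])
  note D_0 = left_invariant_0[OF L]
  have nilp: "\<exists>n. (D ^^ n) f = 0" if "f \<in> A" for f
    using D(2) that by (simp add: locally_nilpotent_def)
  define P where "P f = (\<Sum>i<(LEAST n. (D ^^ n) f = 0). monom ((D ^^ i) f x / fact i) i)" for f
  have coeff_P: "coeff (P f) i = (D ^^ i) f x / fact i" if "f \<in> A" for f i
  proof -
    have "(D ^^ (LEAST n. (D ^^ n) f = 0)) f = 0"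
      using nilp[OF that] by (rule LeastI_ex)
    then have "(D ^^ i) f = 0" if "\<not> i < (LEAST n. (D ^^ n) f = 0)"
      using funpow_zero_mono[where \<delta> = D, OF D_0] that by (meson not_less)
    then show ?thesis
      by (cases "i < (LEAST n. (D ^^ n) f = 0)") (auto simp: P_def coeff_sum coeff_monom fun_apply)
  qed
  have eval: "poly (P f) 1 = nil_sum (\<lambda>i. 1 / fact i) D f x" for f
    by (simp add: P_def nil_sum_def poly_sum poly_monom sum_fun_apply fun_apply)
  note D_A = left_invariantD(2)[OF L]
  have pow: "fn.endo_on A (D ^^ n)" for n
    by (rule fn.endo_on_funpow[OF left_invariantD(1)[OF L]])
  have P_add: "P (f + g) = P f + P g" if "f \<in> A" "g \<in> A" for f g
    using that by (intro poly_eqI) (simp add: coeff_P A_closed fn.endo_onD(2)[OF pow] fun_apply add_divide_distrib)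
  have pderiv_P: "pderiv (P f) = P (D f)" if f: "f \<in> A" for f
  proof (rule poly_eqI)
    fix i
    have "coeff (pderiv (P f)) i = of_nat (Suc i) * ((D ^^ Suc i) f x / fact (Suc i))"
      by (simp add: coeff_pderiv coeff_P[OF f] del: funpow.simps fact_Suc)
    also have "\<dots> = (D ^^ i) (D f) x / fact i"
      by (simp add: funpow_Suc_right field_simps del: funpow.simps of_nat_Suc)
    finally show "coeff (pderiv (P f)) i = coeff (P (D f)) i"
      by (simp add: coeff_P[OF D_A[OF f]])
  qed
  have P_0: "P 0 = 0"
    using fn.endo_on_zero[OF pow A_subspace]
    by (intro poly_eqI) (simp add: coeff_P[OF fn.subspace_0[OF A_subspace]] zero_fun_apply)
  have "P (f * g) = P f * P g" if "f \<in> A" "g \<in> A" "(D ^^ n) f = 0" "(D ^^ m) g = 0" "n + m \<le> N" for f g n m N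
    using that
  proof (induction N arbitrary: f g n m)
    case 0
    then show ?case
      by (simp add: P_0)
  next
    case (Suc N)
    show ?case
    proof (cases "n = 0 \<or> m = 0")
      case True
      then have "f = 0 \<or> g = 0"
        using Suc.prems(3,4) by auto
      then show ?thesis
        by (auto simp: P_0)
    next
      case False
      then obtain n' m' where nm: "n = Suc n'" "m = Suc m'"
        using not0_implies_Suc by blast
      have f1: "(D ^^ n') (D f) = 0" and g1: "(D ^^ m') (D g) = 0"
        using Suc.prems nm by (simp_all add: funpow_Suc_right del: funpow.simps)
      have 1: "P (D f * g) = P (D f) * P g"
        using Suc.IH[OF D_A[OF Suc.prems(1)] Suc.prems(2) f1 Suc.prems(4)] Suc.prems(5) nm by simp
      have 2: "P (f * D g) = P f * P (D g)"
        using Suc.IH[OF Suc.prems(1) D_A[OF Suc.prems(2)] Suc.prems(3) g1] Suc.prems(5) nm by simp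
      \<comment> \<open>By induction the products \<open>D f * g\<close> and \<open>f * D g\<close>
        already behave multiplicatively, so \<open>q\<close> has derivative 0. In characteristic 0
        it is constant, and its constant term is 0.\<close>
      define q where "q = P (f * g) - P f * P g"
      have "pderiv q = P (D (f * g)) - (P (D f) * P g + P f * P (D g))"
        using Suc.prems(1,2) by (simp add: q_def pderiv_diff pderiv_mult pderiv_P A_closed algebra_simps)
      also have "P (D (f * g)) = P (D f) * P g + P f * P (D g)"
        using Suc.prems(1,2) D_A by (simp add: lieD(3)[OF D(1)] P_add A_closed 1 2)
      finally have "degree q = 0"
        by (simp add: pderiv_eq_0_iff)
      moreover have "coeff q 0 = 0"
        using Suc.prems(1,2) by (simp add: q_def coeff_P A_closed coeff_mult fun_apply)
      ultimately have "q = 0"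
        by (metis leading_coeff_0_iff)
      then show ?thesis
        by (simp add: q_def)
    qed
  qed
  then have "P (f * g) = P f * P g"
    using nilp[OF fg(1)] nilp[OF fg(2)] fg by blast
  then show "nil_sum (\<lambda>i. 1 / fact i) D (f * g) x =
      (nil_sum (\<lambda>i. 1 / fact i) D f * nil_sum (\<lambda>i. 1 / fact i) D g) x"
    using eval by (simp add: fun_apply flip: eval)
qed

text \<open>The binomial theorem for right translation written as \<open>1 + \<delta>\<close>.
  Generalised binomial coefficients appear because the exponent will later run through the
  field.\<close>

lemma right_translate_funpow:
  assumes u: "u \<in> carrier G" and f: "f \<in> A" and \<delta>: "\<delta> = (\<lambda>f. right_translate G u f - f)"
    and n: "(\<delta> ^^ n) f = 0"
  shows "(right_translate G u ^^ m) f = (\<Sum>i<n. fscale (of_nat m gchoose i) ((\<delta> ^^ i) f))"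
  using f n
proof (induction m arbitrary: f)
  case 0
  have "(\<Sum>i<n. fscale (of_nat 0 gchoose i) ((\<delta> ^^ i) f)) = (\<Sum>i<n. if i = 0 then f else 0)"
    by (intro sum.cong) (auto simp: gbinomial_0_left)
  then show ?case
    using 0(2) by (cases "n = 0") auto
next
  case (Suc m)
  have R: "fn.endo_on A (right_translate G u ^^ m)"
    by (rule fn.endo_on_funpow[OF left_invariantD(1)[OF left_invariant_right_translate[OF u]]])
  have \<delta>A: "\<delta> f \<in> A"
    using Suc.prems(1) u by (simp add: \<delta> fn.subspace_diff[OF A_subspace] right_translate_A)
  have \<delta>_0: "\<delta> 0 = 0"
    by (auto simp: \<delta> right_translate_def pullback_def fun_eq_iff fun_apply)
  have \<delta>f: "(\<delta> ^^ n) (\<delta> f) = 0"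
    using funpow_zero_mono[where \<delta> = \<delta>, OF \<delta>_0 Suc.prems(2), of "Suc n"]
    by (simp add: funpow_Suc_right del: funpow.simps)
  define h where "h i = (\<delta> ^^ i) f" for i
  define C where "C k i = fscale (of_nat k gchoose i) (h i)" for k i
  have pascal: "(of_nat (Suc m) :: 'k) gchoose Suc i = (of_nat m gchoose i) + (of_nat m gchoose Suc i)" for i
    using gbinomial_Suc_Suc[of "of_nat m :: 'k" i] by (simp add: add.commute)
  have h_n: "C k n = 0" for k
    using Suc.prems(2) by (simp add: C_def h_def)
  have "(right_translate G u ^^ Suc m) f = (right_translate G u ^^ m) (f + \<delta> f)"
    by (simp add: funpow_Suc_right \<delta> del: funpow.simps)
  also have "\<dots> = (\<Sum>i<n. C m i) + (\<Sum>i<n. fscale (of_nat m gchoose i) (h (Suc i)))"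
    using Suc.IH[OF Suc.prems] Suc.IH[OF \<delta>A \<delta>f] Suc.prems(1) \<delta>A
    by (simp add: fn.endo_onD(2)[OF R] C_def h_def funpow_Suc_right del: funpow.simps)
  \<comment> \<open>The term of index \<open>n\<close> is zero; adding it lines the sums up for
    Pascal's rule.\<close>
  also have "(\<Sum>i<n. C m i) = (\<Sum>i<Suc n. C m i)"
    by (simp add: h_n)
  also have "\<dots> = C m 0 + (\<Sum>i<n. C m (Suc i))"
    by (rule sum.lessThan_Suc_shift)
  also have "C m 0 + (\<Sum>i<n. C m (Suc i)) + (\<Sum>i<n. fscale (of_nat m gchoose i) (h (Suc i))) =
      C (Suc m) 0 + (\<Sum>i<n. C (Suc m) (Suc i))"
    by (simp add: C_def pascal sum.distrib fn.scale_left_distrib add.commute del: of_nat_Suc)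
  also have "\<dots> = (\<Sum>i<Suc n. C (Suc m) i)"
    by (rule sum.lessThan_Suc_shift[symmetric])
  also have "\<dots> = (\<Sum>i<n. C (Suc m) i)"
    by (simp add: h_n)
  finally show ?case
    by (simp add: C_def h_def)
qed

end

section \<open>The unipotent group attached to the radical\<close>

context generated_alg_group
begin

lemma radical_locally_nilpotent:
  assumes D: "D \<in> radical"
  shows "locally_nilpotent D"
proof (rule locally_nilpotentI)
  note Dl = radical_lie[OF D]
  show "left_invariant D"
    by (rule lieD(4)[OF Dl])
  show "D unit = 0"
    by (rule lieD(2)[OF Dl])
  show "D (f * g) = fscale 0 (D f * D g) + D f * g + f * D g" if "f \<in> A" "g \<in> A" for f g
    using lieD(3)[OF Dl that] by simp
  show "\<exists>n. (D ^^ n) f = 0" if "f \<in> F" for f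
    using radical_nilpotent[OF D] module_superset that by blast
qed

lemma radical_layer: "D \<in> radical \<Longrightarrow> f \<in> layer (Suc i) \<Longrightarrow> D f \<in> layer i"
  using rad.flag_Suc[OF subset_refl] by blast

definition radical_group :: "'g set" where
  "radical_group = {u \<in> carrier G. \<forall>i. \<forall>f\<in>layer (Suc i). right_translate G u f - f \<in> layer i}"

lemma radical_groupD:
  assumes "u \<in> radical_group"
  shows "u \<in> carrier G" "f \<in> layer (Suc i) \<Longrightarrow> right_translate G u f - f \<in> layer i"
  using assms by (auto simp: radical_group_def)

lemma left_invariant_difference:
  assumes "u \<in> carrier G"
  shows "left_invariant (\<lambda>f. right_translate G u f - f)"
  using left_invariantD[OF left_invariant_right_translate[OF assms]] A_subspace left_translate_A
  by (auto simp: left_invariant_def fn.endo_on_def fn.subspace_diff right_translate_linear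
      left_translate_linear fn.scale_right_diff_distrib)

lemma difference_locally_nilpotent:
  assumes u: "u \<in> radical_group"
  shows "locally_nilpotent (\<lambda>f. right_translate G u f - f)"
proof (rule locally_nilpotentI[where c = 1])
  note u' = radical_groupD(1)[OF u]
  show "left_invariant (\<lambda>f. right_translate G u f - f)"
    by (rule left_invariant_difference[OF u'])
  show "right_translate G u unit - unit = 0"
    by (simp add: right_translate_unit[OF u'])
  show "right_translate G u (f * g) - f * g =
      fscale 1 ((right_translate G u f - f) * (right_translate G u g - g)) +
      (right_translate G u f - f) * g + f * (right_translate G u g - g)" for f g
    by (simp add: right_translate_linear algebra_simps)
  obtain d where d: "layer d = V"
    using rad.engel by blast
  have "((\<lambda>f. right_translate G u f - f) ^^ i) f = 0" if "f \<in> layer i" for i f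
    using that
  proof (induction i arbitrary: f)
    case 0
    then show ?case
      using rad.flag_0 by simp
  next
    case (Suc i)
    then show ?case
      using radical_groupD(2)[OF u] by (simp add: funpow_Suc_right del: funpow.simps)
  qed
  then show "\<exists>n. ((\<lambda>f. right_translate G u f - f) ^^ n) f = 0" if "f \<in> F" for f
    using d module_superset that by blast
qed

text \<open>Common to exponentials and powers. Because \<open>a 0 = 1\<close>, the series minus the
  identity contains only positive powers of \<delta>, which lower the flag.\<close>

lemma nil_sum_in_radical_group:
  assumes \<delta>: "locally_nilpotent \<delta>" and unit: "\<delta> unit = 0" and a: "a 0 = 1"
    and mult: "\<And>f g. f \<in> A \<Longrightarrow> g \<in> A \<Longrightarrow> nil_sum a \<delta> (f * g) = nil_sum a \<delta> f * nil_sum a \<delta> g"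
    and layer: "\<And>i f. f \<in> layer (Suc i) \<Longrightarrow> \<delta> f \<in> layer i"
  obtains u where "u \<in> radical_group" "\<And>f. f \<in> A \<Longrightarrow> nil_sum a \<delta> f = right_translate G u f"
proof -
  have L: "left_invariant \<delta>"
    using \<delta> by (simp add: locally_nilpotent_def)
  note \<delta>_0 = left_invariant_0[OF L]
  have "(\<delta> ^^ 1) unit = 0"
    using unit by simp
  from nil_sum_eq[where \<delta> = \<delta>, OF \<delta>_0 this] have "nil_sum a \<delta> unit = unit"
    by (simp add: a)
  then obtain u where u: "u \<in> carrier G" "\<And>f. f \<in> A \<Longrightarrow> nil_sum a \<delta> f = right_translate G u f"
    using left_invariant_homomorphism[OF nil_sum_left_invariant[OF \<delta>] mult] by metis
  have "right_translate G u f - f \<in> layer i" if f: "f \<in> layer (Suc i)" for f i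
  proof -
    have fA: "f \<in> A"
      using f by (rule layer_A)
    obtain n where n: "(\<delta> ^^ n) f = 0"
      using \<delta> fA unfolding locally_nilpotent_def by blast
    have n': "(\<delta> ^^ Suc n) f = 0"
      using funpow_zero_mono[where \<delta> = \<delta>, OF \<delta>_0 n, of "Suc n"] by simp
    have pow: "(\<delta> ^^ Suc j) f \<in> layer i" for j
    proof (induction j)
      case 0
      then show ?case
        using layer[OF f] by simp
    next
      case (Suc j)
      have "(\<delta> ^^ Suc j) f \<in> layer (Suc i)"
        using Suc rad.flag_Suc_mono[OF subset_refl] by blast
      then show ?case
        using layer by simp
    qed
    have "nil_sum a \<delta> f = (\<Sum>j<Suc n. fscale (a j) ((\<delta> ^^ j) f))"
      by (rule nil_sum_eq[where \<delta> = \<delta>, OF \<delta>_0 n'])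
    also have "\<dots> = f + (\<Sum>j<n. fscale (a (Suc j)) ((\<delta> ^^ Suc j) f))"
      by (subst sum.lessThan_Suc_shift) (simp add: a)
    finally have "right_translate G u f - f = (\<Sum>j<n. fscale (a (Suc j)) ((\<delta> ^^ Suc j) f))"
      by (simp add: u(2)[OF fA])
    also have "\<dots> \<in> layer i"
      by (intro fn.subspace_sum[OF layer_subspace] fn.subspace_scale[OF layer_subspace] pow)
    finally show ?thesis .
  qed
  then have "u \<in> radical_group"
    using u(1) by (simp add: radical_group_def)
  then show ?thesis
    using u(2) by (rule that)
qed

lemma radical_exp:
  assumes D: "D \<in> radical"
  obtains u where "u \<in> radical_group" "\<And>f. f \<in> A \<Longrightarrow> nil_sum (\<lambda>i. 1 / fact i) D f = right_translate G u f"
proof (rule nil_sum_in_radical_group[OF radical_locally_nilpotent[OF D]])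
  show "D unit = 0"
    by (rule lieD(2)[OF radical_lie[OF D]])
  show "nil_sum (\<lambda>i. 1 / fact i) D (f * g) = nil_sum (\<lambda>i. 1 / fact i) D f * nil_sum (\<lambda>i. 1 / fact i) D g"
    if "f \<in> A" "g \<in> A" for f g
    by (rule exp_derivation_mult[OF radical_lie[OF D] radical_locally_nilpotent[OF D] that])
  show "D f \<in> layer i" if "f \<in> layer (Suc i)" for f i
    by (rule radical_layer[OF D that])
qed (auto intro: that)

text \<open>If the group is trivial, the exponential of \<open>D\<close> is the identity. On a
  function killed by the square of \<open>D\<close> it is also \<open>1 + D\<close>, so
  \<open>D\<close> kills that function; this reduces the order of nilpotency step by step.\<close>

lemma radical_eq_0:
  assumes trivial: "radical_group = {\<one>}" and D: "D \<in> radical"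
  shows "D = 0"
proof -
  have L: "left_invariant D"
    by (rule lieD(4)[OF radical_lie[OF D]])
  note D_0 = left_invariant_0[OF L]
  obtain u where u: "u \<in> radical_group" "\<And>f. f \<in> A \<Longrightarrow> nil_sum (\<lambda>i. 1 / fact i) D f = right_translate G u f"
    using radical_exp[OF D] by metis
  have exp: "nil_sum (\<lambda>i. 1 / fact i) D f = f" if "f \<in> A" for f
    using u trivial that by (simp add: right_translate_one)
  have D2: "D f = 0" if f: "f \<in> A" and "D (D f) = 0" for f
  proof -
    have "(D ^^ 2) f = 0"
      using \<open>D (D f) = 0\<close> by (simp add: numeral_2_eq_2)
    from nil_sum_eq[where \<delta> = D, OF D_0 this, of "\<lambda>i. 1 / fact i"]
    have "f = f + D f"
      by (simp add: exp[OF f] numeral_2_eq_2)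
    then show ?thesis
      by simp
  qed
  have "D f = 0" if "f \<in> A" "(D ^^ n) f = 0" for f n
    using that
  proof (induction n arbitrary: f)
    case 0
    then show ?case
      by (simp add: D_0)
  next
    case (Suc n)
    have "D (D f) = 0"
      using Suc.IH[OF left_invariantD(2)[OF L Suc.prems(1)]] Suc.prems(2)
      by (simp add: funpow_Suc_right del: funpow.simps)
    then show ?case
      by (rule D2[OF Suc.prems(1)])
  qed
  then have "D f = 0" if "f \<in> F" for f
    using radical_locally_nilpotent[OF D] F_A that unfolding locally_nilpotent_def by blast
  then show ?thesis
    by (rule lie_eq_0[OF radical_lie[OF D] F(3)])
qed

subsection \<open>The radical group is a connected normal unipotent subgroup\<close>

lemma radical_group_mult:
  assumes u: "u \<in> radical_group" and v: "v \<in> radical_group"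
  shows "u \<otimes> v \<in> radical_group"
  unfolding radical_group_def
proof (intro CollectI conjI allI ballI)
  note u' = radical_groupD[OF u] and v' = radical_groupD[OF v]
  show "u \<otimes> v \<in> carrier G"
    using u' v' by simp
  fix i f assume f: "f \<in> layer (Suc i)"
  have "right_translate G (u \<otimes> v) f - f =
      right_translate G u (right_translate G v f - f) + (right_translate G u f - f)"
    using right_translate_mult[OF u'(1) v'(1) layer_A[OF f]] by (simp add: right_translate_linear)
  also have "\<dots> \<in> layer i"
    using layer_right_translate[OF u'(1) v'(2)[OF f]] u'(2)[OF f] layer_subspace
    by (simp add: fn.subspace_add)
  finally show "right_translate G (u \<otimes> v) f - f \<in> layer i" .
qed

lemma radical_group_conj:
  assumes g: "g \<in> carrier G" and u: "u \<in> radical_group"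
  shows "g \<otimes> u \<otimes> inv g \<in> radical_group"
  unfolding radical_group_def
proof (intro CollectI conjI allI ballI)
  note u' = radical_groupD[OF u]
  show "g \<otimes> u \<otimes> inv g \<in> carrier G"
    using u' g by simp
  fix i f assume f: "f \<in> layer (Suc i)"
  define h where "h = right_translate G (inv g) f"
  have h: "h \<in> layer (Suc i)"
    unfolding h_def using layer_right_translate[OF inv_closed[OF g] f] .
  have "right_translate G (g \<otimes> u \<otimes> inv g) f - f = right_translate G g (right_translate G u h - h)"
    using right_translate_mult[of "g \<otimes> u" "inv g" f] right_translate_mult[OF g u'(1) layer_A[OF h]]
      right_translate_inverse(1)[OF g layer_A[OF f]] g u'(1) layer_A[OF f]
    by (simp add: right_translate_linear h_def)
  then show "right_translate G (g \<otimes> u \<otimes> inv g) f - f \<in> layer i"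
    using layer_right_translate[OF g u'(2)[OF h]] by simp
qed

lemma radical_group_one: "\<one> \<in> radical_group"
  using layer_subspace by (auto simp: radical_group_def right_translate_one layer_A fn.subspace_0)

lemma radical_group_inv:
  assumes u: "u \<in> radical_group"
  shows "inv u \<in> radical_group"
  unfolding radical_group_def
proof (intro CollectI conjI allI ballI)
  note u' = radical_groupD[OF u]
  show "inv u \<in> carrier G"
    using u' by simp
  fix i f assume f: "f \<in> layer (Suc i)"
  have "right_translate G (inv u) f - f = - right_translate G (inv u) (right_translate G u f - f)"
    using right_translate_inverse(2)[OF u'(1) layer_A[OF f]] by (simp add: right_translate_linear)
  also have "\<dots> \<in> layer i"
    using layer_right_translate[OF inv_closed[OF u'(1)] u'(2)[OF f]] layer_subspace
    by (simp add: fn.subspace_neg)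
  finally show "right_translate G (inv u) f - f \<in> layer i" .
qed

lemma radical_group_normal: "radical_group \<lhd> G"
  unfolding normal_inv_iff
proof (intro conjI ballI subgroupI)
  show "radical_group \<subseteq> carrier G"
    using radical_groupD(1) by blast
qed (use radical_group_one radical_group_mult radical_group_inv radical_group_conj in auto)

lemma radical_group_unipotent: "u \<in> radical_group \<Longrightarrow> unipotent G A u"
  using difference_locally_nilpotent by (simp add: unipotent_def locally_nilpotent_def)

text \<open>For a fixed function, a fixed word of operators and a fixed evaluation point, the
  defining condition is the vanishing of a regular function of \<open>u\<close>, so the complement
  is a union of principal open sets.\<close>

lemma radical_group_closed: "closedin (zariski (carrier G) A) radical_group"
proof -
  have top: "topspace (zariski (carrier G) A) = carrier G"
    by (rule topspace_zariski[OF A_closed(1)])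
  have "\<exists>E. openin (zariski (carrier G) A) E \<and> u \<in> E \<and> E \<subseteq> carrier G - radical_group"
    if u: "u \<in> carrier G - radical_group" for u
  proof -
    obtain i f where f: "f \<in> layer (Suc i)" "right_translate G u f - f \<notin> layer i"
      using u by (auto simp: radical_group_def)
    have fA: "f \<in> A" and fV: "f \<in> V"
      using layer_A[OF f(1)] layer_V[OF f(1)] .
    have "right_translate G u f - f \<in> V"
      using fn.endo_onD(1)[OF V_endo[OF left_invariant_difference] fV] u by blast
    then obtain Ds where Ds: "set Ds \<subseteq> radical" "length Ds = i" "word Ds (right_translate G u f - f) \<noteq> 0"
      using f(2) by (auto simp: flag_def)
    then obtain x where x: "word Ds (right_translate G u f - f) x \<noteq> 0"
      by (auto simp: fun_eq_iff fun_apply)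
    define T where "T = word Ds"
    have "fn.endo_on A T"
      unfolding T_def using Ds(1) radical_lie by (intro word_endo_on lie_endo) auto
    note T = fn.endo_onD[OF this] fn.endo_on_diff[OF this A_subspace] fn.endo_on_sum[OF this A_subspace]
    obtain n g h where "comult f n g h"
      using comult_exists[OF fA] by blast
    note gh = comultD[OF this]
    \<comment> \<open>\<open>T (right_translate G v f - f) x\<close> as a regular function of
      \<open>v\<close>, expanded by the comultiplication of \<open>f\<close>.\<close>
    define p where "p = (\<Sum>j<n. fscale (T (g j) x) (h j)) - fscale (T f x) unit"
    have p: "p \<in> A"
      unfolding p_def using gh(2)
      by (intro fn.subspace_diff[OF A_subspace] fn.subspace_sum[OF A_subspace] A_scale A_closed) auto
    have p_eq: "p v = T (right_translate G v f - f) x" if v: "v \<in> carrier G" for v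
    proof -
      have "right_translate G v f = (\<Sum>j<n. fscale (h j v) (g j))"
      proof
        fix y
        show "right_translate G v f y = (\<Sum>j<n. fscale (h j v) (g j)) y"
          using gh(3)[of y v] v A_outside[OF gh(1)]
          by (cases "y \<in> carrier G")
            (simp_all add: right_translate_apply translate_outside sum_fun_apply fun_apply mult.commute)
      qed
      then have "T (right_translate G v f) = (\<Sum>j<n. T (fscale (h j v) (g j)))"
        using gh(1) T(5)[of "{..<n}" "\<lambda>j. fscale (h j v) (g j)"] by (simp add: A_scale)
      also have "\<dots> = (\<Sum>j<n. fscale (h j v) (T (g j)))"
        using gh(1) by (intro sum.cong) (simp_all add: T(3))
      finally have "T (right_translate G v f) = (\<Sum>j<n. fscale (h j v) (T (g j)))" .
      moreover have "T (right_translate G v f - f) = T (right_translate G v f) - T f"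
        using right_translate_A[OF v fA] fA by (rule T(4))
      ultimately show ?thesis
        using v by (simp add: p_def sum_fun_apply fun_apply const_on_def mult.commute)
    qed
    have "p v = 0" if v: "v \<in> radical_group" for v
    proof -
      have "right_translate G v f - f \<in> layer i"
        by (rule radical_groupD(2)[OF v f(1)])
      then have "T (right_translate G v f - f) = 0"
        using Ds(1,2) by (simp add: flag_def T_def)
      then show ?thesis
        using p_eq[OF radical_groupD(1)[OF v]] by (simp add: fun_apply)
    qed
    moreover have "p u \<noteq> 0"
      using p_eq u x by (simp add: T_def)
    ultimately show ?thesis
      using u openin_zariski_basic[OF p, of "carrier G"]
      by (intro exI[of _ "{x \<in> carrier G. p x \<noteq> 0}"]) auto
  qed
  then have "openin (zariski (carrier G) A) (carrier G - radical_group)"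
    by (subst openin_subopen) blast
  then show ?thesis
    using radical_groupD(1) by (auto simp: closedin_def top)
qed

text \<open>The powers \<open>u\<^sup>t\<close> with \<open>t\<close> in the ground field form a line joining \<open>\<one>\<close> to \<open>u\<close>.\<close>

lemma radical_group_line:
  assumes u: "u \<in> radical_group"
  obtains w p where "\<And>t. w t \<in> radical_group" "w 0 = \<one>" "w 1 = u"
    "\<And>f t. f \<in> A \<Longrightarrow> f (w t) = poly (p f) t"
proof -
  note u' = radical_groupD(1)[OF u]
  define \<delta> :: "('g, 'k) operator" where "\<delta> = (\<lambda>f. right_translate G u f - f)"
  have nil: "locally_nilpotent \<delta>"
    unfolding \<delta>_def by (rule difference_locally_nilpotent[OF u])
  have \<delta>_0: "\<delta> 0 = 0"
    using nil left_invariant_0 by (simp add: locally_nilpotent_def)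
  define S where "S t = nil_sum (\<lambda>i. t gchoose i) \<delta>" for t
  \<comment> \<open>The binomial coefficient as a polynomial in its upper argument.\<close>
  define gch :: "nat \<Rightarrow> 'k poly" where "gch i = Polynomial.smult (1 / fact i) (\<Prod>j = 0..<i. [:- of_nat j, 1:])" for i
  have gch: "poly (gch i) t = t gchoose i" for i t
    by (simp add: gch_def gbinomial_prod_rev poly_prod)
  define P where "P f x = (\<Sum>i<(LEAST n. (\<delta> ^^ n) f = 0). Polynomial.smult ((\<delta> ^^ i) f x) (gch i))" for f x
  have P: "poly (P f x) t = S t f x" for f x t
    by (simp add: P_def S_def nil_sum_def poly_sum gch sum_fun_apply fun_apply mult.commute)
  have S_nat: "S (of_nat m) f = (right_translate G u ^^ m) f" if f: "f \<in> A" for m f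
  proof -
    obtain n where n: "(\<delta> ^^ n) f = 0"
      using nil f unfolding locally_nilpotent_def by blast
    show ?thesis
      unfolding S_def nil_sum_eq[where \<delta> = \<delta>, OF \<delta>_0 n]
      by (rule right_translate_funpow[OF u' f \<delta>_def n, symmetric])
  qed
  have R_mult: "(right_translate G u ^^ m) (f * g) = (right_translate G u ^^ m) f * (right_translate G u ^^ m) g" for m f g
    by (induction m) (simp_all add: right_translate_linear)
  have S_mult: "S t (f * g) = S t f * S t g" if fg: "f \<in> A" "g \<in> A" for t f g
  proof
    fix x
    \<comment> \<open>For natural exponents the series is an iterated right translation, hence
      multiplicative. A polynomial identity valid at all naturals is valid at every
      \<open>t\<close>.\<close>
    define q where "q = P (f * g) x - P f x * P g x"
    have "poly q (of_nat m) = 0" for m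
      using fg by (simp add: q_def P S_nat A_closed R_mult fun_apply)
    then have "range (of_nat :: nat \<Rightarrow> 'k) \<subseteq> {t. poly q t = 0}"
      by blast
    moreover have "infinite (range (of_nat :: nat \<Rightarrow> 'k))"
      by (simp add: range_inj_infinite inj_of_nat)
    ultimately have "q = 0"
      using poly_roots_finite[of q] finite_subset by blast
    then have "poly (P (f * g) x) t = poly (P f x * P g x) t"
      by (simp add: q_def)
    then show "S t (f * g) x = (S t f * S t g) x"
      by (simp add: P fun_apply)
  qed
  have "\<exists>v. v \<in> radical_group \<and> (\<forall>f\<in>A. S t f = right_translate G v f)" for t
  proof -
    obtain v where "v \<in> radical_group" "\<And>f. f \<in> A \<Longrightarrow> S t f = right_translate G v f"
    proof (rule nil_sum_in_radical_group[OF nil, of "\<lambda>i. t gchoose i"])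
      show "\<delta> unit = 0"
        by (simp add: \<delta>_def right_translate_unit[OF u'])
      show "t gchoose 0 = 1"
        by simp
      show "nil_sum (\<lambda>i. t gchoose i) \<delta> (f * g) = nil_sum (\<lambda>i. t gchoose i) \<delta> f * nil_sum (\<lambda>i. t gchoose i) \<delta> g"
        if "f \<in> A" "g \<in> A" for f g
        using S_mult[OF that, of t] unfolding S_def .
      show "\<delta> f \<in> layer i" if "f \<in> layer (Suc i)" for f i
        unfolding \<delta>_def by (rule radical_groupD(2)[OF u that])
    qed (auto simp: S_def)
    then show ?thesis
      by blast
  qed
  then obtain w where w: "\<And>t. w t \<in> radical_group" "\<And>t f. f \<in> A \<Longrightarrow> S t f = right_translate G (w t) f"
    by metis
  note w' = radical_groupD(1)[OF w(1)]
  have "w 0 = \<one>"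
    using S_nat[of _ 0] w(2)[of _ 0] by (intro right_translate_eqD w') (simp_all add: right_translate_one)
  moreover have "w 1 = u"
    using S_nat[of _ 1] w(2)[of _ 1] u' by (intro right_translate_eqD w') simp_all
  moreover have "f (w t) = poly (P f \<one>) t" if "f \<in> A" for f t
    using fun_cong[OF w(2)[OF that, of t], of \<one>] w'[of t] by (simp add: P right_translate_apply)
  ultimately show ?thesis
    using w(1) by (intro that[of w "\<lambda>f. P f \<one>"]) auto
qed

text \<open>An open set around the identity and one around \<open>u\<close> each contain the line
  joining the two points up to finitely many parameters, so they meet each other inside the
  group.\<close>

lemma radical_group_connected: "connectedin (zariski (carrier G) A) radical_group"
proof -
  let ?X = "zariski (carrier G) A"
  have meet: "E \<inter> E' \<inter> radical_group \<noteq> {}"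
    if E: "openin ?X E" "\<one> \<in> E" and E': "openin ?X E'" "u \<in> E'" and u: "u \<in> radical_group" for E E' u
  proof -
    have "\<exists>f\<in>A. f \<one> \<noteq> 0 \<and> {y \<in> carrier G. f y \<noteq> 0} \<subseteq> E"
      by (rule openin_zariski_nonvanishing[OF A_closed(1) _ E]) (rule A_closed(3))
    then obtain f where f: "f \<in> A" "f \<one> \<noteq> 0" "{y \<in> carrier G. f y \<noteq> 0} \<subseteq> E"
      by (elim bexE conjE)
    have "\<exists>g\<in>A. g u \<noteq> 0 \<and> {y \<in> carrier G. g y \<noteq> 0} \<subseteq> E'"
      by (rule openin_zariski_nonvanishing[OF A_closed(1) _ E']) (rule A_closed(3))
    then obtain g where g: "g \<in> A" "g u \<noteq> 0" "{y \<in> carrier G. g y \<noteq> 0} \<subseteq> E'"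
      by (elim bexE conjE)
    obtain w p where w: "\<And>t. w t \<in> radical_group" "w 0 = \<one>" "w 1 = u"
      "\<And>f t. f \<in> A \<Longrightarrow> f (w t) = poly (p f) t"
      using radical_group_line[OF u] by metis
    have "poly (p f) 0 \<noteq> 0" "poly (p g) 1 \<noteq> 0"
      using w(2,3) w(4)[OF f(1), of 0] w(4)[OF g(1), of 1] f(2) g(2) by simp_all
    then have "p f * p g \<noteq> 0"
      by auto
    then obtain t where "poly (p f * p g) t \<noteq> 0"
      using poly_all_0_iff_0 by blast
    then have "f (w t) \<noteq> 0" "g (w t) \<noteq> 0"
      using w(4)[OF f(1)] w(4)[OF g(1)] by simp_all
    then have "w t \<in> E \<inter> E' \<inter> radical_group"
      using f(3) g(3) w(1)[of t] radical_groupD(1)[OF w(1)] by blast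
    then show ?thesis
      by blast
  qed
  show ?thesis
    unfolding connectedin
  proof (intro conjI notI)
    show "radical_group \<subseteq> topspace ?X"
      using radical_groupD(1) by (auto simp: topspace_zariski[OF A_closed(1)])
    assume "\<exists>E1 E2. openin ?X E1 \<and> openin ?X E2 \<and> radical_group \<subseteq> E1 \<union> E2 \<and>
      E1 \<inter> E2 \<inter> radical_group = {} \<and> E1 \<inter> radical_group \<noteq> {} \<and> E2 \<inter> radical_group \<noteq> {}"
    then obtain E1 E2 where E: "openin ?X E1" "openin ?X E2" "radical_group \<subseteq> E1 \<union> E2"
      "E1 \<inter> E2 \<inter> radical_group = {}" "E1 \<inter> radical_group \<noteq> {}" "E2 \<inter> radical_group \<noteq> {}"
      by (elim exE conjE)
    show False
    proof (cases "\<one> \<in> E1")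
      case True
      obtain u where "u \<in> E2" "u \<in> radical_group"
        using E(6) by blast
      then show False
        using meet[OF E(1) True E(2)] E(4) by blast
    next
      case False
      then have 1: "\<one> \<in> E2"
        using E(3) radical_group_one by blast
      obtain u where "u \<in> E1" "u \<in> radical_group"
        using E(5) by blast
      then show False
        using meet[OF E(2) 1 E(1)] E(4) by blast
    qed
  qed
qed

theorem form_nondegenerate:
  assumes "connected_reductive_group G A" "D \<in> lie" "\<And>E. E \<in> lie \<Longrightarrow> form D E = 0"
  shows "D = 0"
proof (rule radical_eq_0)
  show "radical_group = {\<one>}"
    using assms(1) radical_group_normal radical_group_closed radical_group_connected radical_group_unipotent
    unfolding connected_reductive_group_def by blast
  show "D \<in> radical"
    using assms(2,3) by (simp add: radical_def)
qed

end

section \<open>Dominance of bilinear maps\<close>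

text \<open>Principal open sets form a base, so a point outside the closure of the image is
  separated from the image by a regular function.\<close>

lemma dominant_iff:
  fixes B :: "('b \<Rightarrow> 'k::field) set"
  assumes B: "const_on Y 1 \<in> B" "\<And>f g. f \<in> B \<Longrightarrow> g \<in> B \<Longrightarrow> f * g \<in> B" and \<phi>: "\<phi> ` X \<subseteq> Y"
  shows "dominant X Y B \<phi> \<longleftrightarrow> (\<forall>f\<in>B. (\<forall>x\<in>X. f (\<phi> x) = 0) \<longrightarrow> (\<forall>y\<in>Y. f y = 0))"
proof -
  have top: "topspace (zariski Y B) = Y"
    by (rule topspace_zariski[OF B(1)])
  show ?thesis
  proof
    assume dom: "dominant X Y B \<phi>"
    show "\<forall>f\<in>B. (\<forall>x\<in>X. f (\<phi> x) = 0) \<longrightarrow> (\<forall>y\<in>Y. f y = 0)"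
    proof (intro ballI impI, rule ccontr)
      fix f y assume f: "f \<in> B" "\<forall>x\<in>X. f (\<phi> x) = 0" and y: "y \<in> Y" "f y \<noteq> 0"
      have "y \<in> (zariski Y B) closure_of (\<phi> ` X)"
        using dom[unfolded dominant_def] y(1) by (rule ssubst)
      then have *: "\<forall>E. y \<in> E \<and> openin (zariski Y B) E \<longrightarrow> (\<exists>z. z \<in> \<phi> ` X \<and> z \<in> E)"
        unfolding in_closure_of by (rule conjunct2)
      have "y \<in> {y \<in> Y. f y \<noteq> 0}"
        using y by simp
      from *[rule_format, OF conjI[OF this openin_zariski_basic[OF f(1)]]]
      obtain z where "z \<in> \<phi> ` X" "z \<in> {y \<in> Y. f y \<noteq> 0}"
        by (elim exE conjE)
      then show False
        using f(2) by auto
    qed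
  next
    assume *: "\<forall>f\<in>B. (\<forall>x\<in>X. f (\<phi> x) = 0) \<longrightarrow> (\<forall>y\<in>Y. f y = 0)"
    have "y \<in> (zariski Y B) closure_of (\<phi> ` X)" if y: "y \<in> Y" for y
      unfolding in_closure_of top
    proof (intro conjI allI impI)
      fix E assume E: "y \<in> E \<and> openin (zariski Y B) E"
      have "\<exists>f\<in>B. f y \<noteq> 0 \<and> {z \<in> Y. f z \<noteq> 0} \<subseteq> E"
        by (rule openin_zariski_nonvanishing[OF B(1) _ conjunct2[OF E] conjunct1[OF E]]) (rule B(2))
      then obtain f where f: "f \<in> B" "f y \<noteq> 0" "{z \<in> Y. f z \<noteq> 0} \<subseteq> E"
        by (elim bexE conjE)
      then obtain x where x: "x \<in> X" "f (\<phi> x) \<noteq> 0"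
        using * y by meson
      then have "\<phi> x \<in> E"
        using f(3) \<phi> by blast
      then show "\<exists>z. z \<in> \<phi> ` X \<and> z \<in> E"
        using x(1) by blast
    qed (rule y)
    moreover have "(zariski Y B) closure_of (\<phi> ` X) \<subseteq> Y"
      using closure_of_subset_topspace[of "zariski Y B" "\<phi> ` X"] top by simp
    ultimately show "dominant X Y B \<phi>"
      unfolding dominant_def by blast
  qed
qed

section \<open>Bilinear maps in coordinates\<close>

lemma opr_linear_sum:
  fixes h :: "('g, 'k::field) operator \<Rightarrow> ('g, 'k) operator"
  assumes U: "opr.subspace U" and h: "\<And>c x y. x \<in> U \<Longrightarrow> y \<in> U \<Longrightarrow> h (scale c x + y) = scale c (h x) + h y"
    and b: "\<And>i. i \<in> I \<Longrightarrow> b i \<in> U"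
  shows "h (\<Sum>i\<in>I. scale (z i) (b i)) = (\<Sum>i\<in>I. scale (z i) (h (b i)))"
proof -
  have "h (scale (- 1) 0 + 0) = scale (- 1) (h 0) + h 0"
    by (rule h) (rule opr.subspace_0[OF U])+
  then have h_0: "h 0 = 0"
    by simp
  show ?thesis
    using b
  proof (induction I rule: infinite_finite_induct)
    case (insert i I)
    then have "(\<Sum>i\<in>I. scale (z i) (b i)) \<in> U"
      by (intro opr.subspace_sum[OF U] opr.subspace_scale[OF U]) auto
    then show ?case
      using insert by (simp add: h)
  qed (simp_all add: h_0)
qed

text \<open>The basis is numbered to match the variables of expressions, and the coordinates are
  linear forms in the sense of \<open>linear_forms\<close>, hence 0 outside
  \<open>W\<close>.\<close>

lemma opr_coordinates:
  assumes "opr.subspace W" "\<exists>T. finite T \<and> W \<subseteq> opr.span T"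
  obtains m e \<kappa> where "\<And>k. k < m \<Longrightarrow> e k \<in> W" "\<And>k. k < m \<Longrightarrow> \<kappa> k \<in> linear_forms W"
    "\<And>w. w \<in> W \<Longrightarrow> w = (\<Sum>k<m. scale (\<kappa> k w) (e k))"
    "\<And>c k. k < (m::nat) \<Longrightarrow> \<kappa> k (\<Sum>j<m. scale (c j) (e j)) = c k"
proof -
  obtain T where T: "finite T" "W \<subseteq> opr.span T"
    using assms(2) by blast
  obtain B where B: "finite B" "opr.independent B" "opr.span B = W"
    using opr.finite_basis[OF assms(1) T(2,1)] by metis
  define m where "m = card B"
  obtain e where e: "bij_betw e {..<m} B"
    using ex_bij_betw_nat_finite[OF B(1)] by (auto simp: m_def atLeast0LessThan)
  have eB: "e k \<in> B" if "k < m" for k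
    using e that by (auto simp: bij_betw_def)
  have eW: "e k \<in> W" if "k < m" for k
    using opr.span_base[OF eB[OF that]] B(3) by simp
  define \<kappa> where "\<kappa> k w = (if w \<in> W then opr.representation B w (e k) else 0)" for k w
  have add: "\<kappa> k (w + w') = \<kappa> k w + \<kappa> k w'" if "w \<in> W" "w' \<in> W" for k w w'
    using that assms(1) B by (simp add: \<kappa>_def opr.subspace_add opr.representation_add)
  have scale: "\<kappa> k (scale c w) = c * \<kappa> k w" if "w \<in> W" for k c w
    using that assms(1) B by (simp add: \<kappa>_def opr.subspace_scale opr.representation_scale)
  have forms: "\<kappa> k \<in> linear_forms W" for k
    using add scale by (auto simp: linear_forms_def functions_on_def \<kappa>_def)
  have expand: "w = (\<Sum>k<m. scale (\<kappa> k w) (e k))" if "w \<in> W" for w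
  proof -
    have "w = (\<Sum>b\<in>B. scale (opr.representation B w b) b)"
      using opr.sum_representation_eq[OF B(2) _ B(1), of w] that B(3) by simp
    also have "\<dots> = (\<Sum>k<m. scale (opr.representation B w (e k)) (e k))"
      by (rule sum.reindex_bij_betw[OF e, symmetric])
    finally show ?thesis
      using that by (simp add: \<kappa>_def)
  qed
  have "\<kappa> k (\<Sum>j<m. scale (c j) (e j)) = c k" if k: "k < m" for c k
  proof -
    have 0: "\<kappa> k 0 = 0"
      using scale[OF opr.subspace_0[OF assms(1)], of k 0] by simp
    have "\<kappa> k (\<Sum>j\<in>J. scale (c j) (e j)) = (\<Sum>j\<in>J. c j * \<kappa> k (e j))" if "J \<subseteq> {..<m}" for J
      using finite_subset[OF that finite_lessThan] that
    proof (induction J rule: finite_induct)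
      case (insert j J)
      have "scale (c j) (e j) \<in> W" "(\<Sum>j\<in>J. scale (c j) (e j)) \<in> W"
        using insert.prems eW assms(1) by (auto intro!: opr.subspace_sum opr.subspace_scale)
      then show ?case
        using insert eW by (simp add: add scale)
    qed (simp add: 0)
    then have "\<kappa> k (\<Sum>j<m. scale (c j) (e j)) = (\<Sum>j<m. c j * \<kappa> k (e j))"
      by blast
    also have "\<dots> = (\<Sum>j<m. if j = k then c k else 0)"
    proof (intro sum.cong refl)
      fix j assume "j \<in> {..<m}"
      then have j: "j < m"
        by simp
      have "e j = e k \<longleftrightarrow> j = k"
        using e j k by (auto simp: bij_betw_def inj_on_def)
      then show "c j * \<kappa> k (e j) = (if j = k then c k else 0)"
        using eW[OF j] B(2) eB[OF j] by (auto simp: \<kappa>_def opr.representation_basis)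
    qed
    finally show ?thesis
      using k by simp
  qed
  then show ?thesis
    using eW forms expand by (intro that[of m e \<kappa>]) blast+
qed

lemma polynomial_function_expression:
  fixes \<kappa> :: "nat \<Rightarrow> ('g, 'k::field) operator \<Rightarrow> 'k"
  assumes e: "\<And>k. k < m \<Longrightarrow> e k \<in> W" and W: "opr.subspace W"
    and expand: "\<And>w. w \<in> W \<Longrightarrow> w = (\<Sum>k<m. scale (\<kappa> k w) (e k))"
    and f: "f \<in> polynomial_functions W"
  shows "\<exists>p. pvars p \<subseteq> {..<m} \<and> (\<forall>w\<in>W. f w = ev id (\<lambda>k. \<kappa> k w) p)"
  using f unfolding polynomial_functions_def
proof induction
  case (generator l)
  have add: "\<And>D E. D \<in> W \<Longrightarrow> E \<in> W \<Longrightarrow> l (D + E) = l D + l E"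
    and sc: "\<And>c D. D \<in> W \<Longrightarrow> l (scale c D) = c * l D"
    using generator by (auto simp: linear_forms_def)
  have 0: "l 0 = 0"
    using sc[OF opr.subspace_0[OF W], of 0] by simp
  have sum: "l (\<Sum>j\<in>J. scale (c j) (e j)) = (\<Sum>j\<in>J. c j * l (e j))" if "J \<subseteq> {..<m}" for J c
    using finite_subset[OF that finite_lessThan] that
  proof (induction J rule: finite_induct)
    case (insert j J)
    have "scale (c j) (e j) \<in> W" "(\<Sum>j\<in>J. scale (c j) (e j)) \<in> W"
      using insert.prems e W by (auto intro!: opr.subspace_sum opr.subspace_scale)
    then show ?case
      using insert e by (simp add: add sc)
  qed (simp add: 0)
  define p where "p = psum (\<lambda>k. Mul (Con (l (e k))) (Var k)) {..<m}"
  have "l w = ev id (\<lambda>k. \<kappa> k w) p" if "w \<in> W" for w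
  proof -
    have "l w = l (\<Sum>k<m. scale (\<kappa> k w) (e k))"
      using expand[OF that] by simp
    also have "\<dots> = (\<Sum>k<m. \<kappa> k w * l (e k))"
      by (rule sum) simp
    finally show ?thesis
      by (simp add: p_def ev_psum mult.commute)
  qed
  moreover have "pvars p \<subseteq> {..<m}"
    by (auto simp: p_def pvars_psum)
  ultimately show ?case
    by blast
next
  case (const c)
  show ?case
    by (intro exI[of _ "Con c"]) (simp add: const_on_def)
next
  case (add f g)
  then obtain p q where "pvars p \<subseteq> {..<m}" "\<forall>w\<in>W. f w = ev id (\<lambda>k. \<kappa> k w) p"
    "pvars q \<subseteq> {..<m}" "\<forall>w\<in>W. g w = ev id (\<lambda>k. \<kappa> k w) q"
    by (elim exE conjE)
  then show ?case
    by (intro exI[of _ "Add p q"]) (simp add: fun_apply id_def)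
next
  case (mult f g)
  then obtain p q where "pvars p \<subseteq> {..<m}" "\<forall>w\<in>W. f w = ev id (\<lambda>k. \<kappa> k w) p"
    "pvars q \<subseteq> {..<m}" "\<forall>w\<in>W. g w = ev id (\<lambda>k. \<kappa> k w) q"
    by (elim exE conjE)
  then show ?case
    by (intro exI[of _ "Mul p q"]) (simp add: fun_apply id_def)
qed

lemma expression_polynomial_function:
  fixes \<kappa> :: "nat \<Rightarrow> ('g, 'k::field) operator \<Rightarrow> 'k"
  assumes "\<And>k. k < m \<Longrightarrow> \<kappa> k \<in> linear_forms W" "pvars p \<subseteq> {..<m}"
  shows "(\<lambda>w. if w \<in> W then ev id (\<lambda>k. \<kappa> k w) p else 0) \<in> polynomial_functions W"
  using assms(2)
proof (induction p)
  case (Var k)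
  then have \<kappa>: "\<kappa> k \<in> linear_forms W"
    using assms(1) by simp
  have "(\<lambda>w. if w \<in> W then ev id (\<lambda>k. \<kappa> k w) (Var k) else 0) = \<kappa> k"
    using \<kappa> by (auto simp: linear_forms_def functions_on_def)
  then show ?case
    using \<kappa> by (simp add: polynomial_functions_def generated_algebra.generator)
next
  case (Con c)
  have "(\<lambda>w. if w \<in> W then ev id (\<lambda>k. \<kappa> k w) (Con c) else 0) = const_on W c"
    by (auto simp: const_on_def)
  then show ?case
    by (simp add: polynomial_functions_def generated_algebra.const)
next
  case (Add p q)
  have "(\<lambda>w. if w \<in> W then ev id (\<lambda>k. \<kappa> k w) (Add p q) else 0) =
      (\<lambda>w. if w \<in> W then ev id (\<lambda>k. \<kappa> k w) p else 0) + (\<lambda>w. if w \<in> W then ev id (\<lambda>k. \<kappa> k w) q else 0)"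
    by (auto simp: fun_apply fun_eq_iff)
  moreover have "\<dots> \<in> polynomial_functions W"
    unfolding polynomial_functions_def
    by (rule generated_algebra.add) (use Add in \<open>simp_all add: polynomial_functions_def\<close>)
  ultimately show ?case
    by simp
next
  case (Mul p q)
  have "(\<lambda>w. if w \<in> W then ev id (\<lambda>k. \<kappa> k w) (Mul p q) else 0) =
      (\<lambda>w. if w \<in> W then ev id (\<lambda>k. \<kappa> k w) p else 0) * (\<lambda>w. if w \<in> W then ev id (\<lambda>k. \<kappa> k w) q else 0)"
    by (auto simp: fun_apply fun_eq_iff)
  moreover have "\<dots> \<in> polynomial_functions W"
    unfolding polynomial_functions_def
    by (rule generated_algebra.mult) (use Mul in \<open>simp_all add: polynomial_functions_def\<close>)
  ultimately show ?case
    by simp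
qed

text \<open>In coordinates a bilinear map is given by quadratic expressions, to which both
  directions of the Jacobian criterion apply. The right-hand side is the product rule for its
  differential at \<open>(x, y)\<close>.\<close>

lemma dominant_bilinear_iff:
  fixes \<beta> :: "('g, 'k::field_char_0) operator \<Rightarrow> ('g, 'k) operator \<Rightarrow> ('g, 'k) operator"
  assumes U1: "opr.subspace U1" "\<exists>T. finite T \<and> U1 \<subseteq> opr.span T"
    and U2: "opr.subspace U2" "\<exists>T. finite T \<and> U2 \<subseteq> opr.span T"
    and W: "opr.subspace W" "\<exists>T. finite T \<and> W \<subseteq> opr.span T"
    and \<beta>: "\<And>x y. x \<in> U1 \<Longrightarrow> y \<in> U2 \<Longrightarrow> \<beta> x y \<in> W"
    and left: "\<And>c x x' y. x \<in> U1 \<Longrightarrow> x' \<in> U1 \<Longrightarrow> y \<in> U2 \<Longrightarrow> \<beta> (scale c x + x') y = scale c (\<beta> x y) + \<beta> x' y"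
    and right: "\<And>c x y y'. x \<in> U1 \<Longrightarrow> y \<in> U2 \<Longrightarrow> y' \<in> U2 \<Longrightarrow> \<beta> x (scale c y + y') = scale c (\<beta> x y) + \<beta> x y'"
  shows "dominant (U1 \<times> U2) W (polynomial_functions W) (\<lambda>(x, y). \<beta> x y) \<longleftrightarrow>
    (\<exists>x\<in>U1. \<exists>y\<in>U2. \<forall>w\<in>W. \<exists>\<xi>\<in>U1. \<exists>\<eta>\<in>U2. \<beta> x \<eta> + \<beta> \<xi> y = w)"
proof -
  obtain p b1 x1 where b1: "\<And>i. i < p \<Longrightarrow> b1 i \<in> U1" and x1: "\<And>w. w \<in> U1 \<Longrightarrow> w = (\<Sum>i<(p::nat). scale (x1 i w) (b1 i))"
    by (rule opr_coordinates[OF U1]) blast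
  obtain q b2 x2 where b2: "\<And>i. i < q \<Longrightarrow> b2 i \<in> U2" and x2: "\<And>w. w \<in> U2 \<Longrightarrow> w = (\<Sum>i<(q::nat). scale (x2 i w) (b2 i))"
    by (rule opr_coordinates[OF U2]) blast
  obtain m e \<kappa> where e: "\<And>k. k < m \<Longrightarrow> e k \<in> W" and \<kappa>: "\<And>k. k < m \<Longrightarrow> \<kappa> k \<in> linear_forms W"
    and expand: "\<And>w. w \<in> W \<Longrightarrow> w = (\<Sum>k<m. scale (\<kappa> k w) (e k))"
    and coord: "\<And>c k. k < (m::nat) \<Longrightarrow> \<kappa> k (\<Sum>j<m. scale (c j) (e j)) = c k"
    by (rule opr_coordinates[OF W]) blast
  \<comment> \<open>Variables below \<open>p\<close> are coordinates on \<open>U1\<close>, the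
    following \<open>q\<close> are coordinates on \<open>U2\<close>.\<close>
  define n where "n = p + q"
  define X where "X z = (\<Sum>i<p. scale (z i) (b1 i))" for z
  define Y where "Y z = (\<Sum>j<q. scale (z (p + j)) (b2 j))" for z
  have XU: "X z \<in> U1" and YU: "Y z \<in> U2" for z
    unfolding X_def Y_def using b1 b2
    by (auto intro!: opr.subspace_sum opr.subspace_scale U1(1) U2(1))
  have point: "\<exists>z. X z = x \<and> Y z = y" if "x \<in> U1" "y \<in> U2" for x y
  proof -
    define z where "z i = (if i < p then x1 i x else x2 (i - p) y)" for i
    have "X z = x" "Y z = y"
      using x1[OF that(1)] x2[OF that(2)] by (simp_all add: X_def Y_def z_def)
    then show ?thesis
      by blast
  qed
  define I where "I = {..<p} \<times> {..<q}"
  have finI: "finite I"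
    by (simp add: I_def)
  define \<beta>' where "\<beta>' s = \<beta> (b1 (fst s)) (b2 (snd s))" for s
  have \<beta>W: "\<beta>' s \<in> W" if "s \<in> I" for s
    using that b1 b2 \<beta> by (auto simp: I_def \<beta>'_def)
  have \<beta>_XY: "\<beta> (X z) (Y v) = (\<Sum>s\<in>I. scale (z (fst s) * v (p + snd s)) (\<beta>' s))" for z v
  proof -
    have "\<beta> (X z) (Y v) = (\<Sum>i<p. scale (z i) (\<beta> (b1 i) (Y v)))"
      unfolding X_def using left YU b1 by (intro opr_linear_sum[OF U1(1), of "\<lambda>x. \<beta> x (Y v)"]) auto
    also have "\<dots> = (\<Sum>i<p. scale (z i) (\<Sum>j<q. scale (v (p + j)) (\<beta> (b1 i) (b2 j))))"
    proof (intro sum.cong refl)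
      fix i assume "i \<in> {..<p}"
      then have "b1 i \<in> U1"
        using b1 by simp
      then have "\<beta> (b1 i) (Y v) = (\<Sum>j<q. scale (v (p + j)) (\<beta> (b1 i) (b2 j)))"
        unfolding Y_def using right b2 by (intro opr_linear_sum[OF U2(1), of "\<beta> (b1 i)"]) auto
      then show "scale (z i) (\<beta> (b1 i) (Y v)) = scale (z i) (\<Sum>j<q. scale (v (p + j)) (\<beta> (b1 i) (b2 j)))"
        by simp
    qed
    also have "\<dots> = (\<Sum>s\<in>I. scale (z (fst s) * v (p + snd s)) (\<beta>' s))"
      by (simp add: I_def \<beta>'_def opr.scale_sum_right sum.cartesian_product case_prod_unfold)
    finally show ?thesis .
  qed
  have \<kappa>_add: "\<kappa> k (w + w') = \<kappa> k w + \<kappa> k w'" and \<kappa>_scale: "\<kappa> k (scale c w) = c * \<kappa> k w"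
    if "k < m" "w \<in> W" "w' \<in> W" for k w w' c
    using \<kappa>[OF that(1)] that(2,3) by (auto simp: linear_forms_def)
  have \<kappa>_sum: "\<kappa> k (\<Sum>s\<in>J. scale (a s) (\<beta>' s)) = (\<Sum>s\<in>J. a s * \<kappa> k (\<beta>' s))"
    if k: "k < m" and J: "J \<subseteq> I" for k J a
    using finite_subset[OF J finI] J
  proof (induction J rule: finite_induct)
    case empty
    then show ?case
      using \<kappa>_scale[OF k opr.subspace_0[OF W(1)] opr.subspace_0[OF W(1)], of 0] by simp
  next
    case (insert s J)
    have "\<beta>' t \<in> W" if "t \<in> insert s J" for t
      using insert.prems that by (intro \<beta>W) blast
    then have "(\<Sum>s\<in>J. scale (a s) (\<beta>' s)) \<in> W" "scale (a s) (\<beta>' s) \<in> W" "\<beta>' s \<in> W"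
      by (simp_all add: opr.subspace_sum[OF W(1)] opr.subspace_scale[OF W(1)])
    then show ?case
      using insert by (simp add: \<kappa>_add[OF k] \<kappa>_scale[OF k])
  qed
  define P where "P k = psum (\<lambda>s. Mul (Con (\<kappa> k (\<beta>' s))) (Mul (Var (fst s)) (Var (p + snd s)))) I" for k
  have P_vars: "pvars (P k) \<subseteq> {..<n}" for k
    using finI by (auto simp: P_def pvars_psum I_def n_def)
  have ev_P: "ev id z (P k) = \<kappa> k (\<beta> (X z) (Y z))" if "k < m" for k z
    using finI \<kappa>_sum[OF that subset_refl]
    by (simp add: P_def ev_psum \<beta>_XY mult.commute mult.left_commute)
  \<comment> \<open>Along the line \<open>z + t * v\<close> the coefficient of \<open>t\<close>
    collects the two mixed terms of the bilinear expression.\<close>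
  have jac_P: "jac P n z v k = \<kappa> k (\<beta> (X z) (Y v) + \<beta> (X v) (Y z))" if k: "k < m" for k z v
  proof -
    have "jac P n z v k = coeff (ev (\<lambda>c. [:c:]) (\<lambda>l. [:z l, v l:]) (P k)) 1"
      using coeff_1_ev[of "{..<n}" "P k" id "\<lambda>l. [:z l, v l:]"] P_vars[of k] by (simp add: jac_def)
    also have "\<dots> = (\<Sum>s\<in>I. (z (fst s) * v (p + snd s)) * \<kappa> k (\<beta>' s)) + (\<Sum>s\<in>I. (v (fst s) * z (p + snd s)) * \<kappa> k (\<beta>' s))"
      using finI by (simp add: P_def ev_psum coeff_sum algebra_simps flip: sum.distrib)
    also have "\<dots> = \<kappa> k (\<beta> (X z) (Y v)) + \<kappa> k (\<beta> (X v) (Y z))"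
      using \<kappa>_sum[OF k subset_refl] by (simp add: \<beta>_XY)
    also have "\<dots> = \<kappa> k (\<beta> (X z) (Y v) + \<beta> (X v) (Y z))"
      using \<kappa>_add[OF k] \<beta>[OF XU YU] by simp
    finally show ?thesis .
  qed
  have W_eqI: "w = w'" if "w \<in> W" "w' \<in> W" "\<And>k. k < m \<Longrightarrow> \<kappa> k w = \<kappa> k w'" for w w'
  proof -
    have "(\<Sum>k<m. scale (\<kappa> k w) (e k)) = (\<Sum>k<m. scale (\<kappa> k w') (e k))"
      using that(3) by simp
    then show ?thesis
      using expand[OF that(1)] expand[OF that(2)] by simp
  qed
  have surj_iff: "jac_surj P n m z \<longleftrightarrow> (\<forall>w\<in>W. \<exists>\<xi>\<in>U1. \<exists>\<eta>\<in>U2. \<beta> (X z) \<eta> + \<beta> \<xi> (Y z) = w)" for z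
  proof
    assume surj: "jac_surj P n m z"
    show "\<forall>w\<in>W. \<exists>\<xi>\<in>U1. \<exists>\<eta>\<in>U2. \<beta> (X z) \<eta> + \<beta> \<xi> (Y z) = w"
    proof
      fix w assume w: "w \<in> W"
      obtain v where v: "\<forall>k<m. jac P n z v k = \<kappa> k w"
        using spec[OF surj[unfolded jac_surj_def], of "\<lambda>k. \<kappa> k w"] by (rule exE)
      have "\<beta> (X z) (Y v) + \<beta> (X v) (Y z) = w"
        using v jac_P w \<beta>[OF XU YU] by (intro W_eqI opr.subspace_add[OF W(1)]) auto
      then show "\<exists>\<xi>\<in>U1. \<exists>\<eta>\<in>U2. \<beta> (X z) \<eta> + \<beta> \<xi> (Y z) = w"
        using XU YU by blast
    qed
  next
    assume surj: "\<forall>w\<in>W. \<exists>\<xi>\<in>U1. \<exists>\<eta>\<in>U2. \<beta> (X z) \<eta> + \<beta> \<xi> (Y z) = w"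
    show "jac_surj P n m z"
      unfolding jac_surj_def
    proof
      fix c
      have "(\<Sum>k<m. scale (c k) (e k)) \<in> W"
        using e by (auto intro!: opr.subspace_sum opr.subspace_scale W(1))
      then obtain \<xi> \<eta> where \<xi>: "\<xi> \<in> U1" "\<eta> \<in> U2" "\<beta> (X z) \<eta> + \<beta> \<xi> (Y z) = (\<Sum>k<m. scale (c k) (e k))"
        using surj by meson
      obtain v where "X v = \<xi>" "Y v = \<eta>"
        using point[OF \<xi>(1,2)] by blast
      then have "\<forall>k<m. jac P n z v k = c k"
        using \<xi>(3) jac_P coord by simp
      then show "\<exists>v. \<forall>k<m. jac P n z v k = c k"
        by blast
    qed
  qed
  have 1: "(\<exists>z. jac_surj P n m z) \<longleftrightarrow>
      (\<exists>x\<in>U1. \<exists>y\<in>U2. \<forall>w\<in>W. \<exists>\<xi>\<in>U1. \<exists>\<eta>\<in>U2. \<beta> x \<eta> + \<beta> \<xi> y = w)"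
    unfolding surj_iff
  proof
    assume "\<exists>z. \<forall>w\<in>W. \<exists>\<xi>\<in>U1. \<exists>\<eta>\<in>U2. \<beta> (X z) \<eta> + \<beta> \<xi> (Y z) = w"
    then show "\<exists>x\<in>U1. \<exists>y\<in>U2. \<forall>w\<in>W. \<exists>\<xi>\<in>U1. \<exists>\<eta>\<in>U2. \<beta> x \<eta> + \<beta> \<xi> y = w"
      by (elim exE) (rule bexI[OF bexI[OF _ YU] XU])
  next
    assume "\<exists>x\<in>U1. \<exists>y\<in>U2. \<forall>w\<in>W. \<exists>\<xi>\<in>U1. \<exists>\<eta>\<in>U2. \<beta> x \<eta> + \<beta> \<xi> y = w"
    then obtain x y where xy: "x \<in> U1" "y \<in> U2" "\<forall>w\<in>W. \<exists>\<xi>\<in>U1. \<exists>\<eta>\<in>U2. \<beta> x \<eta> + \<beta> \<xi> y = w"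
      by (elim bexE)
    obtain z where "X z = x" "Y z = y"
      using point[OF xy(1,2)] by blast
    then show "\<exists>z. \<forall>w\<in>W. \<exists>\<xi>\<in>U1. \<exists>\<eta>\<in>U2. \<beta> (X z) \<eta> + \<beta> \<xi> (Y z) = w"
      using xy(3) by (intro exI[of _ z]) simp
  qed
  have 2: "dominant (U1 \<times> U2) W (polynomial_functions W) (\<lambda>(x, y). \<beta> x y) \<longleftrightarrow>
      (\<forall>f\<in>polynomial_functions W. (\<forall>s\<in>U1 \<times> U2. f (case s of (x, y) \<Rightarrow> \<beta> x y) = 0) \<longrightarrow> (\<forall>w\<in>W. f w = 0))"
    using \<beta> by (intro dominant_iff) (auto simp: polynomial_functions_def generated_algebra.const generated_algebra.mult)
  \<comment> \<open>If the differential were nowhere onto, a relation among the components, read as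
    a regular function on \<open>W\<close>, would vanish on the image without being zero.\<close>
  have forth: "\<exists>z. jac_surj P n m z"
    if *: "\<forall>f\<in>polynomial_functions W. (\<forall>s\<in>U1 \<times> U2. f (case s of (x, y) \<Rightarrow> \<beta> x y) = 0) \<longrightarrow> (\<forall>w\<in>W. f w = 0)"
  proof (rule ccontr)
    assume "\<not> (\<exists>z. jac_surj P n m z)"
    then have no: "\<And>z. \<not> jac_surj P n m z"
      by blast
    obtain E x where E: "pvars E \<subseteq> {..<m}" "ev id x E \<noteq> 0"
      "\<And>z. ev id (\<lambda>k. ev id z (P k)) E = 0"
      by (rule not_jac_surj_imp_dependent[OF P_vars no]) (erule that, assumption, blast)
    define f where "f = (\<lambda>w. if w \<in> W then ev id (\<lambda>k. \<kappa> k w) E else 0)"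
    have f: "f \<in> polynomial_functions W"
      unfolding f_def by (rule expression_polynomial_function[OF \<kappa> E(1)])
    have "f (\<beta> x y) = 0" if xy: "x \<in> U1" "y \<in> U2" for x y
    proof -
      obtain z where z: "X z = x" "Y z = y"
        using point[OF xy] by blast
      have "ev id (\<lambda>k. \<kappa> k (\<beta> x y)) E = ev id (\<lambda>k. ev id z (P k)) E"
        using E(1) ev_P z by (intro ev_cong) auto
      then show ?thesis
        using E(3) by (simp add: f_def)
    qed
    then have "\<forall>s\<in>U1 \<times> U2. f (case s of (x, y) \<Rightarrow> \<beta> x y) = 0"
      by (simp add: case_prod_unfold mem_Times_iff)
    then have zero: "\<forall>w\<in>W. f w = 0"
      by (rule mp[OF bspec[OF * f]])
    define w where "w = (\<Sum>k<m. scale (x k) (e k))"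
    have w: "w \<in> W"
      unfolding w_def using e by (auto intro!: opr.subspace_sum opr.subspace_scale W(1))
    have "ev id (\<lambda>k. \<kappa> k w) E = ev id x E"
      using E(1) coord by (intro ev_cong) (auto simp: w_def)
    then show False
      using zero w E(2) by (auto simp: f_def)
  qed
  \<comment> \<open>A regular function vanishing on the image is a relation among the components,
    and a surjective differential forces it to be zero.\<close>
  have converse: "\<forall>w\<in>W. f w = 0"
    if z: "jac_surj P n m z" and f: "f \<in> polynomial_functions W"
      and van: "\<forall>s\<in>U1 \<times> U2. f (case s of (x, y) \<Rightarrow> \<beta> x y) = 0" for f z
  proof -
    have "\<exists>E. pvars E \<subseteq> {..<m} \<and> (\<forall>w\<in>W. f w = ev id (\<lambda>k. \<kappa> k w) E)"
      by (rule polynomial_function_expression[where e = e, OF _ W(1) _ f])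
        (rule e, assumption, rule expand, assumption)
    then obtain E where E: "pvars E \<subseteq> {..<m}" "\<forall>w\<in>W. f w = ev id (\<lambda>k. \<kappa> k w) E"
      by (elim exE conjE)
    have "ev id (\<lambda>k. ev id z (P k)) E = 0" for z
    proof -
      have "ev id (\<lambda>k. ev id z (P k)) E = ev id (\<lambda>k. \<kappa> k (\<beta> (X z) (Y z))) E"
        using E(1) ev_P by (intro ev_cong) auto
      also have "\<dots> = f (\<beta> (X z) (Y z))"
        using E(2) \<beta>[OF XU YU] by simp
      also have "\<dots> = 0"
        using van XU YU by auto
      finally show ?thesis .
    qed
    then have "ev id (\<lambda>k. \<kappa> k w) E = 0" for w
      by (rule jac_surj_imp_independent[OF z P_vars E(1)])
    then show ?thesis
      using E(2) by simp
  qed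
  have 3: "(\<forall>f\<in>polynomial_functions W. (\<forall>s\<in>U1 \<times> U2. f (case s of (x, y) \<Rightarrow> \<beta> x y) = 0) \<longrightarrow> (\<forall>w\<in>W. f w = 0))
      \<longleftrightarrow> (\<exists>z. jac_surj P n m z)"
  proof (rule iffI)
    assume "\<exists>z. jac_surj P n m z"
    then show "\<forall>f\<in>polynomial_functions W. (\<forall>s\<in>U1 \<times> U2. f (case s of (x, y) \<Rightarrow> \<beta> x y) = 0) \<longrightarrow> (\<forall>w\<in>W. f w = 0)"
      by (elim exE) (rule ballI, rule impI, rule converse)
  qed (rule forth)
  show ?thesis
    by (rule trans[OF 2 trans[OF 3 1]])
qed

section \<open>Involutions\<close>

context alg_group
begin

lemma lie_bracket_bilinear:
  assumes "D \<in> lie_algebra G A" "D' \<in> lie_algebra G A" "E \<in> lie_algebra G A"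
  shows "lie_bracket (scale c D + D') E = scale c (lie_bracket D E) + lie_bracket D' E"
    and "lie_bracket E (scale c D + D') = scale c (lie_bracket E D) + lie_bracket E D'"
proof -
  have E: "E (fscale c (D f) + D' f) = fscale c (E (D f)) + E (D' f)" for f
    using fn.endo_onD(2,3)[OF lie_endo[OF assms(3)]] lie_A[OF assms(1)] lie_A[OF assms(2)] A_scale
    by simp
  show "lie_bracket (scale c D + D') E = scale c (lie_bracket D E) + lie_bracket D' E"
    by (rule ext) (simp add: lie_bracket_def op_apply E fn.scale_right_diff_distrib)
  show "lie_bracket E (scale c D + D') = scale c (lie_bracket E D) + lie_bracket E D'"
    by (rule ext) (simp add: lie_bracket_def op_apply E fn.scale_right_diff_distrib)
qed

lemma lie_eqI:
  assumes "D \<in> lie_algebra G A" "E \<in> lie_algebra G A" "\<And>f. f \<in> A \<Longrightarrow> D f = E f"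
  shows "D = E"
  using assms lieD(1) by (metis ext)

lemma lie_bracket_comm: "lie_bracket D E = - lie_bracket E D"
  by (rule ext) (simp add: lie_bracket_def op_apply)

context
  fixes \<sigma>
  assumes \<sigma>: "group_involution G A \<sigma>"
begin

lemma involution_carrier: "x \<in> carrier G \<Longrightarrow> \<sigma> x \<in> carrier G"
  and involution_mult: "x \<in> carrier G \<Longrightarrow> y \<in> carrier G \<Longrightarrow> \<sigma> (x \<otimes> y) = \<sigma> x \<otimes> \<sigma> y"
  and involution_twice: "x \<in> carrier G \<Longrightarrow> \<sigma> (\<sigma> x) = x"
  using \<sigma> by (auto simp: group_involution_def hom_def)

lemma involution_inv: "x \<in> carrier G \<Longrightarrow> \<sigma> (inv x) = inv (\<sigma> x)"
proof -
  assume x: "x \<in> carrier G"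
  have "\<sigma> \<one> = \<one>"
    using \<sigma> hom_one[OF _ group_axioms group_axioms] by (auto simp: group_involution_def)
  then have "\<sigma> (inv x) \<otimes> \<sigma> x = \<one>"
    using involution_mult[of "inv x" x] x by simp
  then show "\<sigma> (inv x) = inv (\<sigma> x)"
    using x by (intro inv_equality[symmetric]) (auto intro: involution_carrier)
qed

abbreviation (input) sig :: "('g \<Rightarrow> 'k) \<Rightarrow> 'g \<Rightarrow> 'k" where
  "sig \<equiv> pullback (carrier G) \<sigma>"

lemma sig_A: "f \<in> A \<Longrightarrow> sig f \<in> A"
  using \<sigma> by (simp add: group_involution_def variety_morphism_def)

lemma sig_linear:
  "sig (f + g) = sig f + sig g" "sig (f - g) = sig f - sig g"
  "sig (fscale c f) = fscale c (sig f)" "sig (f * g) = sig f * sig g"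
  by (auto simp: pullback_def fun_eq_iff fun_apply)

lemma sig_twice: "f \<in> A \<Longrightarrow> sig (sig f) = f"
  using involution_carrier involution_twice
  by (intro A_eqI) (auto simp: sig_A, auto simp: pullback_def)

lemma sig_endo: "fn.endo_on A sig"
  by (simp add: fn.endo_on_def sig_A sig_linear)

lemma sig_left_translate:
  assumes "g \<in> carrier G"
  shows "sig (left_translate G g f) = left_translate G (\<sigma> g) (sig f)"
  using assms involution_carrier involution_twice
  by (auto simp: fun_eq_iff left_translate_def pullback_def involution_mult involution_inv)

lemma sig_conjugate_left_invariant:
  assumes T: "left_invariant T"
  shows "left_invariant (\<lambda>f. sig (T (sig f)))"
  unfolding left_invariant_def
proof (intro conjI ballI)
  show "fn.endo_on A (\<lambda>f. sig (T (sig f)))"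
    using sig_endo left_invariantD(1)[OF T] by (simp add: fn.endo_on_def)
  fix g f assume "g \<in> carrier G" "f \<in> A"
  then show "sig (T (sig (left_translate G g f))) = left_translate G g (sig (T (sig f)))"
    by (simp add: sig_left_translate left_invariantD(3)[OF T] involution_carrier sig_A involution_twice)
qed

text \<open>Because \<sigma> is its own inverse, the differential is conjugation by the pullback
  along \<sigma>. In this form its compatibility with brackets and traces is easy to see.\<close>

lemma differential_eq:
  assumes D: "D \<in> lie_algebra G A"
  shows "differential G A \<sigma> D = (\<lambda>f. if f \<in> A then sig (D (sig f)) else 0)"
proof (intro ext)
  fix f g
  note L = lieD(4)[OF D]
  show "differential G A \<sigma> D f g = (if f \<in> A then sig (D (sig f)) else 0) g"
  proof (cases "f \<in> A \<and> g \<in> carrier G")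
    case True
    then have fg: "f \<in> A" "g \<in> carrier G" "\<sigma> g \<in> carrier G" "\<sigma> (inv g) \<in> carrier G"
      using involution_carrier by auto
    have "D (sig (left_translate G (inv g) f)) \<one> = D (left_translate G (\<sigma> (inv g)) (sig f)) \<one>"
      using fg by (simp add: sig_left_translate)
    also have "\<dots> = D (sig f) (\<sigma> g)"
      using fg by (simp add: left_invariantD(3)[OF L] sig_A left_translate_apply involution_inv)
    finally show ?thesis
      using fg by (simp add: differential_def pullback_def)
  next
    case False
    then show ?thesis
      by (auto simp: differential_def pullback_def fun_apply)
  qed
qed

lemma differential_lie:
  assumes D: "D \<in> lie_algebra G A"
  shows "differential G A \<sigma> D \<in> lie_algebra G A"
  unfolding differential_eq[OF D]
proof (rule lieI)
  show "left_invariant (\<lambda>f. if f \<in> A then sig (D (sig f)) else 0)"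
    using sig_conjugate_left_invariant[OF lieD(4)[OF D]] left_translate_A
    by (auto simp: left_invariant_def fn.endo_on_def A_closed A_scale)
  show "(if f * g \<in> A then sig (D (sig (f * g))) else 0) =
      (if f \<in> A then sig (D (sig f)) else 0) * g + f * (if g \<in> A then sig (D (sig g)) else 0)"
    if "f \<in> A" "g \<in> A" for f g
    using that by (simp add: A_closed sig_linear lieD(3)[OF D] sig_A sig_twice)
qed auto

lemma differential_apply: "D \<in> lie_algebra G A \<Longrightarrow> f \<in> A \<Longrightarrow> differential G A \<sigma> D f = sig (D (sig f))"
  by (simp add: differential_eq)

lemma differential_linear:
  assumes "D \<in> lie_algebra G A" "E \<in> lie_algebra G A"
  shows "differential G A \<sigma> (scale c D + E) = scale c (differential G A \<sigma> D) + differential G A \<sigma> E"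
proof (rule lie_eqI)
  note lc = opr.subspace_add[OF lie_subspace] opr.subspace_scale[OF lie_subspace]
  show "differential G A \<sigma> (scale c D + E) \<in> lie_algebra G A"
    "scale c (differential G A \<sigma> D) + differential G A \<sigma> E \<in> lie_algebra G A"
    using assms by (auto intro!: differential_lie lc)
  fix f assume f: "f \<in> A"
  have "scale c D + E \<in> lie_algebra G A"
    using assms by (intro lc)
  then show "differential G A \<sigma> (scale c D + E) f = (scale c (differential G A \<sigma> D) + differential G A \<sigma> E) f"
    using f assms by (simp add: differential_apply op_apply sig_linear)
qed

lemma differential_twice:
  assumes D: "D \<in> lie_algebra G A"
  shows "differential G A \<sigma> (differential G A \<sigma> D) = D"
proof (rule lie_eqI)
  fix f assume f: "f \<in> A"
  show "differential G A \<sigma> (differential G A \<sigma> D) f = D f"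
    using f by (simp add: differential_apply[OF differential_lie[OF D]] differential_apply[OF D] sig_A
        sig_twice lie_A[OF D])
qed (use D differential_lie in auto)

lemma differential_bracket:
  assumes D: "D \<in> lie_algebra G A" and E: "E \<in> lie_algebra G A"
  shows "differential G A \<sigma> (lie_bracket D E) = lie_bracket (differential G A \<sigma> D) (differential G A \<sigma> E)"
proof (rule lie_eqI)
  fix f assume f: "f \<in> A"
  show "differential G A \<sigma> (lie_bracket D E) f = lie_bracket (differential G A \<sigma> D) (differential G A \<sigma> E) f"
    unfolding lie_bracket_def[of "differential G A \<sigma> D"] differential_apply[OF lie_bracket_closed[OF D E] f]
    using f by (simp add: differential_apply[OF D] differential_apply[OF E] sig_A sig_twice lie_A[OF D] lie_A[OF E]
        lie_bracket_def sig_linear)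
qed (use D E in \<open>auto intro!: differential_lie lie_bracket_closed\<close>)

lemma bracket_eigen:
  assumes D: "D \<in> lie_algebra G A" "differential G A \<sigma> D = scale c D"
    and E: "E \<in> lie_algebra G A" "differential G A \<sigma> E = scale d E"
  shows "differential G A \<sigma> (lie_bracket D E) = scale (c * d) (lie_bracket D E)"
proof -
  have 0: "0 \<in> lie_algebra G A"
    by (rule opr.subspace_0[OF lie_subspace])
  have br0: "lie_bracket 0 H = 0" if "H \<in> lie_algebra G A" for H
    using left_invariant_apply lie_endo[OF that] fn.endo_on_zero[OF lie_endo[OF that] A_subspace]
    by (intro ext) (simp add: lie_bracket_def op_apply)
  have left: "lie_bracket (scale c D) H = scale c (lie_bracket D H)" if "H \<in> lie_algebra G A" for H
    using lie_bracket_bilinear(1)[OF D(1) 0 that, of c] br0[OF that] by simp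
  have right: "lie_bracket D (scale d E) = scale d (lie_bracket D E)"
    using lie_bracket_bilinear(2)[OF E(1) 0 D(1), of d] lie_bracket_comm[of D 0] br0[OF D(1)] by simp
  have "scale d E \<in> lie_algebra G A"
    using E(1) by (rule opr.subspace_scale[OF lie_subspace])
  then show ?thesis
    unfolding differential_bracket[OF D(1) E(1)] D(2) E(2) by (simp add: left right)
qed

end

end

section \<open>Compatibility of the trace form with an involution\<close>

context generated_alg_group
begin

text \<open>Pulling back \<open>T f\<close> gives the conjugate of \<open>T\<close>, again left
  invariant, applied to the pullback of \<open>f\<close>, which lies in \<open>F\<close>
  again.\<close>

lemma sig_module:
  assumes \<sigma>: "group_involution G A \<sigma>" and F': "pullback (carrier G) \<sigma> ` F \<subseteq> F"
  shows "fn.endo_on V (pullback (carrier G) \<sigma>)"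
proof -
  have "f \<in> A \<and> pullback (carrier G) \<sigma> f \<in> V" if "f \<in> V" for f
    using that unfolding module_of_def
  proof (induction f rule: fn.span_induct_alt)
    case base
    have "pullback (carrier G) \<sigma> 0 = (0 :: 'g \<Rightarrow> 'k)"
      by (auto simp: pullback_def fun_eq_iff fun_apply)
    then show ?case
      using fn.span_zero fn.subspace_0[OF A_subspace] by simp
  next
    case (step c x y)
    from step.hyps obtain T f where x: "x = T f" "left_invariant T" "f \<in> F"
      by blast
    have fA: "f \<in> A"
      using x(3) F_A by blast
    define S where "S = (\<lambda>f. pullback (carrier G) \<sigma> (T (pullback (carrier G) \<sigma> f)))"
    define h where "h = pullback (carrier G) \<sigma> f"
    have S: "left_invariant S"
      unfolding S_def by (rule sig_conjugate_left_invariant[OF \<sigma> x(2)])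
    have h: "h \<in> F"
      using F' x(3) by (auto simp: h_def)
    have Sh: "pullback (carrier G) \<sigma> x = S h"
      by (simp add: S_def h_def x(1) sig_twice[OF \<sigma> fA])
    have "pullback (carrier G) \<sigma> x \<in> {T f | T f. left_invariant T \<and> f \<in> F}"
      by (rule CollectI, rule exI[of _ S], rule exI[of _ h], rule conjI[OF Sh conjI[OF S h]])
    then have "pullback (carrier G) \<sigma> x \<in> fn.span {T f | T f. left_invariant T \<and> f \<in> F}"
      by (rule fn.span_base)
    then show ?case
      using step.IH left_invariantD(2)[OF x(2) fA]
      by (simp add: sig_linear[OF \<sigma>] fn.span_add fn.span_scale A_closed A_scale x(1))
  qed
  then show ?thesis
    by (simp add: fn.endo_on_def sig_linear[OF \<sigma>])
qed

text \<open>Both operators are conjugated by the same involution of \<open>V\<close>, which leaves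
  the trace of their product unchanged.\<close>

lemma form_differential:
  assumes \<sigma>: "group_involution G A \<sigma>" "pullback (carrier G) \<sigma> ` F \<subseteq> F" and D: "D \<in> lie" and E: "E \<in> lie"
  shows "form (differential G A \<sigma> D) (differential G A \<sigma> E) = form D E"
proof -
  let ?s = "pullback (carrier G) \<sigma>"
  note s = sig_module[OF \<sigma>]
  note e = lie_V_endo[OF D] lie_V_endo[OF E]
  have "form (differential G A \<sigma> D) (differential G A \<sigma> E) = fn.trace basis (\<lambda>f. ?s (D (E (?s f))))"
    unfolding form_def
  proof (rule trace_V_cong)
    fix f assume "f \<in> V"
    then have f: "f \<in> A"
      using V_A by blast
    then show "differential G A \<sigma> D (differential G A \<sigma> E f) = ?s (D (E (?s f)))"
      by (simp add: differential_apply[OF \<sigma>(1) D] differential_apply[OF \<sigma>(1) E] sig_A[OF \<sigma>(1)]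
          sig_twice[OF \<sigma>(1)] lie_A[OF E])
  qed
  also have "\<dots> = fn.trace basis (\<lambda>f. D (E (?s (?s f))))"
    by (rule trace_V_comm[OF s fn.endo_on_comp[OF e(1) fn.endo_on_comp[OF e(2) s]]])
  also have "\<dots> = form D E"
    unfolding form_def by (rule trace_V_cong) (use V_A sig_twice[OF \<sigma>(1)] in \<open>simp add: subset_iff\<close>)
  finally show ?thesis .
qed

text \<open>\<open>E'\<close> is the component of \<open>E\<close> in the eigenspace of the sign
  \<open>c\<close>. The component in the opposite eigenspace is orthogonal to \<open>D\<close>
  because the form is invariant.\<close>

lemma form_projection:
  assumes \<sigma>: "group_involution G A \<sigma>" "pullback (carrier G) \<sigma> ` F \<subseteq> F" and c: "c * c = 1"
    and D: "D \<in> lie" "differential G A \<sigma> D = scale c D" and E: "E \<in> lie"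
  defines "E' \<equiv> scale (1 / 2) (scale c (differential G A \<sigma> E) + E)"
  shows "E' \<in> lie" "differential G A \<sigma> E' = scale c E'" "form D E' = form D E"
proof -
  let ?d = "differential G A \<sigma>"
  note dE = differential_lie[OF \<sigma>(1) E]
  define S where "S = scale c (?d E) + E"
  have S: "S \<in> lie"
    unfolding S_def using dE E by (intro opr.subspace_add[OF lie_subspace] opr.subspace_scale[OF lie_subspace])
  have E': "E' = scale (1 / 2) S + 0"
    by (simp add: E'_def S_def)
  have 0: "0 \<in> lie"
    by (rule opr.subspace_0[OF lie_subspace])
  show "E' \<in> lie"
    unfolding E'_def S_def[symmetric] by (rule opr.subspace_scale[OF lie_subspace S])
  have "?d 0 = scale 1 (?d 0) + ?d 0"
    using differential_linear[OF \<sigma>(1) 0 0, of 1] by simp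
  then have d0: "?d 0 = 0"
    by simp
  have "?d S = scale c E + ?d E"
    unfolding S_def using differential_linear[OF \<sigma>(1) dE E] differential_twice[OF \<sigma>(1) E] by simp
  also have "\<dots> = scale c S"
    using c by (simp add: S_def opr.scale_right_distrib add.commute)
  finally show "?d E' = scale c E'"
    using differential_linear[OF \<sigma>(1) S 0, of "1 / 2"] d0 by (simp add: E' mult.commute)
  have "form (?d E) D = form (?d (?d E)) (?d D)"
    by (rule form_differential[OF \<sigma> dE D(1), symmetric])
  also have "\<dots> = form (scale c D) E"
    using differential_twice[OF \<sigma>(1) E] D(2) form_comm[OF E differential_lie[OF \<sigma>(1) D(1)]] by simp
  also have "\<dots> = c * form D E"
    by (rule form_scale[OF D(1) E])
  finally have "form (?d E) D = c * form D E" .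
  then have "form S D = c * (c * form D E) + form D E"
    unfolding S_def using form_add[OF opr.subspace_scale[OF lie_subspace dE] E D(1)] form_scale[OF dE D(1)]
      form_comm[OF E D(1)] by simp
  also have "c * (c * form D E) + form D E = 2 * form D E"
    by (simp add: c flip: mult.assoc)
  finally have "form E' D = form D E"
    using form_scale[OF S D(1), of "1 / 2"] by (simp add: E')
  then show "form D E' = form D E"
    using form_comm[OF \<open>E' \<in> lie\<close> D(1)] by simp
qed

end

section \<open>The joint eigenspaces of two commuting involutions\<close>

locale two_involutions = generated_alg_group G A F
  for G :: "('g, 'm) monoid_scheme" (structure) and A :: "('g \<Rightarrow> 'k::{alg_closed_field, field_char_0}) set"
    and F +
  fixes \<sigma>1 \<sigma>2 :: "'g \<Rightarrow> 'g"
  assumes \<sigma>1: "group_involution G A \<sigma>1" "pullback (carrier G) \<sigma>1 ` F \<subseteq> F"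
    and \<sigma>2: "group_involution G A \<sigma>2" "pullback (carrier G) \<sigma>2 ` F \<subseteq> F"
    and commute: "\<And>x. x \<in> carrier G \<Longrightarrow> \<sigma>1 (\<sigma>2 x) = \<sigma>2 (\<sigma>1 x)"
    and reductive: "connected_reductive_group G A"
begin

abbreviation part :: "nat \<Rightarrow> nat \<Rightarrow> ('g, 'k) operator set" where
  "part i j \<equiv> eigen_part G A \<sigma>1 \<sigma>2 i j"

lemma partD:
  assumes "D \<in> part i j"
  shows "D \<in> lie" "differential G A \<sigma>1 D = scale ((-1) ^ i) D" "differential G A \<sigma>2 D = scale ((-1) ^ j) D"
  using assms by (simp_all add: eigen_part_def)

lemma differential_0: "group_involution G A \<sigma> \<Longrightarrow> differential G A \<sigma> 0 = 0"
proof -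
  assume \<sigma>: "group_involution G A \<sigma>"
  have "differential G A \<sigma> (scale 1 0 + 0) = scale 1 (differential G A \<sigma> 0) + differential G A \<sigma> 0"
    by (rule differential_linear[OF \<sigma> opr.subspace_0[OF lie_subspace] opr.subspace_0[OF lie_subspace]])
  then show ?thesis
    by simp
qed

lemma eigen_subspace:
  assumes \<sigma>: "group_involution G A \<sigma>"
  shows "opr.subspace {D \<in> lie. differential G A \<sigma> D = scale c D}"
proof (rule opr.subspaceI)
  show "0 \<in> {D \<in> lie. differential G A \<sigma> D = scale c D}"
    using opr.subspace_0[OF lie_subspace] differential_0[OF \<sigma>] by simp
  fix D E assume D: "D \<in> {D \<in> lie. differential G A \<sigma> D = scale c D}"
    and E: "E \<in> {D \<in> lie. differential G A \<sigma> D = scale c D}"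
  show "D + E \<in> {D \<in> lie. differential G A \<sigma> D = scale c D}"
    using D E differential_linear[OF \<sigma>, of D E 1] opr.subspace_add[OF lie_subspace]
    by (simp add: opr.scale_right_distrib)
next
  fix a D assume D: "D \<in> {D \<in> lie. differential G A \<sigma> D = scale c D}"
  then have "differential G A \<sigma> (scale a D + 0) = scale c (scale a D)"
    using differential_linear[OF \<sigma> _ opr.subspace_0[OF lie_subspace], of D a] differential_0[OF \<sigma>]
    by (simp add: mult.commute)
  then show "scale a D \<in> {D \<in> lie. differential G A \<sigma> D = scale c D}"
    using D opr.subspace_scale[OF lie_subspace] by simp
qed

lemma part_subspace: "opr.subspace (part i j)"
proof -
  have "part i j = {D \<in> lie. differential G A \<sigma>1 D = scale ((-1) ^ i) D} \<inter>
      {D \<in> lie. differential G A \<sigma>2 D = scale ((-1) ^ j) D}"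
    by (auto simp: eigen_part_def)
  then show ?thesis
    using opr.subspace_inter[OF eigen_subspace[OF \<sigma>1(1)] eigen_subspace[OF \<sigma>2(1)]] by simp
qed

lemma part_finite_dimensional: "\<exists>T. finite T \<and> part i j \<subseteq> opr.span T"
proof -
  obtain T where T: "finite T" "lie \<subseteq> opr.span T"
    using lie_finite_dimensional by (elim exE conjE)
  have "part i j \<subseteq> lie"
    using partD(1) by (rule subsetI)
  then show ?thesis
    using T by (intro exI[of _ T] conjI) (rule T(1), rule subset_trans)
qed

text \<open>Eigenvalues multiply under the bracket, so the indices add modulo 2; the parity
  hypotheses express this for natural numbers.\<close>

lemma bracket_part:
  assumes D: "D \<in> part i j" and E: "E \<in> part i' j'" and "even (i + i' + k)" "even (j + j' + l)"
  shows "lie_bracket D E \<in> part k l"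
proof -
  note D' = partD[OF D] and E' = partD[OF E]
  have sign: "(-1) ^ a * (-1) ^ b = (-1 :: 'k) ^ c" if "even (a + b + c)" for a b c :: nat
    using that by (cases "even a"; cases "even b"; cases "even c") auto
  show ?thesis
    unfolding eigen_part_def
    using bracket_eigen[OF \<sigma>1(1) D'(1,2) E'(1,2)] bracket_eigen[OF \<sigma>2(1) D'(1,3) E'(1,3)]
      sign[OF assms(3)] sign[OF assms(4)] lie_bracket_closed[OF D'(1) E'(1)] by simp
qed

lemma differential_commute:
  assumes D: "D \<in> lie"
  shows "differential G A \<sigma>1 (differential G A \<sigma>2 D) = differential G A \<sigma>2 (differential G A \<sigma>1 D)"
proof (rule lie_eqI)
  let ?s1 = "pullback (carrier G) \<sigma>1" and ?s2 = "pullback (carrier G) \<sigma>2"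
  have s: "?s1 (?s2 f) = ?s2 (?s1 f)" for f :: "'g \<Rightarrow> 'k"
    using commute involution_carrier[OF \<sigma>1(1)] involution_carrier[OF \<sigma>2(1)]
    by (auto simp: pullback_def)
  fix f assume f: "f \<in> A"
  show "differential G A \<sigma>1 (differential G A \<sigma>2 D) f = differential G A \<sigma>2 (differential G A \<sigma>1 D) f"
    using f by (simp add: differential_apply[OF \<sigma>1(1)] differential_apply[OF \<sigma>2(1)] D
        differential_lie[OF \<sigma>1(1)] differential_lie[OF \<sigma>2(1)] sig_A[OF \<sigma>1(1)] sig_A[OF \<sigma>2(1)] s)
qed (use D differential_lie[OF \<sigma>1(1)] differential_lie[OF \<sigma>2(1)] in auto)

text \<open>Nondegeneracy on the whole Lie algebra passes to a joint eigenspace: an arbitrary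
  \<open>E\<close> may be replaced by its projection without changing the pairing with
  \<open>D\<close>.\<close>

lemma part_nondegenerate:
  assumes D: "D \<in> part i j" and zero: "\<And>E. E \<in> part i j \<Longrightarrow> form D E = 0"
  shows "D = 0"
proof (rule form_nondegenerate[OF reductive])
  note D' = partD[OF D]
  show "D \<in> lie"
    by (rule D'(1))
  fix E assume E: "E \<in> lie"
  define c where "c = ((-1) ^ i :: 'k)"
  define d where "d = ((-1) ^ j :: 'k)"
  have cd: "c * c = 1" "d * d = 1"
    by (simp_all add: c_def d_def flip: power_mult_distrib)
  define E1 where "E1 = scale (1 / 2) (scale c (differential G A \<sigma>1 E) + E)"
  define E2 where "E2 = scale (1 / 2) (scale d (differential G A \<sigma>2 E1) + E1)"
  have E1: "E1 \<in> lie" "differential G A \<sigma>1 E1 = scale c E1" "form D E1 = form D E"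
    unfolding E1_def using form_projection[OF \<sigma>1 cd(1) D'(1) _ E] D'(2) by (simp_all add: c_def)
  have E2: "E2 \<in> lie" "differential G A \<sigma>2 E2 = scale d E2" "form D E2 = form D E1"
    unfolding E2_def using form_projection[OF \<sigma>2 cd(2) D'(1) _ E1(1)] D'(3) by (simp_all add: d_def)
  \<comment> \<open>The second projection must not leave the first eigenspace; this is where the two
    differentials have to commute.\<close>
  have "differential G A \<sigma>2 E1 \<in> {D \<in> lie. differential G A \<sigma>1 D = scale c D}"
  proof -
    have 0: "0 \<in> lie"
      by (rule opr.subspace_0[OF lie_subspace])
    have "differential G A \<sigma>1 (differential G A \<sigma>2 E1) = differential G A \<sigma>2 (scale c E1 + 0)"
      using differential_commute[OF E1(1)] E1(2) by simp
    also have "\<dots> = scale c (differential G A \<sigma>2 E1)"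
      using differential_linear[OF \<sigma>2(1) E1(1) 0, of c] differential_0[OF \<sigma>2(1)] by simp
    finally show ?thesis
      using differential_lie[OF \<sigma>2(1) E1(1)] by simp
  qed
  then have "E2 \<in> {D \<in> lie. differential G A \<sigma>1 D = scale c D}"
    unfolding E2_def using E1(1,2)
    by (intro opr.subspace_scale[OF eigen_subspace[OF \<sigma>1(1)]] opr.subspace_add[OF eigen_subspace[OF \<sigma>1(1)]]) auto
  then have "E2 \<in> part i j"
    using E2(1,2) by (simp add: eigen_part_def c_def d_def)
  then have "form D E2 = 0"
    by (rule zero)
  then show "form D E = 0"
    using E1(3) E2(3) by simp
qed

lemma form_bracket_swap:
  assumes "x \<in> lie" "y \<in> lie" "z \<in> lie"
  shows "form z (lie_bracket x y) = form (lie_bracket z x) y"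
  by (rule form_invariant[OF assms(3,1,2), symmetric])

text \<open>
  By invariance of the form, the orthogonal complement of the image of the differential of the
  commutator map at \<open>(x, y)\<close> consists of the elements commuting with \<open>x\<close> and \<open>y\<close>.
\<close>

lemma differential_onto_iff:
  assumes x: "x \<in> part 1 0" and y: "y \<in> part 1 1"
  shows "(\<forall>w\<in>part 0 1. \<exists>\<xi>\<in>part 1 0. \<exists>\<eta>\<in>part 1 1. lie_bracket x \<eta> + lie_bracket \<xi> y = w) \<longleftrightarrow>
    (\<forall>z\<in>part 0 1. lie_bracket x z = 0 \<and> lie_bracket y z = 0 \<longrightarrow> z = 0)"
proof
  assume onto: "\<forall>w\<in>part 0 1. \<exists>\<xi>\<in>part 1 0. \<exists>\<eta>\<in>part 1 1. lie_bracket x \<eta> + lie_bracket \<xi> y = w"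
  show "\<forall>z\<in>part 0 1. lie_bracket x z = 0 \<and> lie_bracket y z = 0 \<longrightarrow> z = 0"
  proof (intro ballI impI)
    fix z assume z: "z \<in> part 0 1" "lie_bracket x z = 0 \<and> lie_bracket y z = 0"
    note l = partD(1)[OF x] partD(1)[OF y] partD(1)[OF z(1)]
    have form_0: "form 0 E = 0" "form E 0 = 0" if "E \<in> lie" for E
      using form_scale[OF opr.subspace_0[OF lie_subspace] that, of 0]
        form_comm[OF opr.subspace_0[OF lie_subspace] that] by simp_all
    have zx: "lie_bracket z x = 0" "lie_bracket z y = 0"
      using z(2) lie_bracket_comm[of z x] lie_bracket_comm[of z y] by simp_all
    show "z = 0"
    proof (rule part_nondegenerate[OF z(1)])
      fix w assume "w \<in> part 0 1"
      then obtain \<xi> \<eta> where w: "\<xi> \<in> part 1 0" "\<eta> \<in> part 1 1" "lie_bracket x \<eta> + lie_bracket \<xi> y = w"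
        using onto by meson
      note m = partD(1)[OF w(1)] partD(1)[OF w(2)]
      have b: "lie_bracket x \<eta> \<in> lie" "lie_bracket \<xi> y \<in> lie" "lie_bracket y \<xi> \<in> lie"
        using l m by (simp_all add: lie_bracket_closed)
      have "form z (lie_bracket x \<eta>) = 0"
        using form_bracket_swap[OF l(1) m(2) l(3)] zx form_0(1)[OF m(2)] by simp
      moreover have "form z (lie_bracket y \<xi>) = 0"
        using form_bracket_swap[OF l(2) m(1) l(3)] zx form_0(1)[OF m(1)] by simp
      moreover have "form z (lie_bracket \<xi> y) = - form z (lie_bracket y \<xi>)"
      proof -
        have "lie_bracket \<xi> y = scale (-1) (lie_bracket y \<xi>)"
          using lie_bracket_comm[of \<xi> y] by simp
        then show ?thesis
          using form_comm[OF l(3)] b form_scale[OF b(3) l(3), of "-1"] by simp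
      qed
      moreover have "form z w = form z (lie_bracket x \<eta>) + form z (lie_bracket \<xi> y)"
        using w(3) form_add[OF b(1,2) l(3)] form_comm[OF l(3)] b opr.subspace_add[OF lie_subspace b(1,2)]
        by auto
      ultimately show "form z w = 0"
        by simp
    qed
  qed
next
  assume inj: "\<forall>z\<in>part 0 1. lie_bracket x z = 0 \<and> lie_bracket y z = 0 \<longrightarrow> z = 0"
  note l = partD(1)[OF x] partD(1)[OF y]
  \<comment> \<open>The image of the differential at \<open>(x, y)\<close>, which has to fill
    \<open>part 0 1\<close>.\<close>
  define I where "I = {lie_bracket x \<eta> + lie_bracket \<xi> y | \<xi> \<eta>. \<xi> \<in> part 1 0 \<and> \<eta> \<in> part 1 1}"
  have I_part: "I \<subseteq> part 0 1"
    using bracket_part[OF x _, of _ 1 1 0 1] bracket_part[OF _ y, of _ 1 0 0 1]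
    by (auto simp: I_def intro!: opr.subspace_add[OF part_subspace])
  have I_sub: "opr.subspace I"
  proof -
    have 0: "0 \<in> part i j" for i j
      by (rule opr.subspace_0[OF part_subspace])
    have lin: "scale c v + v' \<in> I" if v: "v \<in> I" "v' \<in> I" for c v v'
    proof -
      obtain \<xi> \<eta> \<xi>' \<eta>' where *: "\<xi> \<in> part 1 0" "\<eta> \<in> part 1 1" "v = lie_bracket x \<eta> + lie_bracket \<xi> y"
        "\<xi>' \<in> part 1 0" "\<eta>' \<in> part 1 1" "v' = lie_bracket x \<eta>' + lie_bracket \<xi>' y"
        using v unfolding I_def by auto
      have "scale c v + v' = lie_bracket x (scale c \<eta> + \<eta>') + lie_bracket (scale c \<xi> + \<xi>') y"
        using lie_bracket_bilinear(2)[OF partD(1)[OF *(2)] partD(1)[OF *(5)] l(1), of c]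
          lie_bracket_bilinear(1)[OF partD(1)[OF *(1)] partD(1)[OF *(4)] l(2), of c]
        by (simp add: *(3,6) opr.scale_right_distrib algebra_simps)
      moreover have "scale c \<eta> + \<eta>' \<in> part 1 1" "scale c \<xi> + \<xi>' \<in> part 1 0"
        using * by (auto intro!: opr.subspace_add[OF part_subspace] opr.subspace_scale[OF part_subspace])
      ultimately show ?thesis
        unfolding I_def by blast
    qed
    have "lie_bracket x 0 + lie_bracket 0 y \<in> I"
      unfolding I_def using 0 by blast
    then have "scale (-1) (lie_bracket x 0 + lie_bracket 0 y) + (lie_bracket x 0 + lie_bracket 0 y) \<in> I"
      using lin by blast
    then have zero: "0 \<in> I"
      by simp
    show ?thesis
    proof (rule opr.subspaceI)
      show "0 \<in> I"
        by (rule zero)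
      show "v + v' \<in> I" if "v \<in> I" "v' \<in> I" for v v'
        using lin[OF that, of 1] by simp
      show "scale c v \<in> I" if "v \<in> I" for c v
        using lin[OF that zero, of c] by simp
    qed
  qed
  have "part 0 1 \<subseteq> I"
  proof (rule ccontr)
    assume not: "\<not> part 0 1 \<subseteq> I"
    obtain BI where BI: "BI \<subseteq> I" "opr.independent BI" "I \<subseteq> opr.span BI"
      using opr.maximal_independent_subset by metis
    obtain T where T: "finite T" "part 0 1 \<subseteq> opr.span T"
      using part_finite_dimensional by metis
    obtain BW where BW: "BI \<subseteq> BW" "BW \<subseteq> part 0 1" "opr.independent BW" "part 0 1 \<subseteq> opr.span BW"
      using opr.maximal_independent_subset_extend[OF subset_trans[OF BI(1) I_part] BI(2)] by metis
    have fin: "finite BW"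
      using opr.independent_span_bound[OF T(1) BW(3)] BW(2) T(2) by auto
    have "BI \<noteq> BW"
      using not BI(1) BW(4) opr.span_minimal[OF BI(1) I_sub] by auto
    then have "card BI < card BW"
      using BW(1) fin by (intro psubset_card_mono) auto
    \<comment> \<open>A basis of a proper image imposes fewer orthogonality conditions than there
      are coordinates on \<open>part 0 1\<close>, so a nonzero \<open>z\<close> orthogonal to the
      image remains.\<close>
    from homogeneous_system[OF finite_subset[OF BW(1) fin] fin this, of "\<lambda>b z. form z b"]
    obtain c where c: "(\<exists>z\<in>BW. c z \<noteq> 0) \<and> (\<forall>b\<in>BI. (\<Sum>z\<in>BW. form z b * c z) = 0)"
      by (rule exE)
    define z where "z = (\<Sum>b\<in>BW. scale (c b) b)"
    have z: "z \<in> part 0 1"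
      unfolding z_def using BW(2)
      by (intro opr.subspace_sum[OF part_subspace] opr.subspace_scale[OF part_subspace]) auto
    note lz = partD(1)[OF z]
    have "z \<noteq> 0"
      using conjunct1[OF c] opr.independentD[OF BW(3) fin subset_refl, of c] by (auto simp: z_def)
    have form_sum: "form (\<Sum>b\<in>J. scale (c b) b) v = (\<Sum>b\<in>J. c b * form b v)"
      if J: "J \<subseteq> BW" and v: "v \<in> lie" for J v
      using finite_subset[OF J fin] J
    proof (induction J rule: finite_induct)
      case empty
      show ?case
        using form_scale[OF opr.subspace_0[OF lie_subspace] v, of 0] by simp
    next
      case (insert b J)
      have b: "b \<in> lie"
        using insert.prems BW(2) partD(1) by blast
      have "(\<Sum>b\<in>J. scale (c b) b) \<in> lie"
        using insert.prems BW(2) partD(1)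
        by (intro opr.subspace_sum[OF lie_subspace] opr.subspace_scale[OF lie_subspace]) blast
      then show ?case
        using insert form_add[OF opr.subspace_scale[OF lie_subspace b] _ v] form_scale[OF b v] by simp
    qed
    have I_lie: "v \<in> lie" if "v \<in> I" for v
      using that I_part partD(1) by blast
    have BI_zero: "form z b = 0" if b: "b \<in> BI" for b
    proof -
      have "form z b = (\<Sum>a\<in>BW. c a * form a b)"
        unfolding z_def by (rule form_sum[OF subset_refl I_lie]) (use b BI(1) in blast)
      then show ?thesis
        using bspec[OF conjunct2[OF c] b] by (simp add: mult.commute)
    qed
    have I_zero: "form z v = 0" if v: "v \<in> I" for v
    proof -
      have "v \<in> opr.span BI"
        using BI(3) v by (rule subsetD)
      then have "v \<in> lie \<and> form v z = 0"
      proof (induction v rule: opr.span_induct_alt)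
        case base
        show ?case
          using opr.subspace_0[OF lie_subspace] form_scale[OF opr.subspace_0[OF lie_subspace] lz, of 0] by simp
      next
        case (step a b v)
        have b: "b \<in> lie" "form b z = 0"
          using step.hyps BI(1) I_lie BI_zero[OF step.hyps] form_comm[OF lz] by auto
        have ab: "scale a b \<in> lie"
          by (rule opr.subspace_scale[OF lie_subspace b(1)])
        show ?case
          using step.IH form_add[OF ab _ lz] form_scale[OF b(1) lz, of a] b(2) opr.subspace_add[OF lie_subspace ab]
          by simp
      qed
      then show ?thesis
        using form_comm[OF lz] by simp
    qed
    \<comment> \<open>With \<xi> = 0, invariance turns the orthogonality of \<open>z\<close> and
      \<open>[x, \<eta>]\<close> into that of \<open>[z, x]\<close> and \<eta>, and the form is
      nondegenerate on \<open>part 1 1\<close>.\<close>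
    have "lie_bracket z x = 0"
    proof (rule part_nondegenerate)
      show "lie_bracket z x \<in> part 1 1"
        using bracket_part[OF z x, of 1 1] by simp
      fix \<eta> assume \<eta>: "\<eta> \<in> part 1 1"
      have "lie_bracket x \<eta> + lie_bracket 0 y \<in> I"
        unfolding I_def using \<eta> opr.subspace_0[OF part_subspace] by blast
      moreover have "lie_bracket 0 y = 0"
        using lie_bracket_bilinear(1)[OF opr.subspace_0[OF lie_subspace] opr.subspace_0[OF lie_subspace] l(2), of 1]
        by simp
      ultimately show "form (lie_bracket z x) \<eta> = 0"
        using I_zero form_bracket_swap[OF l(1) partD(1)[OF \<eta>] lz] by simp
    qed
    moreover have "lie_bracket z y = 0"
    proof (rule part_nondegenerate)
      show "lie_bracket z y \<in> part 1 0"
        using bracket_part[OF z y, of 1 0] by simp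
      fix \<xi> assume \<xi>: "\<xi> \<in> part 1 0"
      have "lie_bracket x 0 + lie_bracket \<xi> y \<in> I"
        unfolding I_def using \<xi> opr.subspace_0[OF part_subspace] by blast
      moreover have "lie_bracket x 0 = 0"
        using lie_bracket_bilinear(2)[OF opr.subspace_0[OF lie_subspace] opr.subspace_0[OF lie_subspace] l(1), of 1]
        by simp
      moreover have "lie_bracket y \<xi> = scale (-1) (lie_bracket \<xi> y)"
        using lie_bracket_comm[of y \<xi>] by simp
      moreover have "form z (scale (-1) (lie_bracket \<xi> y)) = - form z (lie_bracket \<xi> y)"
      proof -
        have q: "lie_bracket \<xi> y \<in> lie"
          by (rule lie_bracket_closed[OF partD(1)[OF \<xi>] l(2)])
        show ?thesis
          unfolding form_comm[OF lz opr.subspace_scale[OF lie_subspace q]] form_scale[OF q lz] form_comm[OF lz q]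
          by simp
      qed
      ultimately show "form (lie_bracket z y) \<xi> = 0"
        using I_zero form_bracket_swap[OF l(2) partD(1)[OF \<xi>] lz] by simp
    qed
    ultimately have "lie_bracket x z = 0 \<and> lie_bracket y z = 0"
      using lie_bracket_comm[of x z] lie_bracket_comm[of y z] by simp
    then show False
      using inj z \<open>z \<noteq> 0\<close> by blast
  qed
  then show "\<forall>w\<in>part 0 1. \<exists>\<xi>\<in>part 1 0. \<exists>\<eta>\<in>part 1 1. lie_bracket x \<eta> + lie_bracket \<xi> y = w"
    unfolding I_def by blast
qed

lemma dominant_iff_centralisers:
  "dominant (part 1 0 \<times> part 1 1) (part 0 1) (polynomial_functions (part 0 1)) (\<lambda>(x, y). lie_bracket x y) \<longleftrightarrow>
    (\<exists>x\<in>part 1 0. \<exists>y\<in>part 1 1.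
      (lie_centraliser G A x \<inter> part 0 1) \<inter> (lie_centraliser G A y \<inter> part 0 1) = {0})"
proof -
  have "dominant (part 1 0 \<times> part 1 1) (part 0 1) (polynomial_functions (part 0 1)) (\<lambda>(x, y). lie_bracket x y) \<longleftrightarrow>
      (\<exists>x\<in>part 1 0. \<exists>y\<in>part 1 1. \<forall>w\<in>part 0 1. \<exists>\<xi>\<in>part 1 0. \<exists>\<eta>\<in>part 1 1.
        lie_bracket x \<eta> + lie_bracket \<xi> y = w)"
  proof (rule dominant_bilinear_iff[OF part_subspace part_finite_dimensional part_subspace
        part_finite_dimensional part_subspace part_finite_dimensional])
    show "lie_bracket x y \<in> part 0 1" if "x \<in> part 1 0" "y \<in> part 1 1" for x y
      using bracket_part[OF that, of 0 1] by simp
  qed (auto intro: lie_bracket_bilinear partD(1))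
  also have "\<dots> \<longleftrightarrow> (\<exists>x\<in>part 1 0. \<exists>y\<in>part 1 1.
      (lie_centraliser G A x \<inter> part 0 1) \<inter> (lie_centraliser G A y \<inter> part 0 1) = {0})"
  proof (intro bex_cong refl)
    fix x y assume x: "x \<in> part 1 0" and y: "y \<in> part 1 1"
    have "(lie_centraliser G A x \<inter> part 0 1) \<inter> (lie_centraliser G A y \<inter> part 0 1) =
        {z \<in> part 0 1. lie_bracket x z = 0 \<and> lie_bracket y z = 0}"
      using partD(1) by (auto simp: lie_centraliser_def)
    moreover have "lie_bracket v 0 = 0" if "v \<in> lie" for v
      using lie_bracket_bilinear(2)[OF opr.subspace_0[OF lie_subspace] opr.subspace_0[OF lie_subspace] that, of 1]
      by simp
    ultimately show "(\<forall>w\<in>part 0 1. \<exists>\<xi>\<in>part 1 0. \<exists>\<eta>\<in>part 1 1. lie_bracket x \<eta> + lie_bracket \<xi> y = w) \<longleftrightarrow>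
        (lie_centraliser G A x \<inter> part 0 1) \<inter> (lie_centraliser G A y \<inter> part 0 1) = {0}"
      unfolding differential_onto_iff[OF x y]
      using partD(1)[OF x] partD(1)[OF y] opr.subspace_0[OF part_subspace, of 0 1] by auto
  qed
  finally show ?thesis .
qed

end

theorem lemma3p2:
  fixes G :: "('g, 'm) monoid_scheme"
    and A :: "('g \<Rightarrow> 'k::{alg_closed_field, field_char_0}) set"
    and \<sigma>\<^sub>1 \<sigma>\<^sub>2 :: "'g \<Rightarrow> 'g"
  assumes "connected_reductive_group G A"
    and "group_involution G A \<sigma>\<^sub>1" and "group_involution G A \<sigma>\<^sub>2"
    and "\<forall>x\<in>carrier G. \<sigma>\<^sub>1 (\<sigma>\<^sub>2 x) = \<sigma>\<^sub>2 (\<sigma>\<^sub>1 x)"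
    and "\<exists>x\<in>carrier G. \<sigma>\<^sub>1 x \<noteq> \<sigma>\<^sub>2 x"
  shows "dominant (eigen_part G A \<sigma>\<^sub>1 \<sigma>\<^sub>2 1 0 \<times> eigen_part G A \<sigma>\<^sub>1 \<sigma>\<^sub>2 1 1)
           (eigen_part G A \<sigma>\<^sub>1 \<sigma>\<^sub>2 0 1) (polynomial_functions (eigen_part G A \<sigma>\<^sub>1 \<sigma>\<^sub>2 0 1))
           (\<lambda>(x, y). lie_bracket x y)
    \<longleftrightarrow> (\<exists>x \<in> eigen_part G A \<sigma>\<^sub>1 \<sigma>\<^sub>2 1 0. \<exists>y \<in> eigen_part G A \<sigma>\<^sub>1 \<sigma>\<^sub>2 1 1.
          (lie_centraliser G A x \<inter> eigen_part G A \<sigma>\<^sub>1 \<sigma>\<^sub>2 0 1) \<inter>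
          (lie_centraliser G A y \<inter> eigen_part G A \<sigma>\<^sub>1 \<sigma>\<^sub>2 0 1) = {0})"
proof -
  have alg: "algebraic_group G A"
    using assms(1) by (simp add: connected_reductive_group_def)
  interpret alg_group G A
    using alg by (simp add: alg_group_def alg_group_axioms_def algebraic_group_def)
  let ?s1 = "pullback (carrier G) \<sigma>\<^sub>1 :: ('g \<Rightarrow> 'k) \<Rightarrow> 'g \<Rightarrow> 'k"
  let ?s2 = "pullback (carrier G) \<sigma>\<^sub>2 :: ('g \<Rightarrow> 'k) \<Rightarrow> 'g \<Rightarrow> 'k"
  obtain E where E: "finite E" "E \<subseteq> functions_on (carrier G)" "A = generated_algebra (carrier G) E"
    by (rule generators)
  \<comment> \<open>The orbit of the generators under the group generated by the two commuting
    pullbacks, so that both of them preserve \<open>F\<close>.\<close>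
  define F where "F = E \<union> ?s1 ` E \<union> ?s2 ` E \<union> ?s1 ` ?s2 ` E"
  have E_A: "E \<subseteq> A"
    using E(3) by (auto intro: generated_algebra.generator)
  have F_A: "F \<subseteq> A"
    using E_A sig_A[OF assms(2)] sig_A[OF assms(3)] by (auto simp: F_def)
  have s: "?s1 (?s2 f) = ?s2 (?s1 f)" for f
    using assms(4) involution_carrier[OF assms(2)] involution_carrier[OF assms(3)]
    by (auto simp: pullback_def)
  have twice: "?s1 (?s1 f) = f" "?s2 (?s2 f) = f" if "f \<in> E" for f
    using that E_A sig_twice[OF assms(2)] sig_twice[OF assms(3)] by auto
  have twice': "?s1 (?s1 (?s2 f)) = ?s2 f" "?s2 (?s1 (?s2 f)) = ?s1 f" if "f \<in> E" for f
    using twice[OF that] s by metis+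
  have "?s1 ` F \<subseteq> F" "?s2 ` F \<subseteq> F"
    using twice twice' s by (auto simp: F_def image_Un image_image)
  moreover have "A = generated_algebra (carrier G) F"
  proof
    show "A \<subseteq> generated_algebra (carrier G) F"
      using generated_algebra_least[of E "carrier G" F] E(3)
      by (auto simp: F_def intro: generated_algebra.generator)
    show "generated_algebra (carrier G) F \<subseteq> A"
      using generated_algebra_least[of F "carrier G" E] F_A E(3) by auto
  qed
  moreover have "F \<subseteq> functions_on (carrier G)"
    using F_A A_functions by blast
  moreover have "finite F"
    using E(1) by (simp add: F_def)
  ultimately interpret two_involutions G A F \<sigma>\<^sub>1 \<sigma>\<^sub>2
    using assms by unfold_locales auto
  show ?thesis
    by (rule dominant_iff_centralisers)
qed

end
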